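(* Let $M>0$, $\alpha>0$ and $n>0$ be given, and let $u^*$ be the unique minimizer of $E$ on $\mathcal{C}_M$. If $\alpha\le1$, then $u^*$ is the unique strong steady state on $\mathcal{C}_M$ with zero dissipation of the equation $$u_t+\partial_x\left[u^n(u_{xxx}+\alpha^2u_x-\sin x)\right]=0,\qquad x\in\Omega.$$ For $\alpha>1$, there exists for each $M>0$ an energy level $E_1>E(u^* )$ such that $u^*$ is the unique strong steady state with zero dissipation in the sub-level set $\{u\in\mathcal{C}_M\mid E(u)<E_1\}$.
   Context: $\Omega=\mathbb{R}/(2\pi\mathbb{Z})$; $\mathcal{C}_M=\{u\in L^2(\Omega)\mid u\ge0,\ \int_\Omega u\,dx=M\}$. The energy is $E(u)=\frac12\int_\Omega(u_x^2-\alpha^2u^2)\,dx-\int_\Omega u\cos x\,dx$, with $E(u)=\infty$ if $u\notin H^1(\Omega)$; it has a unique minimizer $u^*$ on $\mathcal{C}_M$ for each $M>0$. $P(u)=\{x\in\Omega\mid u(x)>0\}$. A strong steady state is a function $u\in\mathcal{C}_M\cap H^2(\Omega)$ (with $E(u)<\infty$) such that for every smooth $2\pi$-periodic test function $\phi$, $\int_\Omega(u_{xx}+\alpha^2u+\cos x)\,(u^n\phi_x)_x\,dx=0$. The dissipation is $D(u)=\int_{P(u)}u^n(u_{xxx}+\alpha^2u_x-\sin x)^2\,dx$; "zero dissipation" means $u\in H^3_{loc}(P(u))$ and $D(u)=0$. *)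

theory Defs
  imports "HOL-Analysis.Analysis"
begin

text \<open>
  Functions on the circle \<open>\<Omega> = \<real>/(2\<pi>\<int>)\<close> are represented by their \<open>2\<pi>\<close>-periodic lifts
  to the real line, subsets of the circle by their periodic preimages, and integrals over the circle
  by integrals over one period. Elements of Lebesgue and Sobolev spaces are represented
  by Lebesgue measurable functions; equality of such elements is equality almost everywhere.
\<close>

definition circle_periodic :: "(real \<Rightarrow> real) \<Rightarrow> bool" where
  "circle_periodic f \<longleftrightarrow> (\<forall>x. f (x + 2 * pi) = f x)"

abbreviation period :: "real set" where
  "period \<equiv> {-pi..pi}"

definition L2_circle :: "(real \<Rightarrow> real) set" where
  "L2_circle = {u. circle_periodic u \<and> u \<in> borel_measurable lebesgue \<and>
                   set_integrable lebesgue period (\<lambda>x. (u x)\<^sup>2)}"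

definition L1_loc :: "real set \<Rightarrow> (real \<Rightarrow> real) set" where
  "L1_loc U = {v. circle_periodic v \<and>
                  (\<forall>K. compact K \<and> K \<subseteq> U \<longrightarrow> set_integrable lebesgue K v)}"

definition L2_loc :: "real set \<Rightarrow> (real \<Rightarrow> real) set" where
  "L2_loc U = {v. circle_periodic v \<and>
                  (\<forall>K. compact K \<and> K \<subseteq> U \<longrightarrow>
                     set_borel_measurable lebesgue K v \<and>
                     set_integrable lebesgue K (\<lambda>x. (v x)\<^sup>2))}"

definition smooth :: "(real \<Rightarrow> real) \<Rightarrow> bool" where
  "smooth \<phi> \<longleftrightarrow> (\<forall>k. ((deriv ^^ k) \<phi>) differentiable_on UNIV)"

text \<open>
  The smooth functions compactly supported in an open subset \<open>U\<close> of the circle. The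
  lifted support is only required to be closed, since closed subsets of the circle are compact.
  For \<open>U = UNIV\<close> these are all smooth periodic functions.
\<close>

definition test_functions :: "real set \<Rightarrow> (real \<Rightarrow> real) set" where
  "test_functions U = {\<phi>. smooth \<phi> \<and> circle_periodic \<phi> \<and> closure {x. \<phi> x \<noteq> 0} \<subseteq> U}"

definition has_weak_deriv :: "nat \<Rightarrow> real set \<Rightarrow> (real \<Rightarrow> real) \<Rightarrow> (real \<Rightarrow> real) \<Rightarrow> bool" where
  "has_weak_deriv k U u v \<longleftrightarrow>
     u \<in> L1_loc U \<and> v \<in> L1_loc U \<and>
     (\<forall>\<phi> \<in> test_functions U.
        (LINT x:period|lebesgue. u x * (deriv ^^ k) \<phi> x) =
        (-1) ^ k * (LINT x:period|lebesgue. v x * \<phi> x))"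

text \<open>The weak derivative, where it exists, is determined up to a null set in \<open>U\<close>.\<close>

definition weak_deriv :: "nat \<Rightarrow> real set \<Rightarrow> (real \<Rightarrow> real) \<Rightarrow> real \<Rightarrow> real" where
  "weak_deriv k U u = (SOME v. has_weak_deriv k U u v)"

definition H_circle :: "nat \<Rightarrow> (real \<Rightarrow> real) set" where
  "H_circle k = {u \<in> L2_circle. \<forall>j\<le>k. \<exists>v\<in>L2_circle. has_weak_deriv j UNIV u v}"

definition H_loc :: "nat \<Rightarrow> real set \<Rightarrow> (real \<Rightarrow> real) set" where
  "H_loc k U = {u \<in> L2_loc U. \<forall>j\<le>k. \<exists>v\<in>L2_loc U. has_weak_deriv j U u v}"

definition mass_class :: "real \<Rightarrow> (real \<Rightarrow> real) set" where
  "mass_class M = {u \<in> L2_circle. (AE x in lebesgue. 0 \<le> u x) \<and>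
                                  (LINT x:period|lebesgue. u x) = M}"

definition energy :: "real \<Rightarrow> (real \<Rightarrow> real) \<Rightarrow> ereal" where
  "energy \<alpha> u =
     (if u \<in> H_circle 1
      then ereal (1/2 * (LINT x:period|lebesgue. (weak_deriv 1 UNIV u x)\<^sup>2 - \<alpha>\<^sup>2 * (u x)\<^sup>2)
                  - (LINT x:period|lebesgue. u x * cos x))
      else \<infinity>)"

definition unique_minimizer :: "real \<Rightarrow> real \<Rightarrow> (real \<Rightarrow> real) \<Rightarrow> bool" where
  "unique_minimizer \<alpha> M u \<longleftrightarrow>
     u \<in> mass_class M \<and> (\<forall>v\<in>mass_class M. energy \<alpha> u \<le> energy \<alpha> v) \<and>
     (\<forall>v\<in>mass_class M. (\<forall>w\<in>mass_class M. energy \<alpha> v \<le> energy \<alpha> w) \<longrightarrow>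
        (AE x in lebesgue. v x = u x))"

text \<open>
  The set where \<open>u > 0\<close> is that of the continuous representative,
  which exists and is unique for \<open>u\<close> in \<open>H\<^sup>1\<close>.
\<close>

definition continuous_rep :: "(real \<Rightarrow> real) \<Rightarrow> real \<Rightarrow> real" where
  "continuous_rep u = (THE w. continuous_on UNIV w \<and> (AE x in lebesgue. w x = u x))"

definition positivity_set :: "(real \<Rightarrow> real) \<Rightarrow> real set" where
  "positivity_set u = {x. continuous_rep u x > 0}"

text \<open>
  For small exponents \<open>n\<close> the function \<open>u\<^sup>n \<phi>\<^sub>x\<close> need not be weakly
  differentiable when \<open>u\<close> is merely in \<open>H\<^sup>2\<close>. The integral condition includes the requirement that
  its derivative \<open>w\<close> exists as an integrable function and that the integrand is integrable.
\<close>

definition strong_steady_state :: "real \<Rightarrow> real \<Rightarrow> real \<Rightarrow> (real \<Rightarrow> real) \<Rightarrow> bool" where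
  "strong_steady_state \<alpha> n M u \<longleftrightarrow>
     u \<in> mass_class M \<and> u \<in> H_circle 2 \<and> energy \<alpha> u < \<infinity> \<and>
     (\<forall>\<phi> \<in> test_functions UNIV.
        \<exists>w. has_weak_deriv 1 UNIV (\<lambda>x. u x powr n * deriv \<phi> x) w \<and>
            set_integrable lebesgue period
              (\<lambda>x. (weak_deriv 2 UNIV u x + \<alpha>\<^sup>2 * u x + cos x) * w x) \<and>
            (LINT x:period|lebesgue. (weak_deriv 2 UNIV u x + \<alpha>\<^sup>2 * u x + cos x) * w x) = 0)"

definition dissipation :: "real \<Rightarrow> real \<Rightarrow> (real \<Rightarrow> real) \<Rightarrow> ennreal" where
  "dissipation \<alpha> n u =
     (\<integral>\<^sup>+x\<in>positivity_set u \<inter> period.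
        ennreal (u x powr n * (weak_deriv 3 (positivity_set u) u x
                               + \<alpha>\<^sup>2 * weak_deriv 1 (positivity_set u) u x - sin x)\<^sup>2) \<partial>lebesgue)"

definition zero_dissipation :: "real \<Rightarrow> real \<Rightarrow> (real \<Rightarrow> real) \<Rightarrow> bool" where
  "zero_dissipation \<alpha> n u \<longleftrightarrow> u \<in> H_loc 3 (positivity_set u) \<and> dissipation \<alpha> n u = 0"

end

theory Submission
  imports Defs "HOL-Complex_Analysis.Great_Picard"
begin

text \<open>
  A strong steady state with zero dissipation has a continuously differentiable representative
  \<open>V \<ge> 0\<close> which satisfies \<open>V'' + \<alpha>\<^sup>2 V + cos x = \<lambda>\<close> on each component of \<open>V > 0\<close>, with zero contact
  angle. Let such a component have centre \<open>c\<close> and half-length \<open>l\<close> with \<open>\<alpha> l \<le> \<pi>\<close>. Testing the part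
  of \<open>V\<close> that is odd about \<open>c\<close> with \<open>sin (\<alpha> (x - c))\<close> forces \<open>sin c = 0\<close>, and the same Wronskian
  argument for \<open>V'\<close> excludes \<open>c = \<pi>\<close> and \<open>\<alpha> l = \<pi>\<close>, so that \<open>V\<close> is a single droplet
  centred at \<open>0\<close>. Droplets are ordered by their half-length, hence determined by their mass.

  Comparing the minimizer with perturbations by hat functions bounds its second differences, which
  gives the regularity and the equation. For \<open>\<alpha> > 1\<close> it cannot be positive on an interval of
  length \<open>2\<pi>/\<alpha>\<close>: there \<open>sin (\<alpha> (x - c))\<close> is a perturbation of zero mass that leaves the energy
  unchanged, against uniqueness. So the minimizer is the droplet. The remaining steady states are
  positive on an interval of length \<open>2\<pi>/\<alpha>\<close>; if their energies approached the minimum, they would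
  converge to the minimizer, which however vanishes on a subinterval of the limit interval, where
  the limit equation would make \<open>cos\<close> constant.
\<close>


section \<open>Smooth periodic functions\<close>

text \<open>Different components of \<open>V > 0\<close> may carry different multipliers, so the
  multiplier is a function with zero derivative on the positivity set, and every argument is
  arranged to make it drop out: by oddness about the centre, by differentiating the equation once,
  or by a second difference. The weight \<open>sin (\<alpha> * y)\<close> solves the homogeneous
  equation, so a Wronskian with it loses the zeroth-order term and only the forcing remains. Its
  sign is known as long as \<open>\<alpha> * l \<le> pi\<close>, and this is the origin of the
  threshold \<open>pi / \<alpha>\<close>. For \<open>\<alpha> \<le> 1\<close> the bound is
  automatic, since half a component is at most \<open>pi\<close> long. On longer components no sign
  is available; they are handled by compactness alone, hence an energy level that is not explicit.
  Regularity is the other obstacle: a strong steady state has a continuous derivative from the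
  start, whereas the minimizer is only known to lie in \<open>H_circle 1\<close>, and smooth contact
  with zero has to be extracted from minimality. Uniqueness of the minimizer enters twice: against a
  neutral perturbation, and to identify the limit of a sequence whose energies approach the
  minimum.\<close>

text \<open>Smoothness by coinduction: it suffices to name a class of differentiable functions that
  \<open>deriv\<close> does not leave. This avoids formulas for the \<open>k\<close>-th derivative
  of products and bumps.\<close>

lemma smoothI:
  assumes "f \<in> S" and "\<And>g x. g \<in> S \<Longrightarrow> g differentiable (at x)" and "\<And>g. g \<in> S \<Longrightarrow> deriv g \<in> S"
  shows "smooth f"
proof -
  have "(deriv ^^ k) f \<in> S" for k
    using assms by (induction k) auto
  then show ?thesis
    unfolding smooth_def differentiable_on_def
    using assms(2) differentiable_at_withinI by blast
qed

lemma smooth_deriv: "smooth f \<Longrightarrow> smooth (deriv f)"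
  unfolding smooth_def by (metis comp_apply funpow_Suc_right)

lemma smooth_has_deriv:
  assumes "smooth f"
  shows "(f has_real_derivative deriv f x) (at x)"
proof -
  have "((deriv ^^ 0) f) differentiable_on UNIV"
    using assms unfolding smooth_def by blast
  then show ?thesis
    by (simp add: differentiable_on_def DERIV_deriv_iff_real_differentiable)
qed

lemma smooth_continuous: "smooth f \<Longrightarrow> continuous_on A f"
  by (meson DERIV_isCont continuous_at_imp_continuous_on smooth_has_deriv)

lemma smooth_from_deriv:
  assumes "\<And>x. (f has_real_derivative g x) (at x)" and "smooth g"
  shows "smooth f"
proof -
  have df: "deriv f = g"
    using assms(1) DERIV_imp_deriv by blast
  have "((deriv ^^ k) f) differentiable_on UNIV" for k
  proof (cases k)
    case 0
    then show ?thesis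
      using assms(1) by (simp add: differentiable_on_def) (meson real_differentiable_def)
  next
    case (Suc j)
    have "(deriv ^^ k) f = (deriv ^^ j) g"
      by (simp only: Suc funpow_Suc_right o_apply df)
    then show ?thesis
      using assms(2) by (simp add: smooth_def)
  qed
  then show ?thesis by (simp add: smooth_def)
qed

lemma smooth_const: "smooth (\<lambda>x. c)"
proof (rule smoothI[where S = "{f. \<exists>c. f = (\<lambda>x. c)}"])
  fix g :: "real \<Rightarrow> real" assume "g \<in> {f. \<exists>c. f = (\<lambda>x. c)}"
  then obtain c where g: "g = (\<lambda>x. c)" by blast
  show "g differentiable (at x)" for x unfolding g by simp
  have "deriv g = (\<lambda>x. 0)" unfolding g by simp
  then show "deriv g \<in> {f. \<exists>c. f = (\<lambda>x. c)}" by blast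
qed blast

lemma smooth_trig: "smooth (\<lambda>x. a * cos x + b * sin x)"
proof (rule smoothI[where S = "{f. \<exists>a b. f = (\<lambda>x. a * cos x + b * sin x)}"])
  have D: "((\<lambda>x. a * cos x + b * sin x) has_real_derivative b * cos x + (- a) * sin x) (at x)" for a b x :: real
    by (auto intro!: derivative_eq_intros)
  fix g assume g: "g \<in> {f. \<exists>a b. f = (\<lambda>x::real. a * cos x + b * sin x)}"
  then show "g differentiable (at x)" for x
    using D real_differentiable_def by blast
  from g obtain a b where g: "g = (\<lambda>x. a * cos x + b * sin x)" by blast
  have "deriv g = (\<lambda>x. b * cos x + (- a) * sin x)"
    unfolding g using D DERIV_imp_deriv by blast
  then show "deriv g \<in> {f. \<exists>a b. f = (\<lambda>x. a * cos x + b * sin x)}" by blast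
qed blast

text \<open>Smooth functions are generators as well, so the factors produced by the product and
  chain rules stay inside. Only the members of \<open>A\<close> then need to have a derivative in
  the algebra.\<close>

inductive_set smooth_alg :: "(real \<Rightarrow> real) set \<Rightarrow> (real \<Rightarrow> real) set" for A where
  base: "f \<in> A \<Longrightarrow> f \<in> smooth_alg A"
| smth: "smooth f \<Longrightarrow> f \<in> smooth_alg A"
| add: "f \<in> smooth_alg A \<Longrightarrow> g \<in> smooth_alg A \<Longrightarrow> (\<lambda>x. f x + g x) \<in> smooth_alg A"
| mult: "f \<in> smooth_alg A \<Longrightarrow> g \<in> smooth_alg A \<Longrightarrow> (\<lambda>x. f x * g x) \<in> smooth_alg A"

lemma smooth_alg_smooth:
  assumes A: "\<And>f. f \<in> A \<Longrightarrow> \<exists>f'\<in>smooth_alg A. \<forall>x. (f has_real_derivative f' x) (at x)"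
    and "f \<in> smooth_alg A"
  shows "smooth f"
proof -
  have *: "\<exists>f'\<in>smooth_alg A. \<forall>x. (f has_real_derivative f' x) (at x)" if "f \<in> smooth_alg A" for f
    using that
  proof induction
    case (base f)
    then show ?case using A by blast
  next
    case (smth f)
    then show ?case
      using smooth_alg.smth smooth_deriv smooth_has_deriv by metis
  next
    case (add f g)
    then obtain f' g' where "f' \<in> smooth_alg A" "g' \<in> smooth_alg A"
      "\<forall>x. (f has_real_derivative f' x) (at x)" "\<forall>x. (g has_real_derivative g' x) (at x)" by blast
    then show ?case
      by (intro bexI[of _ "\<lambda>x. f' x + g' x"] allI DERIV_add smooth_alg.add) blast+
  next
    case (mult f g)
    then obtain f' g' where "f' \<in> smooth_alg A" "g' \<in> smooth_alg A"
      "\<forall>x. (f has_real_derivative f' x) (at x)" "\<forall>x. (g has_real_derivative g' x) (at x)" by blast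
    with mult show ?case
      by (intro bexI[of _ "\<lambda>x. f' x * g x + g' x * f x"] allI DERIV_mult smooth_alg.add
            smooth_alg.mult[of f'] smooth_alg.mult[of g']) blast+
  qed
  show ?thesis
  proof (rule smoothI[OF assms(2)])
    fix g assume g: "g \<in> smooth_alg A"
    show "g differentiable at x" for x
      using *[OF g] real_differentiable_def by blast
    obtain g' where "g' \<in> smooth_alg A" "\<And>x. (g has_real_derivative g' x) (at x)"
      using *[OF g] by blast
    then show "deriv g \<in> smooth_alg A"
      using DERIV_imp_deriv[of g] by (metis (no_types, lifting) ext)
  qed
qed

lemma smooth_add: "smooth f \<Longrightarrow> smooth g \<Longrightarrow> smooth (\<lambda>x. f x + g x)"
  and smooth_mult: "smooth f \<Longrightarrow> smooth g \<Longrightarrow> smooth (\<lambda>x. f x * g x)"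
proof -
  assume "smooth f" "smooth g"
  then have "f \<in> smooth_alg {}" "g \<in> smooth_alg {}" by (auto intro: smooth_alg.smth)
  from smooth_alg.add[OF this] smooth_alg.mult[OF this]
  show "smooth (\<lambda>x. f x + g x)" "smooth (\<lambda>x. f x * g x)"
    by (auto intro: smooth_alg_smooth[of "{}"])
qed

section \<open>Smooth periodic bump functions\<close>

text \<open>The flat function \<open>exp (- 1/s)\<close>, together with the polynomial factors in
  \<open>1/s\<close> that its derivatives acquire.\<close>

definition exp_atom :: "real poly \<Rightarrow> real \<Rightarrow> real" where
  "exp_atom p s = (if s > 0 then poly p (1/s) * exp (- 1/s) else 0)"

lemma tendsto_poly_div_exp: "((\<lambda>y::real. poly p y * exp (- y)) \<longlongrightarrow> 0) at_top"
proof -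
  have "((\<lambda>y. \<Sum>i\<le>degree p. coeff p i * (y ^ i / exp y)) \<longlongrightarrow> (\<Sum>i\<le>degree p. coeff p i * 0)) at_top"
    by (intro tendsto_intros tendsto_power_div_exp_0)
  then show ?thesis
    by (simp add: poly_altdef sum_distrib_right exp_minus divide_inverse mult.assoc)
qed

text \<open>With \<open>y = 1/s\<close> one has d/ds = - y^2 d/dy, which turns p(y) exp(-y) into y^2
  (p - p')(y) exp(-y); \<open>monom 1 2\<close> is the factor y^2. At \<open>s = 0\<close>
  exponential decay beats every polynomial.\<close>

lemma exp_atom_has_deriv:
  "(exp_atom p has_real_derivative exp_atom (monom 1 2 * (p - pderiv p)) s) (at s)"
proof -
  consider "s > 0" | "s < 0" | "s = 0" by linarith
  then show ?thesis
  proof cases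
    case 1
    have "((\<lambda>s. poly p (1/s) * exp (- (1/s))) has_real_derivative
        poly (pderiv p) (1/s) * (- (1/s^2)) * exp (- (1/s)) + exp (- (1/s)) * (1/s^2) * poly p (1/s)) (at s)"
    proof (rule DERIV_mult)
      have I: "((\<lambda>s. 1/s) has_real_derivative - (1/s^2)) (at s)"
        using 1 by (auto intro!: derivative_eq_intros simp: power2_eq_square)
      show "((\<lambda>s. poly p (1/s)) has_real_derivative poly (pderiv p) (1/s) * (- (1/s^2))) (at s)"
        by (rule DERIV_chain2[OF poly_DERIV I])
      show "((\<lambda>s. exp (- (1/s))) has_real_derivative exp (- (1/s)) * (1/s^2)) (at s)"
        using DERIV_chain2[OF DERIV_exp DERIV_minus[OF I]] by simp
    qed
    moreover have "poly (pderiv p) (1/s) * (- (1/s^2)) * exp (- (1/s)) + exp (- (1/s)) * (1/s^2) * poly p (1/s)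
        = exp_atom (monom 1 2 * (p - pderiv p)) s"
      using 1 by (simp add: exp_atom_def poly_monom algebra_simps power_one_over)
    ultimately have "((\<lambda>s. poly p (1/s) * exp (- (1/s))) has_real_derivative
        exp_atom (monom 1 2 * (p - pderiv p)) s) (at s)" by simp
    then show ?thesis
      by (rule has_field_derivative_transform_within_open[OF _ open_greaterThan[of 0]])
        (use 1 in \<open>simp_all add: exp_atom_def\<close>)
  next
    case 2
    have "((\<lambda>s. 0) has_real_derivative 0) (at s)" by simp
    then have "(exp_atom p has_real_derivative 0) (at s)"
      by (rule has_field_derivative_transform_within_open[OF _ open_lessThan[of 0]])
        (use 2 in \<open>simp_all add: exp_atom_def\<close>)
    then show ?thesis using 2 by (simp add: exp_atom_def)
  next
    case 3
    have "((\<lambda>h. exp_atom p h / h) \<longlongrightarrow> 0) (at 0)"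
    proof (rule filterlim_split_at)
      \<comment> \<open>Dividing by \<open>h\<close> is multiplying by \<open>1/h\<close>, which
        raises the polynomial to \<open>monom 1 1 * p\<close>.\<close>
      have "((\<lambda>h::real. poly (monom 1 1 * p) (inverse h) * exp (- (inverse h))) \<longlongrightarrow> 0) (at_right 0)"
        by (rule filterlim_compose[OF tendsto_poly_div_exp filterlim_inverse_at_top_right])
      moreover have "eventually (\<lambda>h. poly (monom 1 1 * p) (inverse h) * exp (- (inverse h)) = exp_atom p h / h) (at_right (0::real))"
        using eventually_at_right_less[of "0::real"]
        by eventually_elim (simp add: exp_atom_def poly_monom divide_inverse)
      ultimately show "((\<lambda>h. exp_atom p h / h) \<longlongrightarrow> 0) (at_right 0)"
        by (rule Lim_transform_eventually)
      have "eventually (\<lambda>h. 0 = exp_atom p h / h) (at_left 0)"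
        unfolding eventually_at_filter by (rule always_eventually) (simp add: exp_atom_def)
      then show "((\<lambda>h. exp_atom p h / h) \<longlongrightarrow> 0) (at_left 0)"
        by (rule Lim_transform_eventually[OF tendsto_const])
    qed
    then show ?thesis
      using 3 by (simp add: DERIV_def exp_atom_def)
  qed
qed

text \<open>Taking a function of \<open>cos (x - c)\<close> makes periodicity automatic, without
  gluing translates together. The bump is positive exactly on the arc of half-width \<open>r\<close>
  about \<open>c\<close> when \<open>r\<close> lies between 0 and \<open>pi\<close>.\<close>

definition bump :: "real \<Rightarrow> real \<Rightarrow> real \<Rightarrow> real" where
  "bump c r x = exp_atom 1 (cos (x - c) - cos r)"

lemma smooth_cos_shift: "smooth (\<lambda>x. cos (x - c))"
  using smooth_trig[of "cos c" "sin c"] by (simp add: cos_diff mult.commute)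

lemma smooth_bump: "smooth (bump c r)"
proof -
  define T where "T = range (\<lambda>p x. exp_atom p (cos (x - c) - cos r))"
  show ?thesis
  proof (rule smooth_alg_smooth)
    show "bump c r \<in> smooth_alg T"
      unfolding bump_def[abs_def] T_def by (rule smooth_alg.base) blast
    fix f assume "f \<in> T"
    then obtain p where f: "f = (\<lambda>x. exp_atom p (cos (x - c) - cos r))"
      by (auto simp: T_def)
    define k where "k = (\<lambda>x. deriv (\<lambda>x. cos (x - c)) x)"
    have k: "smooth k" "\<And>x. ((\<lambda>x. cos (x - c)) has_real_derivative k x) (at x)"
      unfolding k_def using smooth_deriv[OF smooth_cos_shift] smooth_has_deriv[OF smooth_cos_shift] by auto
    have "((\<lambda>x. cos (x - c) - cos r) has_real_derivative k x) (at x)" for x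
      using DERIV_diff[OF k(2) DERIV_const] by simp
    from DERIV_chain2[OF exp_atom_has_deriv this]
    have "(f has_real_derivative exp_atom (monom 1 2 * (p - pderiv p)) (cos (x - c) - cos r) * k x) (at x)" for x
      unfolding f by blast
    then have "\<forall>x. (f has_real_derivative exp_atom (monom 1 2 * (p - pderiv p)) (cos (x - c) - cos r) * k x) (at x)" ..
    moreover have "(\<lambda>x. exp_atom (monom 1 2 * (p - pderiv p)) (cos (x - c) - cos r) * k x) \<in> smooth_alg T"
      by (intro smooth_alg.mult smooth_alg.base smooth_alg.smth k) (auto simp: T_def)
    ultimately show "\<exists>f'\<in>smooth_alg T. \<forall>x. (f has_real_derivative f' x) (at x)"
      by (rule rev_bexI[rotated])
  qed
qed

lemma bump_nonneg: "bump c r x \<ge> 0"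
  and bump_pos_iff: "bump c r x > 0 \<longleftrightarrow> cos (x - c) > cos r"
  and bump_nonzero_iff: "bump c r x \<noteq> 0 \<longleftrightarrow> cos (x - c) > cos r"
  by (auto simp: bump_def exp_atom_def)

lemma bump_periodic: "circle_periodic (bump c r)"
proof -
  have "cos (x + 2 * pi - c) = cos (x - c)" for x
    using cos_periodic[of "x - c"] by (simp add: algebra_simps)
  then show ?thesis by (simp add: circle_periodic_def bump_def)
qed

lemma cos_greater_iff:
  assumes "0 \<le> r" "r \<le> pi" "\<bar>y\<bar> \<le> pi"
  shows "cos y > cos r \<longleftrightarrow> \<bar>y\<bar> < r"
  using cos_mono_less_eq[of r "\<bar>y\<bar>"] assms by (simp add: cos_abs_real)

lemma bump_closure: "closure {x. bump c r x \<noteq> 0} \<subseteq> {x. cos (x - c) \<ge> cos r}"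
proof (rule closure_minimal)
  show "{x. bump c r x \<noteq> 0} \<subseteq> {x. cos (x - c) \<ge> cos r}"
    by (auto simp: bump_nonzero_iff)
  show "closed {x. cos (x - c) \<ge> cos r}"
    by (intro closed_Collect_le continuous_intros)
qed

subsection \<open>Periodicity\<close>

lemma periodic_int:
  assumes "circle_periodic f"
  shows "f (x + 2 * pi * of_int k) = f x"
proof (induction k rule: int_induct[where k = 0])
  case base
  show ?case by simp
next
  case (step1 i)
  have "f (x + 2 * pi * of_int (i+1)) = f ((x + 2 * pi * of_int i) + 2 * pi)"
    by (simp add: algebra_simps)
  then show ?case using assms step1 unfolding circle_periodic_def by metis
next
  case (step2 i)
  have "f ((x + 2 * pi * of_int (i - 1)) + 2 * pi) = f (x + 2 * pi * of_int i)"
    by (simp add: algebra_simps)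
  then show ?case using assms step2 unfolding circle_periodic_def by metis
qed

text \<open>The representative of \<open>x\<close> modulo \<open>2 * pi\<close> in the half-open
  window from \<open>c - pi\<close> to \<open>c + pi\<close>. The centre is a parameter so that a
  construction near any point can be extended periodically from a window around that point.\<close>

definition reduce :: "real \<Rightarrow> real \<Rightarrow> real" where
  "reduce c x = x - 2 * pi * of_int \<lfloor>(x - c + pi) / (2 * pi)\<rfloor>"

lemma reduce_bounds: "c - pi \<le> reduce c x" "reduce c x < c + pi"
proof -
  have "of_int \<lfloor>(x - c + pi) / (2 * pi)\<rfloor> \<le> (x - c + pi) / (2 * pi)"
    "(x - c + pi) / (2 * pi) < of_int \<lfloor>(x - c + pi) / (2 * pi)\<rfloor> + 1"
    by linarith+
  then have "of_int \<lfloor>(x - c + pi) / (2 * pi)\<rfloor> * (2 * pi) \<le> x - c + pi"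
    "x - c + pi < (of_int \<lfloor>(x - c + pi) / (2 * pi)\<rfloor> + 1) * (2 * pi)"
    by (simp_all only: pos_le_divide_eq pos_divide_less_eq pi_gt_zero mult_pos_pos zero_less_numeral)
  then show "c - pi \<le> reduce c x" "reduce c x < c + pi"
    unfolding reduce_def by (simp_all add: algebra_simps)
qed

lemma reduce_shift: "\<exists>k::int. x = reduce c x + 2 * pi * of_int k"
  unfolding reduce_def by (intro exI[of _ "\<lfloor>(x - c + pi) / (2 * pi)\<rfloor>"]) simp

lemma reduce_id: "c - pi \<le> x \<Longrightarrow> x < c + pi \<Longrightarrow> reduce c x = x"
  unfolding reduce_def
proof -
  assume "c - pi \<le> x" "x < c + pi"
  then have "\<lfloor>(x - c + pi) / (2 * pi)\<rfloor> = 0"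
    by (simp add: floor_eq_iff)
  then show "x - 2 * pi * of_int \<lfloor>(x - c + pi) / (2 * pi)\<rfloor> = x" by simp
qed

lemma periodic_reduce: "circle_periodic f \<Longrightarrow> f (reduce c x) = f x"
  using reduce_shift[of x c] periodic_int by metis

lemma reduce_periodic: "reduce c (x + 2 * pi) = reduce c x"
proof -
  have "(x + 2 * pi - c + pi) / (2 * pi) = (x - c + pi) / (2 * pi) + 1"
    by (simp add: field_simps)
  then have "\<lfloor>(x + 2 * pi - c + pi) / (2 * pi)\<rfloor> = \<lfloor>(x - c + pi) / (2 * pi)\<rfloor> + 1" by simp
  then show ?thesis by (simp add: reduce_def algebra_simps)
qed

lemma periodic_compose_reduce: "circle_periodic (\<lambda>x. F (reduce c x))"
  by (simp add: circle_periodic_def reduce_periodic)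

lemma reduce_measurable[measurable]: "reduce c \<in> borel_measurable borel"
  unfolding reduce_def[abs_def] by measurable

lemma periodic_add: "circle_periodic f \<Longrightarrow> circle_periodic g \<Longrightarrow> circle_periodic (\<lambda>x. f x + g x)"
  and periodic_mult: "circle_periodic f \<Longrightarrow> circle_periodic g \<Longrightarrow> circle_periodic (\<lambda>x. f x * g x)"
  and periodic_const: "circle_periodic (\<lambda>x. c)"
  and periodic_cos: "circle_periodic cos"
  by (simp_all add: circle_periodic_def)

lemma periodic_deriv:
  assumes "circle_periodic f"
  shows "circle_periodic (deriv f)"
proof -
  have "(f has_real_derivative D) (at (x + 2 * pi)) \<longleftrightarrow> (f has_real_derivative D) (at x)" for D x
    using DERIV_shift[of f D x "2 * pi"] assms by (simp add: circle_periodic_def add.commute)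
  then show ?thesis by (simp add: circle_periodic_def deriv_def)
qed

section \<open>Test functions on the circle\<close>

lemma test_smooth: "\<phi> \<in> test_functions U \<Longrightarrow> smooth \<phi>"
  and test_periodic: "\<phi> \<in> test_functions U \<Longrightarrow> circle_periodic \<phi>"
  and test_UNIV: "\<phi> \<in> test_functions U \<Longrightarrow> \<phi> \<in> test_functions UNIV"
  and testI_UNIV: "smooth \<phi> \<Longrightarrow> circle_periodic \<phi> \<Longrightarrow> \<phi> \<in> test_functions UNIV"
  by (auto simp: test_functions_def)

lemma test_deriv:
  assumes "\<phi> \<in> test_functions U"
  shows "deriv \<phi> \<in> test_functions U"
proof -
  have "deriv \<phi> x = 0" if "x \<notin> closure {x. \<phi> x \<noteq> 0}" for x
  proof -
    have "((\<lambda>x. 0) has_real_derivative 0) (at x)" by simp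
    then have "(\<phi> has_real_derivative 0) (at x)"
    proof (rule has_field_derivative_transform_within_open)
      show "open (- closure {x. \<phi> x \<noteq> 0})" by auto
      show "x \<in> - closure {x. \<phi> x \<noteq> 0}" using that by simp
      show "0 = \<phi> y" if "y \<in> - closure {x. \<phi> x \<noteq> 0}" for y
        using that closure_subset[of "{x. \<phi> x \<noteq> 0}"] by auto
    qed
    then show ?thesis by (rule DERIV_imp_deriv)
  qed
  then have "closure {x. deriv \<phi> x \<noteq> 0} \<subseteq> closure {x. \<phi> x \<noteq> 0}"
    by (intro closure_minimal) auto
  then show ?thesis
    using assms by (auto simp: test_functions_def smooth_deriv periodic_deriv)
qed

lemma test_mult:
  assumes "\<phi> \<in> test_functions U" "\<psi> \<in> test_functions UNIV"
  shows "(\<lambda>x. \<phi> x * \<psi> x) \<in> test_functions U"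
proof -
  have "closure {x. \<phi> x * \<psi> x \<noteq> 0} \<subseteq> closure {x. \<phi> x \<noteq> 0}"
    by (intro closure_mono) auto
  then show ?thesis
    using assms by (auto simp: test_functions_def smooth_mult periodic_mult)
qed

lemma bump_test:
  assumes "\<And>x. cos (x - c) \<ge> cos r \<Longrightarrow> x \<in> U"
  shows "bump c r \<in> test_functions U"
  using bump_closure[of c r] assms by (auto simp: test_functions_def smooth_bump bump_periodic)

lemma bump_test_interval:
  assumes "0 \<le> r" "r < pi" and per: "\<And>x k. x \<in> U \<Longrightarrow> x + 2 * pi * of_int k \<in> U" and "{c-r..c+r} \<subseteq> U"
  shows "bump c r \<in> test_functions U"
proof (rule bump_test)
  fix x assume *: "cos (x - c) \<ge> cos r"
  obtain k :: int where k: "x = reduce c x + 2 * pi * of_int k"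
    using reduce_shift by blast
  have "cos (reduce c x - c) = cos (x - c)"
    using k periodic_int[OF periodic_cos, of "reduce c x - c" k] by (metis add_diff_eq diff_add_eq)
  moreover have "\<bar>reduce c x - c\<bar> \<le> pi" using reduce_bounds[of c x] by auto
  ultimately have "\<not> r < \<bar>reduce c x - c\<bar>"
    using * cos_greater_iff[of "\<bar>reduce c x - c\<bar>" r] assms(1,2) by (simp add: cos_abs_real)
  then have "reduce c x \<in> {c-r..c+r}" by auto
  then have "reduce c x \<in> U" using assms(4) by blast
  then show "x \<in> U" using per k by metis
qed


section \<open>Absolutely continuous periodic functions\<close>

text \<open>The integral over a set is a signed measure that vanishes on intervals, hence on all
  Borel sets, so its density vanishes. The function is first replaced by a Borel version, because
  the extension from intervals runs in the Borel sigma-algebra.\<close>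

lemma AE_zero_of_interval_integrals:
  fixes v :: "real \<Rightarrow> real"
  assumes v: "v absolutely_integrable_on {a..b}"
    and zero: "\<And>x y. a \<le> x \<Longrightarrow> x \<le> y \<Longrightarrow> y \<le> b \<Longrightarrow> integral {x..y} v = 0"
  shows "AE x in lebesgue. x \<in> {a..b} \<longrightarrow> v x = 0"
proof -
  define f where "f = (\<lambda>x. indicator {a..b} x *\<^sub>R v x)"
  have f: "integrable lebesgue f"
    using v by (simp add: set_integrable_def f_def)
  obtain g where g: "g \<in> borel_measurable lborel" "AE x in lborel. f x = g x"
    using completion_ex_borel_measurable_real[of f lborel] f by blast
  have fg: "AE x in lebesgue. f x = g x"
    using g(2) by (rule AE_completion)
  have gl: "integrable lebesgue g"
    using f fg g(1) by (subst integrable_cong_AE[of g lebesgue f]) (auto simp: measurable_completion)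
  have gi: "integrable lborel g"
    using gl g(1) by (simp add: integrable_completion)
  have box: "(LINT x:{c..d}|lborel. g x) = 0" for c d
  proof -
    have m: "(\<lambda>x. indicator {c..d} x *\<^sub>R g x) \<in> borel_measurable lborel"
      using g(1) by measurable
    have "(LINT x:{c..d}|lborel. g x) = (LINT x|lebesgue. indicator {c..d} x *\<^sub>R g x)"
      unfolding set_lebesgue_integral_def using integral_completion[OF m] by simp
    also have "\<dots> = (LINT x|lebesgue. indicator {max a c..min b d} x *\<^sub>R v x)"
    proof (rule integral_cong_AE)
      show "(\<lambda>x. indicator {c..d} x *\<^sub>R g x) \<in> borel_measurable lebesgue"
        using m by (rule measurable_completion)
      have "set_integrable lebesgue {max a c..min b d} v"
        by (rule set_integrable_subset[OF v]) auto
      then show "(\<lambda>x. indicator {max a c..min b d} x *\<^sub>R v x) \<in> borel_measurable lebesgue"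
        by (simp add: set_integrable_def borel_measurable_integrable)
      show "AE x in lebesgue. indicator {c..d} x *\<^sub>R g x = indicator {max a c..min b d} x *\<^sub>R v x"
        using fg by eventually_elim (auto simp: f_def indicator_def split: if_splits)
    qed
    also have "\<dots> = integral {max a c..min b d} v"
      using set_lebesgue_integral_eq_integral(2)[OF set_integrable_subset[OF v], of "{max a c..min b d}"]
      by (simp add: set_lebesgue_integral_def)
    also have "\<dots> = 0"
      by (cases "max a c \<le> min b d") (use zero[of "max a c" "min b d"] in auto)
    finally show ?thesis .
  qed
  have si: "set_integrable lborel A g" if "A \<in> sets borel" for A
    unfolding set_integrable_def using gi that by (intro integrable_mult_indicator) auto
  have UN: "(LINT x|lborel. g x) = 0"
  proof -
    have "(LINT x|lborel. g x) = (LINT x:{a..b}|lborel. g x)"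
      unfolding set_lebesgue_integral_def
    proof (rule integral_cong_AE)
      show "AE x in lborel. g x = indicat_real {a..b} x *\<^sub>R g x"
        using g(2)
      proof eventually_elim
        fix x assume "f x = g x"
        then show "g x = indicat_real {a..b} x *\<^sub>R g x"
          by (cases "x \<in> {a..b}") (simp_all add: f_def)
      qed
    qed (use g(1) in measurable)
    then show ?thesis using box by simp
  qed
  have A0: "(LINT x:A|lborel. g x) = 0" if "A \<in> sets borel" for A
  proof -
    \<comment> \<open>Closed intervals, empty ones included, are stable under intersection and
      generate the Borel sets; the induction below is the pi-lambda theorem.\<close>
    have sig: "sets borel = sigma_sets UNIV (range (\<lambda>(a, b). {a..b::real}))"
      by (subst borel_eq_atLeastAtMost) (simp add: sets_measure_of)
    have "A \<in> sigma_sets UNIV (range (\<lambda>(a, b). {a..b::real}))"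
      using that sig by simp
    then show ?thesis
    proof (induction rule: sigma_sets_induct_disjoint[rotated 2, consumes 1, case_names basic empty compl union])
      case (basic A)
      then show ?case using box by auto
    next
      case empty
      show ?case by (simp add: set_lebesgue_integral_def)
    next
      case (compl A)
      have A: "A \<in> sets borel" using compl(1) sig by simp
      have "(LINT x:(A \<union> (UNIV - A))|lborel. g x) = (LINT x:A|lborel. g x) + (LINT x:(UNIV - A)|lborel. g x)"
        by (rule set_integral_Un) (use A si in auto)
      moreover have "(LINT x:(A \<union> (UNIV - A))|lborel. g x) = 0"
        using UN by (simp add: set_lebesgue_integral_def)
      ultimately show ?case using compl(2) by simp
    next
      case (union B)
      have B: "B i \<in> sets borel" for i using union(2) sig by auto
      have "(LINT x:(\<Union>i. B i)|lborel. g x) = (\<Sum>i. (LINT x:(B i)|lborel. g x))"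
        by (rule lebesgue_integral_countable_add)
           (use B si union(1) in \<open>auto simp: disjoint_family_on_def\<close>)
      then show ?case using union(3) by simp
    qed (auto simp: Int_stable_def)
  qed
  have "AE x in lborel. g x = 0"
    by (rule density_unique_real[OF gi]) (use A0 in \<open>auto simp: set_lebesgue_integral_def\<close>)
  then have "AE x in lebesgue. g x = 0" by (rule AE_completion)
  with fg show ?thesis
    by eventually_elim (auto simp: f_def)
qed

lemma abs_int_mult_cont:
  fixes g :: "real \<Rightarrow> real"
  assumes "g absolutely_integrable_on {a..b}" and "continuous_on {a..b} f"
  shows "(\<lambda>x. f x * g x) absolutely_integrable_on {a..b}"
    and "(\<lambda>x. g x * f x) absolutely_integrable_on {a..b}"
proof -
  have "bounded (f ` {a..b})"
    using assms(2) by (intro compact_imp_bounded compact_continuous_image) auto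
  then show "(\<lambda>x. f x * g x) absolutely_integrable_on {a..b}"
    using absolutely_integrable_bounded_measurable_product_real[of f "{a..b}" g] assms
      continuous_imp_measurable_on_sets_lebesgue[of "{a..b}" f] by auto
  then show "(\<lambda>x. g x * f x) absolutely_integrable_on {a..b}"
    by (simp add: mult.commute)
qed

lemma indef_integral_diff:
  fixes g :: "real \<Rightarrow> real"
  assumes "g integrable_on {a..b}" "a \<le> x" "x \<le> y" "y \<le> b"
  shows "integral {x..y} g = integral {a..y} g - integral {a..x} g"
proof -
  have "g integrable_on {a..y}"
    using assms by (meson integrable_subinterval_real atLeastatMost_subset_iff order_refl)
  from Henstock_Kurzweil_Integration.integral_combine[OF assms(2,3) this] show ?thesis by simp
qed

text \<open>\<open>U\<close> need not be differentiable at every point, so the product rule is not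
  at hand. Instead the defect \<open>F\<close> of the formula is shown to have derivative zero
  everywhere: its increment over an interval is at most the length times the increment of the
  continuous primitive \<open>G\<close> of \<open>\<bar>g\<bar>\<close>, hence of smaller order than
  the length.\<close>

lemma integration_by_parts_ac:
  fixes U g \<phi> \<phi>' :: "real \<Rightarrow> real"
  assumes ab: "a \<le> b" and g: "g absolutely_integrable_on {a..b}"
    and U: "\<And>x. x \<in> {a..b} \<Longrightarrow> U x = U a + integral {a..x} g"
    and \<phi>: "\<And>x. x \<in> {a..b} \<Longrightarrow> (\<phi> has_real_derivative \<phi>' x) (at x within {a..b})"
    and \<phi>': "continuous_on {a..b} \<phi>'"
  shows "integral {a..b} (\<lambda>x. U x * \<phi>' x) = U b * \<phi> b - U a * \<phi> a - integral {a..b} (\<lambda>x. g x * \<phi> x)"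
proof -
  have gi: "g integrable_on {a..b}" and ngi: "(\<lambda>x. \<bar>g x\<bar>) integrable_on {a..b}"
    using g by (simp_all add: absolutely_integrable_on_def)
  have c\<phi>: "continuous_on {a..b} \<phi>"
    using \<phi> DERIV_continuous_on by blast
  have "continuous_on {a..b} (\<lambda>x. U a + integral {a..x} g)"
    by (intro continuous_intros indefinite_integral_continuous_1 gi)
  then have cU: "continuous_on {a..b} U"
    by (rule continuous_on_eq) (use U[symmetric] in blast)
  obtain K where K: "0 \<le> K" "\<And>x. x \<in> {a..b} \<Longrightarrow> \<bar>\<phi>' x\<bar> \<le> K"
  proof -
    have "bounded (\<phi>' ` {a..b})"
      using \<phi>' by (intro compact_imp_bounded compact_continuous_image) auto
    then obtain B where "\<forall>x\<in>{a..b}. \<bar>\<phi>' x\<bar> \<le> B"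
      by (auto simp: bounded_iff)
    then show ?thesis by (intro that[of "\<bar>B\<bar>"]) (simp, meson abs_ge_self order_trans)
  qed
  have s1: "continuous_on {a..b} (\<lambda>x. U x * \<phi>' x)"
    using cU \<phi>' by (intro continuous_intros)
  have i1: "(\<lambda>x. U x * \<phi>' x) integrable_on {a..b}"
    by (rule integrable_continuous_real[OF s1])
  have i2: "(\<lambda>x. g x * \<phi> x) integrable_on {a..b}"
    using abs_int_mult_cont(2)[OF g c\<phi>] by (simp add: absolutely_integrable_on_def)
  define h where "h = (\<lambda>x. U x * \<phi>' x + g x * \<phi> x)"
  have hi: "h integrable_on {a..b}"
    unfolding h_def by (rule integrable_add[OF i1 i2])
  define F where "F = (\<lambda>x. U x * \<phi> x - integral {a..x} h)"
  define G where "G = (\<lambda>x. integral {a..x} (\<lambda>x. \<bar>g x\<bar>))"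
  have cG: "continuous_on {a..b} G"
    unfolding G_def by (rule indefinite_integral_continuous_1[OF ngi])
  have sub: "f integrable_on {x..y}" if "f integrable_on {a..b}" "a \<le> x" "y \<le> b" for f :: "real \<Rightarrow> real" and x y
    by (rule integrable_subinterval_real[OF that(1)]) (use that in auto)
  have bnd: "\<bar>F y - F x\<bar> \<le> (y - x) * (2 * K * (G y - G x))" if xy: "a \<le> x" "x \<le> y" "y \<le> b" for x y
  proof -
    have dU: "U t - U s = integral {s..t} g" if "a \<le> s" "s \<le> t" "t \<le> b" for s t
      using indef_integral_diff[OF gi, of s t] U[of s] U[of t] that by simp
    have ftc: "(\<phi>' has_integral (\<phi> t - \<phi> s)) {s..t}" if "a \<le> s" "s \<le> t" "t \<le> b" for s t
    proof (rule fundamental_theorem_of_calculus[OF that(2)])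
      fix z assume "z \<in> {s..t}"
      then show "(\<phi> has_vector_derivative \<phi>' z) (at z within {s..t})"
        using has_vector_derivative_within_subset[of \<phi> "\<phi>' z" z "{a..b}" "{s..t}"] \<phi>[of z] that
        by (auto simp: has_real_derivative_iff_has_vector_derivative)
    qed
    have dphi: "\<bar>\<phi> x - \<phi> s\<bar> \<le> K * (y - x)" if "s \<in> {x..y}" for s
    proof -
      have "norm (\<phi> s - \<phi> x) \<le> K * (s - x)"
        using has_integral_bound[of K \<phi>' "\<phi> s - \<phi> x" x s] ftc[of x s] that xy K by simp
      also have "\<dots> \<le> K * (y - x)"
        using that K(1) by (auto intro!: mult_left_mono)
      finally show ?thesis by (simp add: abs_minus_commute)
    qed
    have dG: "\<bar>U y - U s\<bar> \<le> G y - G x" if "s \<in> {x..y}" for s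
    proof -
      have "\<bar>U y - U s\<bar> = \<bar>integral {s..y} g\<bar>" using dU[of s y] that xy by simp
      also have "\<dots> \<le> integral {s..y} (\<lambda>x. \<bar>g x\<bar>)"
        using integral_norm_bound_integral[of g "{s..y}" "\<lambda>x. \<bar>g x\<bar>"] sub[OF gi, of s y] sub[OF ngi, of s y] that xy by auto
      also have "\<dots> = G y - G s"
        unfolding G_def using indef_integral_diff[OF ngi, of s y] that xy by simp
      also have "\<dots> \<le> G y - G x"
      proof -
        have "G s - G x = integral {x..s} (\<lambda>x. \<bar>g x\<bar>)"
          unfolding G_def using indef_integral_diff[OF ngi, of x s] that xy by simp
        also have "\<dots> \<ge> 0" by (intro integral_nonneg sub[OF ngi]) (use that xy in auto)
        finally show ?thesis by simp
      qed
      finally show ?thesis .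
    qed
    \<comment> \<open>The remainder after freezing \<open>U\<close> at the right end and
      \<open>\<phi>\<close> at the left end; both factors in parentheses are small on a short
      interval.\<close>
    define k where "k = (\<lambda>s. (U y - U s) * \<phi>' s + g s * (\<phi> x - \<phi> s))"
    have I: "(k has_integral (F y - F x)) {x..y}"
    proof -
      have "((\<lambda>s. U y * \<phi>' s + \<phi> x * g s - h s) has_integral
          (U y * (\<phi> y - \<phi> x) + \<phi> x * integral {x..y} g - integral {x..y} h)) {x..y}"
        by (intro has_integral_diff has_integral_add has_integral_mult_right ftc integrable_integral sub[OF gi] sub[OF hi] xy)
      moreover have "U y * (\<phi> y - \<phi> x) + \<phi> x * integral {x..y} g - integral {x..y} h = F y - F x"
        using indef_integral_diff[OF hi xy] dU[OF xy] unfolding F_def by (simp add: algebra_simps)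
      moreover have "(\<lambda>s. U y * \<phi>' s + \<phi> x * g s - h s) = k"
        by (auto simp: k_def h_def algebra_simps)
      ultimately show ?thesis by simp
    qed
    have J: "((\<lambda>s. (G y - G x) * K + \<bar>g s\<bar> * (K * (y - x))) has_integral
        ((G y - G x) * K * (y - x) + (G y - G x) * (K * (y - x)))) {x..y}"
    proof (intro has_integral_add has_integral_mult_left)
      show "((\<lambda>s. (G y - G x) * K) has_integral (G y - G x) * K * (y - x)) {x..y}"
        using has_integral_const_real[of "(G y - G x) * K" x y] xy by (simp add: mult.commute)
      show "((\<lambda>s. \<bar>g s\<bar>) has_integral G y - G x) {x..y}"
        unfolding G_def using indef_integral_diff[OF ngi xy] integrable_integral[OF sub[OF ngi, of x y]] xy by auto
    qed
    have "norm (F y - F x) \<le> (G y - G x) * K * (y - x) + (G y - G x) * (K * (y - x))"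
    proof -
      have "norm (integral {x..y} k) \<le> integral {x..y} (\<lambda>s. (G y - G x) * K + \<bar>g s\<bar> * (K * (y - x)))"
      proof (rule integral_norm_bound_integral)
        fix s assume s: "s \<in> {x..y}"
        have "\<bar>k s\<bar> \<le> \<bar>U y - U s\<bar> * \<bar>\<phi>' s\<bar> + \<bar>g s\<bar> * \<bar>\<phi> x - \<phi> s\<bar>"
          unfolding k_def by (rule order_trans[OF abs_triangle_ineq]) (simp add: abs_mult)
        also have "\<dots> \<le> (G y - G x) * K + \<bar>g s\<bar> * (K * (y - x))"
        proof (intro add_mono mult_mono mult_left_mono)
          show "\<bar>\<phi>' s\<bar> \<le> K" using K(2) s xy by auto
          show "0 \<le> G y - G x" using dG[of y] xy by simp
        qed (use dG[OF s] dphi[OF s] in auto)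
        finally show "norm (k s) \<le> (G y - G x) * K + \<bar>g s\<bar> * (K * (y - x))" by simp
      qed (use I J in \<open>auto simp: integrable_on_def\<close>)
      then show ?thesis using I J by (simp add: integral_unique)
    qed
    then show ?thesis by (simp add: algebra_simps)
  qed
  have "\<exists>c. \<forall>x\<in>{a..b}. F x = c"
  proof (rule has_field_derivative_zero_constant)
    fix x assume x: "x \<in> {a..b}"
    have "((\<lambda>y. (F y - F x) / (y - x)) \<longlongrightarrow> 0) (at x within {a..b})"
    proof (rule Lim_null_comparison)
      have "(G \<longlongrightarrow> G x) (at x within {a..b})"
        using cG x by (simp add: continuous_on_def)
      then have "((\<lambda>y. 2 * K * \<bar>G y - G x\<bar>) \<longlongrightarrow> 2 * K * \<bar>G x - G x\<bar>) (at x within {a..b})"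
        by (intro tendsto_intros)
      then show "((\<lambda>y. 2 * K * \<bar>G y - G x\<bar>) \<longlongrightarrow> 0) (at x within {a..b})" by simp
      show "\<forall>\<^sub>F y in at x within {a..b}. norm ((F y - F x) / (y - x)) \<le> 2 * K * \<bar>G y - G x\<bar>"
        unfolding eventually_at_filter
      proof (rule always_eventually, intro allI impI)
        fix y assume y: "y \<noteq> x" "y \<in> {a..b}"
        have "\<bar>F y - F x\<bar> \<le> \<bar>y - x\<bar> * (2 * K * \<bar>G y - G x\<bar>)"
        proof (cases "x \<le> y")
          case True
          then have "\<bar>F y - F x\<bar> \<le> (y - x) * (2 * K * (G y - G x))" using bnd[of x y] x y by auto
          also have "\<dots> \<le> (y - x) * (2 * K * \<bar>G y - G x\<bar>)"
            using True K(1) by (intro mult_left_mono) auto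
          finally show ?thesis using True by simp
        next
          case False
          then have "\<bar>F x - F y\<bar> \<le> (x - y) * (2 * K * (G x - G y))" using bnd[of y x] x y by auto
          also have "\<dots> \<le> (x - y) * (2 * K * \<bar>G x - G y\<bar>)"
            using False K(1) by (intro mult_left_mono) auto
          finally show ?thesis using False by (simp add: abs_minus_commute)
        qed
        then show "norm ((F y - F x) / (y - x)) \<le> 2 * K * \<bar>G y - G x\<bar>"
          using y by (simp add: field_simps abs_mult)
      qed
    qed
    then show "(F has_real_derivative 0) (at x within {a..b})"
      by (simp add: has_field_derivative_iff)
  qed simp
  then have "F b = F a" using ab by auto
  moreover have "integral {a..b} h = integral {a..b} (\<lambda>x. U x * \<phi>' x) + integral {a..b} (\<lambda>x. g x * \<phi> x)"
    unfolding h_def by (rule integral_add[OF i1 i2])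
  ultimately show ?thesis by (simp add: F_def)
qed

lemma abs_int_shift:
  fixes f :: "real \<Rightarrow> real"
  assumes "f absolutely_integrable_on {a..b}"
  shows "(\<lambda>x. f (x + c)) absolutely_integrable_on {a - c..b - c}"
  using assms integrable_shift_real_ivl[of f a b c] integrable_shift_real_ivl[of "\<lambda>x. norm (f x)" a b c]
  by (simp add: absolutely_integrable_on_def)

lemma abs_int_combine:
  fixes f :: "real \<Rightarrow> real"
  assumes "a \<le> c" "c \<le> b" "f absolutely_integrable_on {a..c}" "f absolutely_integrable_on {c..b}"
  shows "f absolutely_integrable_on {a..b}"
  using assms Henstock_Kurzweil_Integration.integrable_combine[of a c b f] Henstock_Kurzweil_Integration.integrable_combine[of a c b "\<lambda>x. norm (f x)"]
  by (simp add: absolutely_integrable_on_def)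

lemma periodic_abs_int:
  assumes per: "circle_periodic f" and f: "f absolutely_integrable_on {c - pi..c + pi}"
  shows "f absolutely_integrable_on {a..b}"
proof -
  have shift: "f absolutely_integrable_on {c - pi + 2 * pi * of_int k..c + pi + 2 * pi * of_int k}" for k :: int
    using abs_int_shift[OF f, of "- (2 * pi * of_int k)"] periodic_int[OF per, of _ "-k"]
    by simp
  have "f absolutely_integrable_on {c - pi + 2 * pi * of_int (- int n)..c + pi + 2 * pi * of_int (int n)}" for n
  proof (induction n)
    case 0
    show ?case using f by simp
  next
    case (Suc n)
    have 1: "f absolutely_integrable_on {c - pi + 2 * pi * of_int (- int n)..c + pi + 2 * pi * of_int (int (Suc n))}"
    proof (rule abs_int_combine[OF _ _ Suc])
      show "f absolutely_integrable_on {c + pi + 2 * pi * of_int (int n)..c + pi + 2 * pi * of_int (int (Suc n))}"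
        using shift[of "int (Suc n)"] by (simp add: algebra_simps)
      show "c - pi + 2 * pi * real_of_int (- int n) \<le> c + pi + 2 * pi * real_of_int (int n)"
        using pi_gt_zero mult_nonneg_nonneg[of pi "real n"] by simp
    qed simp
    show ?case
    proof (rule abs_int_combine[OF _ _ _ 1])
      show "f absolutely_integrable_on {c - pi + 2 * pi * of_int (- int (Suc n))..c - pi + 2 * pi * of_int (- int n)}"
        using shift[of "- int (Suc n)"] by (simp add: algebra_simps)
      show "c - pi + 2 * pi * real_of_int (- int n) \<le> c + pi + 2 * pi * real_of_int (int (Suc n))"
        using pi_gt_zero mult_nonneg_nonneg[of pi "real n"] by (simp add: distrib_left)
    qed (simp add: algebra_simps)
  qed
  note big = this
  obtain n :: nat where n: "\<bar>a - c\<bar> + \<bar>b - c\<bar> \<le> real n * (2 * pi)"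
    using real_arch_simple[of "(\<bar>a - c\<bar> + \<bar>b - c\<bar>) / (2 * pi)"] by (auto simp: pos_divide_le_eq)
  have "\<bar>a - c\<bar> \<le> 2 * pi * real n" "\<bar>b - c\<bar> \<le> 2 * pi * real n"
    using n by (simp_all add: algebra_simps)
  then have "c - pi + 2 * pi * of_int (- int n) \<le> a" "b \<le> c + pi + 2 * pi * of_int (int n)"
    using pi_gt_zero by (simp_all add: abs_le_iff, linarith+)
  then show ?thesis
    by (intro absolutely_integrable_on_subinterval[OF big[of n]]) auto
qed

section \<open>Primitives and periodic functions with an integrable density\<close>

text \<open>A primitive on the whole line, normalized at 0: for either sign of \<open>x\<close> one
  of the two integrals runs over an empty interval.\<close>

definition prim :: "(real \<Rightarrow> real) \<Rightarrow> real \<Rightarrow> real" where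
  "prim f x = integral {0..x} f - integral {x..0} f"

lemma prim_diff:
  assumes f: "\<And>a b. f integrable_on {a..b}" and "a \<le> b"
  shows "prim f b - prim f a = integral {a..b} f"
proof -
  have *: "prim f x = integral {c..x} f - integral {c..0} f" if "c \<le> x" "c \<le> 0" for x c
  proof (cases "0 \<le> x")
    case True
    then have "integral {x..0} f = 0" by (cases "x = 0") auto
    then show ?thesis using Henstock_Kurzweil_Integration.integral_combine[of c 0 x f] f that True by (simp add: prim_def)
  next
    case False
    then show ?thesis using Henstock_Kurzweil_Integration.integral_combine[of c x 0 f] f that by (simp add: prim_def)
  qed
  show ?thesis
    using *[of "min a 0" a] *[of "min a 0" b] Henstock_Kurzweil_Integration.integral_combine[of "min a 0" a b f] f assms(2) by simp
qed

lemma periodic_integral: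
  assumes per: "circle_periodic f" and f: "f absolutely_integrable_on period"
  shows "integral {c - pi..c + pi} f = integral period f"
    and "prim f (x + 2 * pi) - prim f x = integral period f"
proof -
  have f': "f absolutely_integrable_on {a..b}" for a b
    using periodic_abs_int[OF per, of 0 a b] f by simp
  then have fi: "f integrable_on {a..b}" for a b
    by (simp add: absolutely_integrable_on_def)
  note pd = prim_diff[OF fi]
  have *: "prim f (b + 2 * pi) - prim f b = prim f (a + 2 * pi) - prim f a" if "a \<le> b" for a b
  proof -
    have "integral {a + 2 * pi..b + 2 * pi} f = integral {a..b} f"
      using integral_shift_real_ivl[of "a + 2*pi" "2 * pi" "b + 2*pi" f] per
      by (simp add: circle_periodic_def)
    then show ?thesis using pd[of a b] pd[of "a + 2*pi" "b + 2*pi"] that by simp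
  qed
  have **: "prim f (x + 2 * pi) - prim f x = integral period f" for x
    using *[of x "-pi"] *[of "-pi" x] pd[of "-pi" pi] by (cases "x \<le> -pi") auto
  then show "prim f (x + 2 * pi) - prim f x = integral period f" .
  show "integral {c - pi..c + pi} f = integral period f"
    using **[of "c - pi"] pd[of "c - pi" "c + pi"] by (simp add: add.commute)
qed

text \<open>Plays the part of a Sobolev function. The density is carried along explicitly because it
  is determined only up to a null set, while \<open>U\<close> itself is an honest continuous
  function.\<close>

definition ac :: "(real \<Rightarrow> real) \<Rightarrow> (real \<Rightarrow> real) \<Rightarrow> bool" where
  "ac U g \<longleftrightarrow> circle_periodic U \<and> circle_periodic g \<and> g absolutely_integrable_on period \<and>
     (\<forall>a b. a \<le> b \<longrightarrow> U b - U a = integral {a..b} g)"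

lemma acD:
  assumes "ac U g"
  shows "circle_periodic U" "circle_periodic g" "g absolutely_integrable_on {a..b}" "g integrable_on {a..b}"
    "a \<le> b \<Longrightarrow> U b - U a = integral {a..b} g"
  using assms periodic_abs_int[of g 0 a b] by (auto simp: ac_def absolutely_integrable_on_def)

lemma ac_continuous:
  assumes "ac U g"
  shows "continuous_on A U"
proof -
  have "isCont U x" for x
  proof -
    have "continuous_on {x-1..x+1} (\<lambda>y. U (x-1) + integral {x-1..y} g)"
      by (intro continuous_intros indefinite_integral_continuous_1 acD(4)[OF assms])
    moreover have "U (x-1) + integral {x-1..y} g = U y" if "y \<in> {x-1..x+1}" for y
      using acD(5)[OF assms, of "x-1" y] that by simp
    ultimately have "continuous_on {x-1..x+1} U"
      by (subst continuous_on_cong[OF refl]) (auto intro: sym)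
    then show ?thesis
      by (rule continuous_on_interior) simp
  qed
  then show ?thesis by (simp add: continuous_at_imp_continuous_on)
qed

text \<open>Periodicity of \<open>U\<close> forces \<open>g\<close> to have mean zero, so
  \<open>prim g\<close> is periodic. Then \<open>U\<close> minus \<open>prim g\<close> is periodic
  and constant on one window, hence constant.\<close>

lemma ac_window:
  assumes U: "circle_periodic U" and g: "circle_periodic g"
    and gi: "g absolutely_integrable_on {c - pi..c + pi}"
    and d: "\<And>x. x \<in> {c - pi..c + pi} \<Longrightarrow> U x - U (c - pi) = integral {c - pi..x} g"
  shows "ac U g"
proof -
  have gi': "g absolutely_integrable_on {a..b}" for a b
    by (rule periodic_abs_int[OF g gi])
  then have g1: "g integrable_on {a..b}" for a b by (simp add: absolutely_integrable_on_def)
  have "U (c + pi) = U (c - pi)"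
    using spec[OF U[unfolded circle_periodic_def], of "c - pi"] by (simp add: add.commute)
  then have "integral {c - pi..c + pi} g = 0"
    using d[of "c + pi"] pi_ge_zero by simp
  then have z: "integral period g = 0"
    using periodic_integral(1)[OF g gi'] by simp
  define D where "D = (\<lambda>x. U x - prim g x)"
  have Dper: "circle_periodic D"
    unfolding D_def circle_periodic_def
    using periodic_integral(2)[OF g gi'] z U by (simp add: circle_periodic_def)
  have Dc: "D x = D (c - pi)" if "x \<in> {c - pi..c + pi}" for x
    using d[OF that] prim_diff[OF g1, of "c - pi" x] that unfolding D_def by simp
  have "D x = D (c - pi)" for x
    using Dc[of "reduce c x"] reduce_bounds[of c x] periodic_reduce[OF Dper, of c x] by simp
  then have "D b = D a" for a b by metis
  then have "U b - U a = integral {a..b} g" if "a \<le> b" for a b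
    using prim_diff[OF g1 that] \<open>\<And>b a. D b = D a\<close>[of b a] unfolding D_def by linarith
  then show ?thesis using U g gi' by (simp add: ac_def)
qed

lemma ac_const: "ac (\<lambda>x. c) (\<lambda>x. 0)"
  by (simp add: ac_def circle_periodic_def)

lemma ac_lincomb:
  assumes "ac U g" "ac V h"
  shows "ac (\<lambda>x. U x + t * V x) (\<lambda>x. g x + t * h x)"
  unfolding ac_def
proof (intro conjI allI impI)
  show "(\<lambda>x. g x + t * h x) absolutely_integrable_on period"
    using assms by (auto simp: ac_def intro!: set_integral_add set_integrable_mult_right)
  fix a b :: real assume ab: "a \<le> b"
  have "integral {a..b} (\<lambda>x. g x + t * h x) = integral {a..b} g + t * integral {a..b} h"
    using acD(4)[OF assms(1), of a b] acD(4)[OF assms(2), of a b] by (subst integral_add) (auto intro: integrable_on_mult_right)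
  then show "U b + t * V b - (U a + t * V a) = integral {a..b} (\<lambda>x. g x + t * h x)"
    using acD(5)[OF assms(1) ab] acD(5)[OF assms(2) ab] by (simp add: algebra_simps)
qed (use assms in \<open>auto simp: ac_def circle_periodic_def\<close>)

lemma ac_C1:
  assumes "circle_periodic U" and "\<And>x. (U has_real_derivative U' x) (at x)" and c: "continuous_on UNIV U'"
  shows "ac U U'"
proof -
  have I: "(U' has_integral (U b - U a)) {a..b}" if "a \<le> b" for a b
    by (rule fundamental_theorem_of_calculus[OF that])
       (use assms(2) in \<open>auto simp: has_real_derivative_iff_has_vector_derivative[symmetric] intro: has_field_derivative_at_within\<close>)
  have "deriv U = U'" using assms(2) DERIV_imp_deriv by blast
  then have "circle_periodic U'" using periodic_deriv[OF assms(1)] by simp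
  moreover have "U' absolutely_integrable_on period"
    by (intro absolutely_integrable_continuous_real continuous_on_subset[OF c]) auto
  ultimately show ?thesis
    using assms(1) integral_unique[OF I] by (auto simp: ac_def)
qed

lemma ac_by_parts:
  assumes "ac U g" "smooth \<phi>" "circle_periodic \<phi>"
  shows "integral period (\<lambda>x. U x * deriv \<phi> x) = - integral period (\<lambda>x. g x * \<phi> x)"
proof -
  have "integral {-pi..pi} (\<lambda>x. U x * deriv \<phi> x) = U pi * \<phi> pi - U (-pi) * \<phi> (-pi) - integral {-pi..pi} (\<lambda>x. g x * \<phi> x)"
  proof (rule integration_by_parts_ac)
    show "U x = U (-pi) + integral {-pi..x} g" if "x \<in> {-pi..pi}" for x
      using acD(5)[OF assms(1), of "-pi" x] that by simp
    show "(\<phi> has_real_derivative deriv \<phi> x) (at x within {-pi..pi})" for x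
      by (rule has_field_derivative_at_within[OF smooth_has_deriv[OF assms(2)]])
  qed (use acD(3)[OF assms(1)] smooth_continuous[OF smooth_deriv[OF assms(2)]] in auto)
  moreover have "U pi = U (-pi)" "\<phi> pi = \<phi> (-pi)"
    using acD(1)[OF assms(1)] assms(3) by (auto simp: circle_periodic_def dest: spec[of _ "-pi"])
  ultimately show ?thesis by simp
qed


section \<open>Weak derivatives\<close>

text \<open>Only functions of mean zero have periodic primitives, hence the correction by the mean
  \<open>\<mu>\<close>.\<close>

lemma test_primitive:
  assumes "\<psi> \<in> test_functions UNIV" and \<mu>: "\<mu> = integral period \<psi> / (2 * pi)"
  obtains \<phi> where "\<phi> \<in> test_functions UNIV" "deriv \<phi> = (\<lambda>x. \<psi> x - \<mu>)"
proof -
  define k where "k = (\<lambda>x. \<psi> x - \<mu>)"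
  have sk: "smooth k"
    using smooth_add[OF test_smooth[OF assms(1)] smooth_const[of "- \<mu>"]] by (simp add: k_def)
  have pk: "circle_periodic k" using test_periodic[OF assms(1)] by (simp add: k_def circle_periodic_def)
  have ck: "continuous_on A k" for A using smooth_continuous[OF sk] .
  have ki: "k integrable_on {a..b}" for a b by (intro integrable_continuous_real ck)
  have ka: "k absolutely_integrable_on {a..b}" for a b by (intro absolutely_integrable_continuous_real ck)
  have "integral period k = integral period \<psi> - integral period (\<lambda>x. \<mu>)"
    unfolding k_def by (intro integral_diff integrable_continuous_real smooth_continuous[OF test_smooth[OF assms(1)]] continuous_intros)
  also have "\<dots> = 0" using \<mu> by simp
  finally have k0: "integral period k = 0" .
  have D: "(prim k has_real_derivative k x) (at x)" for x
  proof -
    have "((\<lambda>y. integral {x-1..y} k) has_real_derivative k x) (at x within {x-1..x+1})"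
      by (rule integral_has_real_derivative) (auto intro: ck)
    then have "((\<lambda>y. prim k (x-1) + integral {x-1..y} k) has_real_derivative k x) (at x within {x-1..x+1})"
      by (auto intro!: derivative_eq_intros)
    moreover have "prim k (x-1) + integral {x-1..y} k = prim k y" if "y \<in> {x-1..x+1}" for y
      using prim_diff[OF ki, of "x-1" y] that by auto
    ultimately have "(prim k has_real_derivative k x) (at x within {x-1..x+1})"
      by (subst has_field_derivative_cong_ev[where g = "\<lambda>y. prim k (x-1) + integral {x-1..y} k"])
         (auto simp: eventually_at_filter)
    then show ?thesis by (simp add: at_within_Icc_at)
  qed
  have "smooth (prim k)" by (rule smooth_from_deriv[OF D sk])
  moreover have "circle_periodic (prim k)"
    using periodic_integral(2)[OF pk ka] k0 by (simp add: circle_periodic_def)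
  moreover have "deriv (prim k) = k" using D DERIV_imp_deriv by blast
  ultimately show ?thesis using that testI_UNIV unfolding k_def by blast
qed

lemma continuous_zero_of_test:
  assumes c: "continuous_on period h"
    and 0: "\<And>\<psi>. \<psi> \<in> test_functions UNIV \<Longrightarrow> integral period (\<lambda>x. h x * \<psi> x) = 0"
    and x: "x \<in> period"
  shows "h x = 0"
proof -
  have "h c = 0" if cpi: "c \<in> {-pi<..<pi}" for c
  proof (rule ccontr)
    assume nz: "h c \<noteq> 0"
    define s where "s = sgn (h c)"
    have sc: "s * h c > 0" using nz by (simp add: s_def sgn_if)
    have "continuous_on period (\<lambda>x. s * h x)" by (intro continuous_intros c)
    then have "((\<lambda>x. s * h x) \<longlongrightarrow> s * h c) (at c within period)"
      using cpi by (auto simp: continuous_on_def)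
    then have "eventually (\<lambda>x. s * h x > 0) (at c within period)"
      using sc by (rule order_tendstoD)
    then obtain d where d: "d > 0" "\<And>x. x \<in> period \<Longrightarrow> x \<noteq> c \<Longrightarrow> \<bar>x - c\<bar> < d \<Longrightarrow> s * h x > 0"
      by (auto simp: eventually_at dist_real_def)
    \<comment> \<open>Besides staying in the neighbourhood of constant sign, \<open>r\<close> is
      smaller than the distance from \<open>c\<close> to the ends of the period, so the bump does
      not wrap around to the other end.\<close>
    define r where "r = min d (pi - \<bar>c\<bar>) / 2"
    have r: "0 < r" "r < d" "r < pi - \<bar>c\<bar>" "r < pi"
      using d(1) cpi unfolding r_def by (auto simp: min_def)
    have bt: "bump c r \<in> test_functions UNIV" by (rule bump_test) simp
    have supp: "\<bar>x - c\<bar> < r" if "bump c r x > 0" "x \<in> period" for x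
    proof (rule ccontr)
      assume *: "\<not> \<bar>x - c\<bar> < r"
      have cs: "cos (x - c) > cos r" using that(1) bump_pos_iff by simp
      show False
      proof (cases "\<bar>x - c\<bar> \<le> pi")
        case True
        then show False using cos_greater_iff[of r "x - c"] cs r * by simp
      next
        case False
        have "cos (2 * pi - \<bar>x - c\<bar>) = cos (x - c)"
          by (simp add: cos_diff cos_abs_real)
        moreover have "\<bar>2 * pi - \<bar>x - c\<bar>\<bar> \<le> pi" using False that(2) cpi by auto
        ultimately have "\<bar>2 * pi - \<bar>x - c\<bar>\<bar> < r" using cos_greater_iff[of r "2 * pi - \<bar>x - c\<bar>"] cs r by simp
        moreover have "\<bar>x - c\<bar> \<le> pi + \<bar>c\<bar>" using that(2) by auto
        ultimately show False using r(3) by linarith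
      qed
    qed
    define k where "k = (\<lambda>x. s * h x * bump c r x)"
    have ck: "continuous_on period k"
      unfolding k_def by (intro continuous_intros c smooth_continuous[OF smooth_bump])
    have k0: "k x \<ge> 0" if "x \<in> period" for x
    proof (cases "bump c r x > 0")
      case True
      then have "s * h x > 0" using supp[OF True that] d(2)[OF that] r sc by (cases "x = c") auto
      then show ?thesis using True by (simp add: k_def)
    next
      case False
      then show ?thesis using bump_nonneg[of c r x] by (simp add: k_def)
    qed
    have "integral period k = s * integral period (\<lambda>x. h x * bump c r x)"
      unfolding k_def by (simp add: mult.assoc)
    then have "integral period k = 0" using 0[OF bt] by simp
    then have "k c = 0"
      using integral_eq_0_iff[OF ck _ k0] cpi by auto
    moreover have "bump c r c > 0"
      using cos_greater_iff[of r 0] r by (simp add: bump_pos_iff)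
    ultimately show False using sc by (auto simp: k_def)
  qed
  then show ?thesis
    using continuous_constant_on_closure[of "{-pi<..<pi}" h 0 x] c x
    by (simp add: closure_greaterThanLessThan)
qed

lemma one_test: "(\<lambda>x. 1) \<in> test_functions UNIV"
  by (rule testI_UNIV[OF smooth_const periodic_const])

text \<open>An integrable \<open>v\<close> has no pointwise sign, so the argument passes to its
  indefinite integral \<open>W\<close>. By parts, \<open>W\<close> is orthogonal to all derivatives
  of test functions, that is, to all test functions of mean zero; being continuous it is constant,
  and it starts at 0.\<close>

lemma fundamental_lemma:
  assumes v: "v absolutely_integrable_on period"
    and 0: "\<And>\<phi>. \<phi> \<in> test_functions UNIV \<Longrightarrow> integral period (\<lambda>x. v x * \<phi> x) = 0"
  shows "AE x in lebesgue. x \<in> period \<longrightarrow> v x = 0"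
proof -
  define W where "W = (\<lambda>x. integral {-pi..x} v)"
  have vi: "v integrable_on period" using v by (simp add: absolutely_integrable_on_def)
  have cW: "continuous_on period W"
    unfolding W_def by (rule indefinite_integral_continuous_1[OF vi])
  have W0: "W (-pi) = 0" "W pi = 0"
    using 0[OF one_test] by (simp_all add: W_def)
  have ibp: "integral period (\<lambda>x. W x * deriv \<phi> x) = 0" if \<phi>: "\<phi> \<in> test_functions UNIV" for \<phi>
  proof -
    have "integral {-pi..pi} (\<lambda>x. W x * deriv \<phi> x) = W pi * \<phi> pi - W (-pi) * \<phi> (-pi) - integral {-pi..pi} (\<lambda>x. v x * \<phi> x)"
    proof (rule integration_by_parts_ac)
      show "W x = W (- pi) + integral {- pi..x} v" for x
        by (simp add: W_def)
      show "(\<phi> has_real_derivative deriv \<phi> x) (at x within {-pi..pi})" for x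
        by (rule has_field_derivative_at_within[OF smooth_has_deriv[OF test_smooth[OF \<phi>]]])
    qed (use v smooth_continuous[OF smooth_deriv[OF test_smooth[OF \<phi>]]] in auto)
    then show ?thesis using W0 0[OF \<phi>] by simp
  qed
  define m where "m = integral period W / (2 * pi)"
  have z: "W x - m = 0" if "x \<in> period" for x
  proof (rule continuous_zero_of_test[of "\<lambda>x. W x - m", OF _ _ that])
    show "continuous_on period (\<lambda>x. W x - m)" by (intro continuous_intros cW)
    fix \<psi> assume \<psi>: "\<psi> \<in> test_functions UNIV"
    define \<mu> where "\<mu> = integral period \<psi> / (2 * pi)"
    obtain \<phi> where \<phi>: "\<phi> \<in> test_functions UNIV" "deriv \<phi> = (\<lambda>x. \<psi> x - \<mu>)"
      using test_primitive[OF \<psi> \<mu>_def] .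
    have c\<psi>: "continuous_on period \<psi>" using smooth_continuous[OF test_smooth[OF \<psi>]] .
    have "0 = integral period (\<lambda>x. W x * \<psi> x - \<mu> * W x)"
      using ibp[OF \<phi>(1)] \<phi>(2) by (simp add: algebra_simps)
    also have "\<dots> = integral period (\<lambda>x. W x * \<psi> x) - \<mu> * integral period W"
      by (subst integral_diff) (auto intro!: integrable_continuous_real continuous_intros cW c\<psi>)
    also have "\<mu> * integral period W = m * integral period \<psi>"
      by (simp add: \<mu>_def m_def)
    also have "integral period (\<lambda>x. W x * \<psi> x) - m * integral period \<psi> = integral period (\<lambda>x. W x * \<psi> x - m * \<psi> x)"
      by (subst integral_diff) (auto intro!: integrable_continuous_real continuous_intros cW c\<psi>)
    finally show "integral period (\<lambda>x. (W x - m) * \<psi> x) = 0"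
      by (simp add: algebra_simps)
  qed
  have "W x = 0" if "x \<in> period" for x
    using z[OF that] z[of "-pi"] W0 by simp
  then have "integral {x..y} v = 0" if "-pi \<le> x" "x \<le> y" "y \<le> pi" for x y
    using indef_integral_diff[OF vi that] that unfolding W_def by simp
  then show ?thesis by (rule AE_zero_of_interval_integrals[OF v])
qed

text \<open>A test function minus its mean is a derivative, and the mean can be moved from the test
  function onto \<open>z\<close>; this reduces the claim to \<open>fundamental_lemma\<close> for
  \<open>z - m\<close>.\<close>

lemma du_bois_reymond:
  assumes z: "z absolutely_integrable_on period"
    and 0: "\<And>\<phi>. \<phi> \<in> test_functions UNIV \<Longrightarrow> integral period (\<lambda>x. z x * deriv \<phi> x) = 0"
  shows "\<exists>m. AE x in lebesgue. x \<in> period \<longrightarrow> z x = m"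
proof -
  define m where "m = integral period z / (2 * pi)"
  have zi: "z integrable_on period" using z by (simp add: absolutely_integrable_on_def)
  have "AE x in lebesgue. x \<in> period \<longrightarrow> z x - m = 0"
  proof (rule fundamental_lemma)
    show "(\<lambda>x. z x - m) absolutely_integrable_on period"
      by (rule set_integral_diff(1)[OF z absolutely_integrable_continuous_real[OF continuous_on_const]])
    fix \<psi> assume \<psi>: "\<psi> \<in> test_functions UNIV"
    define \<mu> where "\<mu> = integral period \<psi> / (2 * pi)"
    obtain \<phi> where \<phi>: "\<phi> \<in> test_functions UNIV" "deriv \<phi> = (\<lambda>x. \<psi> x - \<mu>)"
      using test_primitive[OF \<psi> \<mu>_def] .
    have c\<psi>: "continuous_on period \<psi>" using smooth_continuous[OF test_smooth[OF \<psi>]] .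
    have z\<psi>: "(\<lambda>x. z x * \<psi> x) integrable_on period"
      using abs_int_mult_cont(2)[OF z c\<psi>] by (simp add: absolutely_integrable_on_def)
    have "0 = integral period (\<lambda>x. z x * \<psi> x - \<mu> * z x)"
      using 0[OF \<phi>(1)] \<phi>(2) by (simp add: algebra_simps)
    also have "\<dots> = integral period (\<lambda>x. z x * \<psi> x) - \<mu> * integral period z"
      using z\<psi> zi by (subst integral_diff) (auto intro: integrable_on_mult_right)
    also have "\<mu> * integral period z = m * integral period \<psi>"
      by (simp add: \<mu>_def m_def)
    also have "integral period (\<lambda>x. z x * \<psi> x) - m * integral period \<psi> = integral period (\<lambda>x. z x * \<psi> x - m * \<psi> x)"
      using z\<psi> by (subst integral_diff) (auto intro!: integrable_continuous_real continuous_intros c\<psi>)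
    finally show "integral period (\<lambda>x. (z x - m) * \<psi> x) = 0"
      by (simp add: algebra_simps)
  qed
  then show ?thesis by auto
qed

lemma AE_periodic:
  assumes f: "circle_periodic f" and g: "circle_periodic g"
    and ae: "AE x in lebesgue. x \<in> {-pi<..<pi} \<longrightarrow> f x = g x"
  shows "AE x in lebesgue. f x = (g x :: real)"
proof -
  obtain N where N: "negligible N" "{x. \<not> (x \<in> {-pi<..<pi} \<longrightarrow> f x = g x)} \<subseteq> N"
    using ae unfolding eventually_ae_filter_negligible by blast
  define N' where "N' = insert pi (insert (-pi) N)"
  have N': "negligible N'" "{x \<in> period. f x \<noteq> g x} \<subseteq> N'"
  proof -
    show "negligible N'" using N by (simp add: N'_def negligible_insert)
    have "x \<in> {-pi<..<pi}" if "x \<in> period" "x \<noteq> pi" "x \<noteq> -pi" for x using that by auto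
    then show "{x \<in> period. f x \<noteq> g x} \<subseteq> N'"
      using N(2) unfolding N'_def by blast
  qed
  define B where "B = (\<Union>k::int. (+) (2 * pi * of_int k) ` N')"
  have "negligible B"
    unfolding B_def by (intro negligible_countable_Union) (auto intro: negligible_translation N')
  moreover have "{x. \<not> f x = g x} \<subseteq> B"
  proof
    fix x assume x: "x \<in> {x. \<not> f x = g x}"
    obtain k :: int where k: "x = reduce 0 x + 2 * pi * of_int k" using reduce_shift by blast
    have "f (reduce 0 x) \<noteq> g (reduce 0 x)"
      using x periodic_reduce[OF f] periodic_reduce[OF g] by simp
    then have "reduce 0 x \<in> N'" using N'(2) reduce_bounds[of 0 x] by auto
    then have "2 * pi * of_int k + reduce 0 x \<in> B" unfolding B_def by blast
    then show "x \<in> B" using k by (simp add: add.commute)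
  qed
  ultimately show ?thesis unfolding eventually_ae_filter_negligible by blast
qed

lemma AE_negligible:
  assumes "AE x in lebesgue. P x"
  obtains N where "negligible N" "\<And>x. x \<notin> N \<Longrightarrow> P x"
  using assms unfolding eventually_ae_filter_negligible by blast

lemma L1_loc_UNIV_period: "u \<in> L1_loc UNIV \<Longrightarrow> u absolutely_integrable_on {a..b}"
  by (simp add: L1_loc_def)

lemma L1_locI_continuous:
  assumes "circle_periodic U" "continuous_on UNIV U"
  shows "U \<in> L1_loc V"
proof -
  have "U absolutely_integrable_on K" if cK: "compact K" for K
  proof -
    obtain a where "K \<subseteq> {-a..a}"
      using bounded_subset_cbox_symmetric[OF compact_imp_bounded[OF cK]] by auto
    moreover have "U absolutely_integrable_on {-a..a}"
      by (intro absolutely_integrable_continuous_real continuous_on_subset[OF assms(2)]) auto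
    ultimately show ?thesis
      using that by (intro set_integrable_subset[of lebesgue "{-a..a}" U K]) (auto intro: fmeasurableD lmeasurable_compact)
  qed
  then show ?thesis using assms(1) by (simp add: L1_loc_def)
qed

lemma L1_locI_abs_int:
  assumes "circle_periodic g" "g absolutely_integrable_on period"
  shows "g \<in> L1_loc V"
proof -
  have "g absolutely_integrable_on K" if cK: "compact K" for K
  proof -
    obtain a where "K \<subseteq> {-a..a}"
      using bounded_subset_cbox_symmetric[OF compact_imp_bounded[OF cK]] by auto
    moreover have "g absolutely_integrable_on {-a..a}"
      using periodic_abs_int[OF assms(1), of 0] assms(2) by simp
    ultimately show ?thesis
      using that by (intro set_integrable_subset[of lebesgue "{-a..a}" g K]) (auto intro: fmeasurableD lmeasurable_compact)
  qed
  then show ?thesis using assms(1) by (simp add: L1_loc_def)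
qed

lemma abs_int_AE:
  fixes f g :: "real \<Rightarrow> real"
  assumes "f absolutely_integrable_on S" and ae: "AE x in lebesgue. x \<in> S \<longrightarrow> g x = f x"
  shows "g absolutely_integrable_on S" "integral S g = integral S f"
proof -
  obtain N where N: "negligible N" "\<And>x. x \<notin> N \<Longrightarrow> x \<in> S \<longrightarrow> g x = f x"
    using AE_negligible[OF ae] by blast
  show "g absolutely_integrable_on S"
    by (rule absolutely_integrable_spike[OF assms(1) N(1)]) (use N in auto)
  show "integral S g = integral S f"
    by (rule integral_spike[OF N(1)]) (use N in auto)
qed

section \<open>Weak derivatives and absolutely continuous representatives\<close>

lemma weak_deriv_period_integrals:
  assumes "has_weak_deriv k UNIV u v" "\<phi> \<in> test_functions UNIV"
  shows "(\<lambda>x. u x * (deriv ^^ k) \<phi> x) absolutely_integrable_on period"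
    "(\<lambda>x. v x * \<phi> x) absolutely_integrable_on period"
    "integral period (\<lambda>x. u x * (deriv ^^ k) \<phi> x) = (-1) ^ k * integral period (\<lambda>x. v x * \<phi> x)"
proof -
  have u: "u absolutely_integrable_on period" and v: "v absolutely_integrable_on period"
    using assms(1) by (auto simp: has_weak_deriv_def L1_loc_UNIV_period)
  have c: "continuous_on period ((deriv ^^ j) \<phi>)" for j
  proof -
    have "smooth ((deriv ^^ j) \<phi>)"
      by (induction j) (auto intro: smooth_deriv test_smooth[OF assms(2)])
    then show ?thesis by (rule smooth_continuous)
  qed
  show 1: "(\<lambda>x. u x * (deriv ^^ k) \<phi> x) absolutely_integrable_on period"
    by (rule abs_int_mult_cont(2)[OF u c])
  show 2: "(\<lambda>x. v x * \<phi> x) absolutely_integrable_on period"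
    using abs_int_mult_cont(2)[OF v c[of 0]] by simp
  show "integral period (\<lambda>x. u x * (deriv ^^ k) \<phi> x) = (-1) ^ k * integral period (\<lambda>x. v x * \<phi> x)"
    using assms set_lebesgue_integral_eq_integral(2)[OF 1] set_lebesgue_integral_eq_integral(2)[OF 2]
    by (simp add: has_weak_deriv_def)
qed

text \<open>Testing with the constant 1 shows that \<open>v\<close> has mean zero, so
  \<open>prim v\<close> is periodic. The difference of \<open>u\<close> and \<open>prim v\<close>
  then has weak derivative zero and is constant almost everywhere.\<close>

lemma weak_deriv_ac:
  assumes w: "has_weak_deriv 1 UNIV u v"
  obtains U where "ac U v" "AE x in lebesgue. U x = u x"
proof -
  have u: "u absolutely_integrable_on period" and v: "v absolutely_integrable_on {a..b}"
    and pu: "circle_periodic u" and pv: "circle_periodic v" for a b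
    using w by (auto simp: has_weak_deriv_def L1_loc_UNIV_period) (auto simp: L1_loc_def)
  have vi: "v integrable_on {a..b}" for a b using v by (simp add: absolutely_integrable_on_def)
  have "integral period (\<lambda>x. u x * deriv (\<lambda>x. 1) x) = - integral period v"
    using weak_deriv_period_integrals(3)[OF w one_test] by simp
  then have v0: "integral period v = 0" by simp
  have a: "ac (prim v) v"
    unfolding ac_def
  proof (intro conjI allI impI)
    show "circle_periodic (prim v)"
      using periodic_integral(2)[OF pv v] v0 by (simp add: circle_periodic_def)
  qed (use prim_diff[OF vi] pv v in auto)
  define z where "z = (\<lambda>x. u x - prim v x)"
  have cp: "continuous_on period (prim v)" by (rule ac_continuous[OF a])
  have "\<exists>m. AE x in lebesgue. x \<in> period \<longrightarrow> z x = m"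
  proof (rule du_bois_reymond)
    show "z absolutely_integrable_on period"
      unfolding z_def by (rule set_integral_diff(1)[OF u absolutely_integrable_continuous_real[OF cp]])
    fix \<phi> assume \<phi>: "\<phi> \<in> test_functions UNIV"
    have "(\<lambda>x. u x * deriv \<phi> x) integrable_on period"
      using weak_deriv_period_integrals(1)[OF w \<phi>] by (simp add: absolutely_integrable_on_def)
    moreover have "(\<lambda>x. prim v x * deriv \<phi> x) integrable_on period"
      by (intro integrable_continuous_real continuous_intros cp smooth_continuous[OF smooth_deriv[OF test_smooth[OF \<phi>]]])
    ultimately have "integral period (\<lambda>x. z x * deriv \<phi> x)
        = integral period (\<lambda>x. u x * deriv \<phi> x) - integral period (\<lambda>x. prim v x * deriv \<phi> x)"
      unfolding z_def by (subst integral_diff[symmetric]) (auto simp: left_diff_distrib)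
    then show "integral period (\<lambda>x. z x * deriv \<phi> x) = 0"
      using weak_deriv_period_integrals(3)[OF w \<phi>] ac_by_parts[OF a test_smooth[OF \<phi>] test_periodic[OF \<phi>]] by simp
  qed
  then obtain m where m: "AE x in lebesgue. x \<in> period \<longrightarrow> z x = m" by blast
  have a': "ac (\<lambda>x. prim v x + m) v"
    using ac_lincomb[OF a ac_const[of 1], of m] by simp
  have "AE x in lebesgue. prim v x + m = u x"
  proof (rule AE_periodic[OF acD(1)[OF a'] pu])
    show "AE x in lebesgue. x \<in> {- pi<..<pi} \<longrightarrow> prim v x + m = u x"
      using m by eventually_elim (auto simp: z_def)
  qed
  then show ?thesis using that a' by blast
qed

lemma ac_weak_deriv:
  assumes a: "ac U g" and u: "circle_periodic u" and ae: "AE x in lebesgue. U x = u x"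
  shows "has_weak_deriv 1 UNIV u g"
proof -
  have ae': "AE x in lebesgue. x \<in> S \<longrightarrow> u x = U x" for S using ae by eventually_elim simp
  have cU: "continuous_on A U" for A by (rule ac_continuous[OF a])
  have Ui: "U absolutely_integrable_on period" by (intro absolutely_integrable_continuous_real cU)
  have ui: "u absolutely_integrable_on period" by (rule abs_int_AE(1)[OF Ui ae'])
  have gi: "g absolutely_integrable_on period" by (rule acD(3)[OF a])
  show ?thesis unfolding has_weak_deriv_def
  proof (intro conjI ballI)
    show "u \<in> L1_loc UNIV" "g \<in> L1_loc UNIV"
      using L1_locI_abs_int u ui acD(2)[OF a] gi by auto
    fix \<phi> assume \<phi>: "\<phi> \<in> test_functions UNIV"
    have c: "continuous_on period \<phi>" "continuous_on period (deriv \<phi>)"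
      using smooth_continuous[OF test_smooth[OF \<phi>]] smooth_continuous[OF smooth_deriv[OF test_smooth[OF \<phi>]]] by auto
    have Ud: "(\<lambda>x. U x * deriv \<phi> x) absolutely_integrable_on period"
      by (rule abs_int_mult_cont[OF Ui c(2)])
    have ud: "(\<lambda>x. u x * deriv \<phi> x) absolutely_integrable_on period"
      "integral period (\<lambda>x. u x * deriv \<phi> x) = integral period (\<lambda>x. U x * deriv \<phi> x)"
      by (rule abs_int_AE[OF Ud]; use ae in eventually_elim, simp)+
    have gp: "(\<lambda>x. g x * \<phi> x) absolutely_integrable_on period"
      by (rule abs_int_mult_cont[OF gi c(1)])
    show "(LINT x:period|lebesgue. u x * (deriv ^^ 1) \<phi> x) = (- 1) ^ 1 * (LINT x:period|lebesgue. g x * \<phi> x)"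
      using set_lebesgue_integral_eq_integral(2)[OF ud(1)] set_lebesgue_integral_eq_integral(2)[OF gp] ud(2)
        ac_by_parts[OF a test_smooth[OF \<phi>] test_periodic[OF \<phi>]] by simp
  qed
qed

lemma weak_deriv_unique:
  assumes "has_weak_deriv k UNIV u v" "has_weak_deriv k UNIV u w"
  shows "AE x in lebesgue. v x = w x"
proof -
  have v: "v absolutely_integrable_on period" "circle_periodic v" and w: "w absolutely_integrable_on period" "circle_periodic w"
    using assms by (auto simp: has_weak_deriv_def L1_loc_UNIV_period) (auto simp: L1_loc_def)
  have "AE x in lebesgue. x \<in> period \<longrightarrow> v x - w x = 0"
  proof (rule fundamental_lemma)
    show "(\<lambda>x. v x - w x) absolutely_integrable_on period" using v w by (intro set_integral_diff)
    fix \<phi> assume \<phi>: "\<phi> \<in> test_functions UNIV"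
    have "integral period (\<lambda>x. v x * \<phi> x) = integral period (\<lambda>x. w x * \<phi> x)"
      using weak_deriv_period_integrals(3)[OF assms(1) \<phi>] weak_deriv_period_integrals(3)[OF assms(2) \<phi>] by simp
    then show "integral period (\<lambda>x. (v x - w x) * \<phi> x) = 0"
      using weak_deriv_period_integrals(2)[OF assms(1) \<phi>] weak_deriv_period_integrals(2)[OF assms(2) \<phi>]
      by (simp add: left_diff_distrib integral_diff absolutely_integrable_on_def)
  qed
  then have "AE x in lebesgue. x \<in> {-pi<..<pi} \<longrightarrow> v x = w x"
    by eventually_elim auto
  then show ?thesis by (rule AE_periodic[OF v(2) w(2)])
qed

lemma weak_deriv_eq:
  assumes "has_weak_deriv k UNIV u v"
  shows "has_weak_deriv k UNIV u (weak_deriv k UNIV u)" "AE x in lebesgue. weak_deriv k UNIV u x = v x"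
proof -
  show 1: "has_weak_deriv k UNIV u (weak_deriv k UNIV u)"
    unfolding weak_deriv_def using assms by (rule someI[of "has_weak_deriv k UNIV u"])
  show "AE x in lebesgue. weak_deriv k UNIV u x = v x"
    by (rule weak_deriv_unique[OF 1 assms])
qed

lemma weak_deriv_2_iff:
  assumes "has_weak_deriv 1 UNIV u v" "has_weak_deriv 2 UNIV u w"
  shows "has_weak_deriv 1 UNIV v w"
  unfolding has_weak_deriv_def
proof (intro conjI ballI)
  show v: "v \<in> L1_loc UNIV" "w \<in> L1_loc UNIV" using assms by (auto simp: has_weak_deriv_def)
  fix \<phi> assume \<phi>: "\<phi> \<in> test_functions UNIV"
  have "deriv \<phi> \<in> test_functions UNIV" by (rule test_deriv[OF \<phi>])
  then show "(LINT x:period|lebesgue. v x * (deriv ^^ 1) \<phi> x) = (- 1) ^ 1 * (LINT x:period|lebesgue. w x * \<phi> x)"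
    using assms \<phi> by (auto simp: has_weak_deriv_def numeral_2_eq_2)
qed

lemma weak_deriv_compose:
  assumes "has_weak_deriv 1 UNIV u v" "has_weak_deriv 1 UNIV v w"
  shows "has_weak_deriv 2 UNIV u w"
  unfolding has_weak_deriv_def
proof (intro conjI ballI)
  show v: "u \<in> L1_loc UNIV" "w \<in> L1_loc UNIV" using assms by (auto simp: has_weak_deriv_def)
  fix \<phi> assume \<phi>: "\<phi> \<in> test_functions UNIV"
  have "deriv \<phi> \<in> test_functions UNIV" by (rule test_deriv[OF \<phi>])
  then show "(LINT x:period|lebesgue. u x * (deriv ^^ 2) \<phi> x) = (- 1) ^ 2 * (LINT x:period|lebesgue. w x * \<phi> x)"
    using assms \<phi> by (auto simp: has_weak_deriv_def numeral_2_eq_2)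
qed

section \<open>Localization by cut-off functions\<close>

text \<open>A cut-off turns the equation r' = 0, known only on \<open>P\<close>, into the global
  equation (r b)' = r b', to which \<open>weak_deriv_ac\<close> applies. It is enough to test with
  \<open>b\<close> times an arbitrary periodic test function.\<close>

lemma localize_ac:
  assumes r: "circle_periodic r" "r absolutely_integrable_on period"
    and 0: "\<And>\<phi>. \<phi> \<in> test_functions P \<Longrightarrow> integral period (\<lambda>x. r x * deriv \<phi> x) = 0"
    and b: "b \<in> test_functions P"
  obtains A where "ac A (\<lambda>x. r x * deriv b x)" "AE x in lebesgue. A x = r x * b x"
proof -
  have cb: "continuous_on period b" "continuous_on period (deriv b)"
    using smooth_continuous[OF test_smooth[OF b]] smooth_continuous[OF smooth_deriv[OF test_smooth[OF b]]] by auto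
  have i1: "(\<lambda>x. r x * b x) absolutely_integrable_on period" and i2: "(\<lambda>x. r x * deriv b x) absolutely_integrable_on period"
    by (rule abs_int_mult_cont[OF r(2) cb(1)], rule abs_int_mult_cont[OF r(2) cb(2)])
  have "has_weak_deriv 1 UNIV (\<lambda>x. r x * b x) (\<lambda>x. r x * deriv b x)"
    unfolding has_weak_deriv_def
  proof (intro conjI ballI)
    show "(\<lambda>x. r x * b x) \<in> L1_loc UNIV" "(\<lambda>x. r x * deriv b x) \<in> L1_loc UNIV"
      using i1 i2 r(1) test_periodic[OF b] periodic_deriv[OF test_periodic[OF b]]
      by (auto intro!: L1_locI_abs_int periodic_mult)
    fix p assume p: "p \<in> test_functions UNIV"
    have cp: "continuous_on period p" "continuous_on period (deriv p)"
      using smooth_continuous[OF test_smooth[OF p]] smooth_continuous[OF smooth_deriv[OF test_smooth[OF p]]] by auto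
    have D: "deriv (\<lambda>x. b x * p x) = (\<lambda>x. b x * deriv p x + deriv b x * p x)"
      by (rule ext, rule DERIV_imp_deriv)
         (use DERIV_mult[OF smooth_has_deriv[OF test_smooth[OF b]] smooth_has_deriv[OF test_smooth[OF p]]] in
           \<open>simp add: algebra_simps\<close>)
    have j1: "(\<lambda>x. r x * b x * deriv p x) absolutely_integrable_on period"
      by (rule abs_int_mult_cont[OF i1 cp(2)])
    have j2: "(\<lambda>x. r x * deriv b x * p x) absolutely_integrable_on period"
      by (rule abs_int_mult_cont[OF i2 cp(1)])
    have "integral period (\<lambda>x. r x * b x * deriv p x) + integral period (\<lambda>x. r x * deriv b x * p x)
       = integral period (\<lambda>x. r x * b x * deriv p x + r x * deriv b x * p x)"
      using j1 j2 by (simp add: integral_add absolutely_integrable_on_def)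
    also have "\<dots> = 0" using 0[OF test_mult[OF b p]] by (simp add: D algebra_simps)
    finally show "(LINT x:period|lebesgue. r x * b x * (deriv ^^ 1) p x) = (- 1) ^ 1 * (LINT x:period|lebesgue. r x * deriv b x * p x)"
      using set_lebesgue_integral_eq_integral(2)[OF j1] set_lebesgue_integral_eq_integral(2)[OF j2] by simp
  qed
  then show ?thesis using weak_deriv_ac that by metis
qed

lemma L1_loc_test_abs_int:
  assumes "d \<in> L1_loc P" "\<phi> \<in> test_functions P"
  shows "(\<lambda>x. d x * \<phi> x) absolutely_integrable_on period"
proof -
  define K where "K = closure {x. \<phi> x \<noteq> 0} \<inter> period"
  have K: "compact K" "K \<subseteq> P" using assms(2) by (auto simp: K_def test_functions_def intro: closed_Int_compact)
  then have dK: "d absolutely_integrable_on K" using assms(1) by (simp add: L1_loc_def)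
  have c: "continuous_on A \<phi>" for A using smooth_continuous[OF test_smooth[OF assms(2)]] .
  have KL: "K \<in> sets lebesgue" using K(1) by (intro fmeasurableD lmeasurable_compact)
  have "(\<lambda>x. \<phi> x * d x) absolutely_integrable_on K"
  proof (rule absolutely_integrable_bounded_measurable_product_real[OF _ KL _ dK])
    show "\<phi> \<in> borel_measurable (lebesgue_on K)" by (rule continuous_imp_measurable_on_sets_lebesgue[OF c KL])
    show "bounded (\<phi> ` K)" by (intro compact_imp_bounded compact_continuous_image c K)
  qed
  moreover have "indicator K x * (\<phi> x * d x) = indicator period x * (d x * \<phi> x)" for x
    using closure_subset[of "{x. \<phi> x \<noteq> 0}"] by (auto simp: K_def indicator_def)
  ultimately show ?thesis by (simp add: set_integrable_def)
qed

lemma localize_zero: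
  assumes d: "d \<in> L1_loc P"
    and 0: "\<And>\<phi>. \<phi> \<in> test_functions P \<Longrightarrow> integral period (\<lambda>x. d x * \<phi> x) = 0"
    and b: "b \<in> test_functions P"
  shows "AE x in lebesgue. x \<in> period \<longrightarrow> b x \<noteq> 0 \<longrightarrow> d x = 0"
proof -
  have "AE x in lebesgue. x \<in> period \<longrightarrow> d x * b x = 0"
  proof (rule fundamental_lemma)
    show "(\<lambda>x. d x * b x) absolutely_integrable_on period" by (rule L1_loc_test_abs_int[OF d b])
    fix \<phi> assume \<phi>: "\<phi> \<in> test_functions UNIV"
    show "integral period (\<lambda>x. d x * b x * \<phi> x) = 0"
      using 0[OF test_mult[OF b \<phi>]] by (simp add: mult.assoc)
  qed
  then show ?thesis by eventually_elim auto
qed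


section \<open>Steady states as solutions of an ordinary differential equation\<close>

text \<open>The function \<open>r\<close> is the multiplier, locally constant on the positivity set
  but free to change from one component to the next. Nothing is required of second derivatives at
  zeros of \<open>V\<close>; only continuity of \<open>V1\<close> links the components.\<close>

locale steady =
  fixes \<alpha> :: real and V V1 r :: "real \<Rightarrow> real"
  assumes \<alpha>: "\<alpha> > 0"
    and per: "circle_periodic V"
    and nonneg: "0 \<le> V x"
    and D: "(V has_real_derivative V1 x) (at x)"
    and cont1: "continuous_on UNIV V1"
    and D1: "V x > 0 \<Longrightarrow> (V1 has_real_derivative r x - \<alpha>\<^sup>2 * V x - cos x) (at x)"
    and Dr: "V x > 0 \<Longrightarrow> (r has_real_derivative 0) (at x)"
begin

lemma per1: "circle_periodic V1"
  using periodic_deriv[OF per] D DERIV_imp_deriv[of V] by (metis (no_types, lifting) ext)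

lemma contV: "continuous_on A V"
  by (meson D DERIV_isCont continuous_at_imp_continuous_on)

lemma contV1: "continuous_on A V1"
  using cont1 continuous_on_subset by blast

text \<open>A zero of a nonnegative function is a minimum. This is the zero contact angle condition,
  and it provides the boundary data of every Wronskian below.\<close>

lemma V1_zero: "V x = 0 \<Longrightarrow> V1 x = 0"
  using DERIV_local_min[OF D, of 1 x] nonneg by auto

lemma r_const:
  assumes "\<And>y. a < y \<Longrightarrow> y < b \<Longrightarrow> V y > 0" "a < x" "x < b" "a < y" "y < b"
  shows "r x = r y"
proof -
  have "\<exists>c. \<forall>x\<in>{a<..<b}. r x = c"
    by (rule has_field_derivative_zero_constant) (use assms(1) Dr in \<open>auto intro: has_field_derivative_at_within\<close>)
  then show ?thesis using assms by auto
qed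

lemma component:
  assumes x: "V x > 0" and z: "V z = 0"
  obtains a b where "a < x" "x < b" "V a = 0" "V b = 0" "b - a \<le> 2 * pi"
    "\<And>y. a < y \<Longrightarrow> y < b \<Longrightarrow> V y > 0"
proof -
  define L where "L = {..x} \<inter> V -` {0}"
  define R where "R = {x..} \<inter> V -` {0}"
  have cl: "closed L" "closed R" unfolding L_def R_def
    by (intro continuous_closed_preimage contV; simp)+
  obtain k :: int where k: "z - x < 2 * pi * of_int k"
    using ex_less_of_int[of "(z - x) / (2 * pi)"] by (auto simp: field_simps)
  obtain j :: int where j: "x - z < 2 * pi * of_int j"
    using ex_less_of_int[of "(x - z) / (2 * pi)"] by (auto simp: field_simps)
  have "z + 2 * pi * of_int (-k) \<in> L" "z + 2 * pi * of_int j \<in> R"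
    using periodic_int[OF per, of z "-k"] periodic_int[OF per, of z j] z k j by (auto simp: L_def R_def)
  then have ne: "L \<noteq> {}" "R \<noteq> {}" by auto
  have bd: "bdd_above L" "bdd_below R" by (auto simp: L_def R_def)
  define a b where "a = Sup L" and "b = Inf R"
  have aL: "a \<in> L" unfolding a_def by (rule closed_contains_Sup[OF ne(1) bd(1) cl(1)])
  have bR: "b \<in> R" unfolding b_def by (rule closed_contains_Inf[OF ne(2) bd(2) cl(2)])
  have a: "a < x" "V a = 0" using aL x by (auto simp: L_def order_less_le)
  have b: "x < b" "V b = 0" using bR x by (auto simp: R_def order_less_le)
  have pos: "V y > 0" if "a < y" "y < b" for y
  proof (rule ccontr)
    assume "\<not> V y > 0"
    then have "V y = 0" using nonneg[of y] by linarith
    then have "y \<in> L \<or> y \<in> R" by (auto simp: L_def R_def)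
    then show False
      using cSup_upper[OF _ bd(1), of y] cInf_lower[OF _ bd(2), of y] that by (auto simp: a_def b_def)
  qed
  have "b \<le> a + 2 * pi"
  proof (rule ccontr)
    assume "\<not> ?thesis"
    then have "V (a + 2 * pi) > 0" using pos[of "a + 2 * pi"] by simp
    then show False using per a by (simp add: circle_periodic_def)
  qed
  then show ?thesis using that a b pos by auto
qed

text \<open>The part of \<open>V\<close> odd about \<open>c\<close> solves the homogeneous
  oscillator equation, because the forcing is even about \<open>c\<close>; its data vanish at
  \<open>l\<close>, so it vanishes. Differentiating the equation removes the multiplier, and the
  Wronskian \<open>W\<close> of \<open>V1\<close> with \<open>sin (\<alpha> * y)\<close> then
  increases from 0. At \<open>\<alpha> * l = pi\<close> it would have to return to 0. Otherwise
  \<open>V1\<close> divided by the sine increases to its value 0 at \<open>l\<close>, which fixes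
  the sign of \<open>V1\<close>. The end values of \<open>V\<close> need only agree, so that
  \<open>l = pi\<close> with \<open>V\<close> positive everywhere is covered.\<close>

lemma core:
  assumes l: "0 < l" "l \<le> pi" "\<alpha> * l \<le> pi" and pos: "\<And>y. \<bar>y - c\<bar> < l \<Longrightarrow> V y > 0"
    and s: "sin c = 0" and e: "V (c + l) = V (c - l)" "V1 (c + l) = 0" "V1 (c - l) = 0"
  shows "\<alpha> * l < pi" "0 \<le> y \<Longrightarrow> y \<le> l \<Longrightarrow> V (c + y) = V (c - y)"
    "0 < y \<Longrightarrow> y < l \<Longrightarrow> cos c * V1 (c + y) < 0"
proof -
  define q where "q = (\<lambda>x. r c - \<alpha>\<^sup>2 * V x - cos x)"
  have rc: "r y = r c" if "\<bar>y - c\<bar> < l" for y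
    by (rule r_const[of "c - l" "c + l"]) (use pos that l in auto)
  have D1': "(V1 has_real_derivative q y) (at y)" if "\<bar>y - c\<bar> < l" for y
    using D1[OF pos[OF that]] rc[OF that] by (simp add: q_def)
  have sh: "((\<lambda>y. c + y) has_real_derivative 1) (at y)" "((\<lambda>y. c - y) has_real_derivative -1) (at y)" for y
    by (auto intro!: derivative_eq_intros)
  have Dp: "((\<lambda>y. V (c + y)) has_real_derivative V1 (c + y)) (at y)" for y
    using DERIV_chain2[OF D sh(1)] by simp
  have Dm: "((\<lambda>y. V (c - y)) has_real_derivative - V1 (c - y)) (at y)" for y
    using DERIV_chain2[OF D sh(2)] by simp
  have D1p: "((\<lambda>y. V1 (c + y)) has_real_derivative q (c + y)) (at y)" if "\<bar>y\<bar> < l" for y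
    using DERIV_chain2[OF D1' sh(1), of y] that by simp
  have D1m: "((\<lambda>y. V1 (c - y)) has_real_derivative - q (c - y)) (at y)" if "\<bar>y\<bar> < l" for y
    using DERIV_chain2[OF D1' sh(2), of y] that by simp
  have cs: "cos (c + y) = cos c * cos y" "cos (c - y) = cos c * cos y" for y
    using s by (simp_all add: cos_add cos_diff)
  define Od where "Od = (\<lambda>y. V (c + y) - V (c - y))"
  define Od1 where "Od1 = (\<lambda>y. V1 (c + y) + V1 (c - y))"
  have DO: "(Od has_real_derivative Od1 y) (at y)" for y
    unfolding Od_def Od1_def using DERIV_diff[OF Dp Dm] by simp
  have DO1: "(Od1 has_real_derivative - \<alpha>\<^sup>2 * Od y) (at y)" if "\<bar>y\<bar> < l" for y
    unfolding Od1_def using DERIV_add[OF D1p[OF that] D1m[OF that]]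
    by (simp add: q_def cs Od_def algebra_simps)
  have cc: "continuous_on A (\<lambda>y. V (c + y))" "continuous_on A (\<lambda>y. V (c - y))"
    "continuous_on A (\<lambda>y. V1 (c + y))" "continuous_on A (\<lambda>y. V1 (c - y))" for A
    by (auto intro!: continuous_on_compose2[OF contV[of UNIV]] continuous_on_compose2[OF contV1[of UNIV]] continuous_intros)
  have cO: "continuous_on A Od" "continuous_on A Od1" for A
    unfolding Od_def Od1_def by (intro continuous_intros cc)+
  \<comment> \<open>The conserved energy of the oscillator; it vanishes at the end
    \<open>l\<close>.\<close>
  define H where "H = (\<lambda>y. (Od1 y)\<^sup>2 + \<alpha>\<^sup>2 * (Od y)\<^sup>2)"
  have cH: "continuous_on {0..l} H" unfolding H_def by (intro continuous_intros cO)
  have DH: "(H has_real_derivative 0) (at y)" if "0 < y" "y < l" for y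
  proof -
    have "(H has_real_derivative (2 * Od1 y * (- \<alpha>\<^sup>2 * Od y) + \<alpha>\<^sup>2 * (2 * Od y * Od1 y))) (at y)"
      unfolding H_def using DO[of y] DO1[of y] that by (auto intro!: derivative_eq_intros)
    then show ?thesis by (simp add: algebra_simps)
  qed
  have Hl: "H l = 0" using e by (simp add: H_def Od_def Od1_def)
  have "H y = H 0" if "0 \<le> y" "y \<le> l" for y
    using DERIV_isconst2[OF l(1) cH DH, of y] that by auto
  then have H0: "H y = 0" if "0 \<le> y" "y \<le> l" for y
    using that Hl l(1) by (metis less_eq_real_def)
  have O0: "Od y = 0" "Od1 y = 0" if "0 \<le> y" "y \<le> l" for y
    using H0[OF that] \<alpha> unfolding H_def by (simp_all add: add_nonneg_eq_0_iff)
  show "V (c + y) = V (c - y)" if "0 \<le> y" "y \<le> l" for y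
    using O0(1)[OF that] by (simp add: Od_def)
  have V1c: "V1 c = 0" using O0(2)[of 0] l by (simp add: Od1_def)
  define W where "W = (\<lambda>y. cos c * (q (c + y) * sin (\<alpha> * y) - \<alpha> * V1 (c + y) * cos (\<alpha> * y)))"
  have cq: "continuous_on A (\<lambda>y. q (c + y))" for A
    unfolding q_def by (intro continuous_intros cc)
  have cW: "continuous_on A W" for A unfolding W_def by (intro continuous_intros cc cq)
  have cos2: "cos c * cos c = 1" using s sin_cos_squared_add[of c] by (simp add: power2_eq_square)
  have DW: "(W has_real_derivative (sin y * sin (\<alpha> * y))) (at y)" if "0 < y" "y < l" for y
  proof -
    have Dq: "((\<lambda>y. q (c + y)) has_real_derivative - \<alpha>\<^sup>2 * V1 (c + y) + sin (c + y)) (at y)"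
      unfolding q_def using Dp[of y] by (auto intro!: derivative_eq_intros)
    have "(W has_real_derivative cos c * ((- \<alpha>\<^sup>2 * V1 (c + y) + sin (c + y)) * sin (\<alpha> * y) + q (c + y) * (\<alpha> * cos (\<alpha> * y))
        - \<alpha> * (q (c + y) * cos (\<alpha> * y) + V1 (c + y) * (- \<alpha> * sin (\<alpha> * y))))) (at y)"
      unfolding W_def using Dq D1p[of y] that
      by (auto intro!: derivative_eq_intros simp: algebra_simps)
    moreover have "cos c * ((- \<alpha>\<^sup>2 * V1 (c + y) + sin (c + y)) * sin (\<alpha> * y) + q (c + y) * (\<alpha> * cos (\<alpha> * y))
        - \<alpha> * (q (c + y) * cos (\<alpha> * y) + V1 (c + y) * (- \<alpha> * sin (\<alpha> * y)))) = cos c * sin (c + y) * sin (\<alpha> * y)"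
      by (simp add: algebra_simps power2_eq_square)
    moreover have "cos c * sin (c + y) = sin y"
      using s cos2 by (simp add: sin_add mult.assoc[symmetric])
    ultimately show ?thesis by simp
  qed
  have Wpos: "W y > 0" if "0 < y" "y \<le> l" for y
  proof -
    have "W 0 < W y"
    proof (rule DERIV_pos_imp_increasing_open[OF that(1)])
      fix x assume x: "0 < x" "x < y"
      have "\<alpha> * x < \<alpha> * l" using x that \<alpha> by simp
      moreover have "0 < \<alpha> * x" using x \<alpha> by simp
      ultimately have "sin (\<alpha> * x) > 0" using l by (intro sin_gt_zero) linarith+
      moreover have "sin x > 0" using x that l by (intro sin_gt_zero) auto
      ultimately show "\<exists>d. (W has_real_derivative d) (at x) \<and> 0 < d"
        using DW[of x] x that by (intro exI[of _ "sin x * sin (\<alpha> * x)"]) auto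
    qed (rule cW)
    then show ?thesis using V1c by (simp add: W_def)
  qed
  show al: "\<alpha> * l < pi"
  proof (rule ccontr)
    assume "\<not> ?thesis"
    then have "\<alpha> * l = pi" using l by simp
    then have "W l = 0" using e by (simp add: W_def)
    then show False using Wpos[of l] l by simp
  qed
  have sp: "sin (\<alpha> * y) > 0" if "0 < y" "y \<le> l" for y
  proof -
    have "\<alpha> * y \<le> \<alpha> * l" "0 < \<alpha> * y" using that \<alpha> by simp_all
    then show ?thesis using al by (intro sin_gt_zero) linarith+
  qed
  show "cos c * V1 (c + y) < 0" if y: "0 < y" "y < l"
  proof -
    \<comment> \<open>The derivative of this quotient is \<open>W\<close> over the squared
      sine.\<close>
    define g where "g = (\<lambda>y. cos c * V1 (c + y) / sin (\<alpha> * y))"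
    have "g y < g l"
    proof (rule DERIV_pos_imp_increasing_open[OF y(2)])
      fix x assume x: "y < x" "x < l"
      have sx: "sin (\<alpha> * x) > 0" using sp[of x] x y by simp
      have "(g has_real_derivative W x / (sin (\<alpha> * x))\<^sup>2) (at x)"
        unfolding g_def using D1p[of x] x y sx
        by (auto intro!: derivative_eq_intros simp: W_def power2_eq_square algebra_simps)
      then show "\<exists>d. (g has_real_derivative d) (at x) \<and> 0 < d"
        using Wpos[of x] sx x y by (intro exI[of _ "W x / (sin (\<alpha> * x))\<^sup>2"]) auto
      next
      show "continuous_on {y..l} g" unfolding g_def
        by (intro continuous_intros cc) (use sp y in \<open>auto simp: less_imp_neq[THEN not_sym]\<close>)
    qed
    then have "g y < 0" using e by (simp add: g_def)
    then show ?thesis using sp[of y] y by (simp add: g_def divide_less_0_iff)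
  qed
qed

text \<open>About any centre the odd part \<open>Od\<close> satisfies Od'' + \<alpha>^2 Od = 2 sin c
  sin y, without the multiplier. Its Wronskian with \<open>sin (\<alpha> * y)\<close> vanishes at
  both ends and would be strictly monotone unless \<open>sin c = 0\<close>.\<close>

lemma component_centre:
  assumes ab: "a < b" and z: "V a = 0" "V b = 0" and pos: "\<And>y. a < y \<Longrightarrow> y < b \<Longrightarrow> V y > 0"
    and len: "b - a \<le> 2 * pi" "\<alpha> * ((b - a) / 2) \<le> pi"
  obtains k :: int where "(a + b) / 2 = 2 * pi * of_int k"
proof -
  define c l where "c = (a + b) / 2" and "l = (b - a) / 2"
  have l: "0 < l" "l \<le> pi" "\<alpha> * l \<le> pi" using ab len by (auto simp: l_def)
  have clb: "c + l = b" "c - l = a" by (auto simp: c_def l_def field_simps)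
  have pos': "V y > 0" if "\<bar>y - c\<bar> < l" for y using pos[of y] that clb by (auto simp: abs_less_iff)
  have e: "V (c + l) = V (c - l)" "V1 (c + l) = 0" "V1 (c - l) = 0" using z V1_zero clb by auto
  have sc: "sin c = 0"
  proof (rule ccontr)
    assume ns: "sin c \<noteq> 0"
    define s where "s = sgn (sin c)"
    have ss: "s * sin c > 0" using ns by (simp add: s_def sgn_if)
    define q where "q = (\<lambda>x. r c - \<alpha>\<^sup>2 * V x - cos x)"
    have rc: "r y = r c" if "\<bar>y - c\<bar> < l" for y
      by (rule r_const[of "c - l" "c + l"]) (use pos' that l in auto)
    have D1': "(V1 has_real_derivative q y) (at y)" if "\<bar>y - c\<bar> < l" for y
      using D1[OF pos'[OF that]] rc[OF that] by (simp add: q_def)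
    have sh: "((\<lambda>y. c + y) has_real_derivative 1) (at y)" "((\<lambda>y. c - y) has_real_derivative -1) (at y)" for y
      by (auto intro!: derivative_eq_intros)
    have Dp: "((\<lambda>y. V (c + y)) has_real_derivative V1 (c + y)) (at y)" for y
      using DERIV_chain2[OF D sh(1)] by simp
    have Dm: "((\<lambda>y. V (c - y)) has_real_derivative - V1 (c - y)) (at y)" for y
      using DERIV_chain2[OF D sh(2)] by simp
    have D1p: "((\<lambda>y. V1 (c + y)) has_real_derivative q (c + y)) (at y)" if "\<bar>y\<bar> < l" for y
      using DERIV_chain2[OF D1' sh(1), of y] that by simp
    have D1m: "((\<lambda>y. V1 (c - y)) has_real_derivative - q (c - y)) (at y)" if "\<bar>y\<bar> < l" for y
      using DERIV_chain2[OF D1' sh(2), of y] that by simp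
    have cc: "continuous_on A (\<lambda>y. V (c + y))" "continuous_on A (\<lambda>y. V (c - y))"
      "continuous_on A (\<lambda>y. V1 (c + y))" "continuous_on A (\<lambda>y. V1 (c - y))" for A
      by (auto intro!: continuous_on_compose2[OF contV[of UNIV]] continuous_on_compose2[OF contV1[of UNIV]] continuous_intros)
    define W where "W = (\<lambda>y. s * ((V1 (c + y) + V1 (c - y)) * sin (\<alpha> * y) - \<alpha> * (V (c + y) - V (c - y)) * cos (\<alpha> * y)))"
    have "W 0 < W l"
    proof (rule DERIV_pos_imp_increasing_open[OF l(1)])
      show "continuous_on {0..l} W" unfolding W_def by (intro continuous_intros cc)
      fix y assume y: "0 < y" "y < l"
      have "(W has_real_derivative s * ((q (c + y) - q (c - y)) * sin (\<alpha> * y) + (V1 (c + y) + V1 (c - y)) * (\<alpha> * cos (\<alpha> * y))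
          - \<alpha> * ((V1 (c + y) + V1 (c - y)) * cos (\<alpha> * y) + (V (c + y) - V (c - y)) * (- \<alpha> * sin (\<alpha> * y))))) (at y)"
        unfolding W_def using D1p[of y] D1m[of y] Dp[of y] Dm[of y] y
        by (auto intro!: derivative_eq_intros simp: algebra_simps)
      moreover have "s * ((q (c + y) - q (c - y)) * sin (\<alpha> * y) + (V1 (c + y) + V1 (c - y)) * (\<alpha> * cos (\<alpha> * y))
          - \<alpha> * ((V1 (c + y) + V1 (c - y)) * cos (\<alpha> * y) + (V (c + y) - V (c - y)) * (- \<alpha> * sin (\<alpha> * y))))
          = 2 * (s * sin c) * sin y * sin (\<alpha> * y)"
        by (simp add: q_def cos_add cos_diff algebra_simps power2_eq_square)
      moreover have "2 * (s * sin c) * sin y * sin (\<alpha> * y) > 0"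
      proof -
        have "\<alpha> * y < \<alpha> * l" using y \<alpha> by simp
        moreover have "0 < \<alpha> * y" using y \<alpha> by simp
        ultimately have "sin (\<alpha> * y) > 0" using l by (intro sin_gt_zero) linarith+
        moreover have "sin y > 0" using y l by (intro sin_gt_zero) auto
        ultimately show ?thesis using ss by simp
      qed
      ultimately show "\<exists>d. (W has_real_derivative d) (at y) \<and> 0 < d" by metis
    qed
    then show False using e by (simp add: W_def)
  qed
  note K = core[OF l pos' sc e]
  \<comment> \<open>At an odd multiple of \<open>pi\<close> the profile would increase away from its
    centre and could not reach zero at the ends.\<close>
  have "cos c = 1"
  proof (rule ccontr)
    assume "cos c \<noteq> 1"
    then have cm: "cos c = -1" using sc sin_cos_squared_add[of c] by (simp add: power2_eq_1_iff)
    have "V c < V (c + l)"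
    proof (rule DERIV_pos_imp_increasing_open[where f = V])
      fix x assume "c < x" "x < c + l"
      then show "\<exists>y. (V has_real_derivative y) (at x) \<and> 0 < y"
        using K(3)[of "x - c"] cm D[of x] by auto
    qed (use l contV in auto)
    then show False using z clb nonneg[of c] by simp
  qed
  then obtain k :: int where "c = of_int k * 2 * pi" using cos_one_2pi_int by auto
  then show ?thesis using that[of k] by (simp add: c_def mult.commute mult.left_commute)
qed

text \<open>A droplet is the part of a profile on one period that is even, decreasing on \<open>[0, l]\<close>
  and constant beyond; for \<open>l = pi\<close> it may be positive everywhere.\<close>

definition droplet :: "real \<Rightarrow> bool" where
  "droplet l \<longleftrightarrow> 0 < l \<and> l \<le> pi \<and> \<alpha> * l < pi \<and>
     (\<forall>y. \<bar>y\<bar> < l \<longrightarrow> V y > 0) \<and> (\<forall>y. 0 \<le> y \<and> y \<le> pi \<longrightarrow> V (-y) = V y) \<and>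
     (\<forall>y. 0 < y \<and> y < l \<longrightarrow> V1 y < 0) \<and>
     (\<forall>y. l \<le> \<bar>y\<bar> \<and> \<bar>y\<bar> \<le> pi \<longrightarrow> V1 y = 0 \<and> (l < pi \<longrightarrow> V y = 0))"

text \<open>The critical half-length \<open>pi / \<alpha>\<close> is the half-period of
  \<open>sin (\<alpha> * y)\<close>. The interval is closed, so that a continuous profile has a
  positive minimum on it, which leaves room for perturbations.\<close>

definition wide :: "real \<Rightarrow> bool" where
  "wide c \<longleftrightarrow> (\<forall>x. \<bar>x - c\<bar> \<le> pi / \<alpha> \<longrightarrow> V x > 0)"

text \<open>There is no contact point to supply boundary data, so periodicity takes its place. At
  resonance \<open>\<alpha> = 1\<close> the Wronskian with the sine would be strictly increasing
  over a period and yet take equal values at its ends. For \<open>\<alpha> < 1\<close> the Wronskian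
  of the odd part with \<open>sin (\<alpha> * y)\<close> is constant; since the odd part vanishes at
  \<open>pi\<close> and \<open>sin (\<alpha> * pi)\<close> does not, \<open>V1\<close> vanishes
  there and \<open>core\<close> applies with \<open>l = pi\<close>.\<close>

lemma positive_droplet:
  assumes pos: "\<And>x. V x > 0" and le: "\<alpha> \<le> 1"
  shows "droplet pi"
proof -
  define q where "q = (\<lambda>x. r 0 - \<alpha>\<^sup>2 * V x - cos x)"
  have rr: "r x = r 0" for x
    by (rule r_const[of "-\<bar>x\<bar> - 1" "\<bar>x\<bar> + 1"]) (use pos in auto)
  have D1': "(V1 has_real_derivative q x) (at x)" for x
    using D1[OF pos, of x] unfolding q_def rr[of x] .
  have cq: "continuous_on A q" for A unfolding q_def by (intro continuous_intros contV)
  have Dq: "(q has_real_derivative - \<alpha>\<^sup>2 * V1 x + sin x) (at x)" for x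
    unfolding q_def using D[of x] by (auto intro!: derivative_eq_intros)
  have eV: "V pi = V (-pi)" "V1 pi = V1 (-pi)"
    using per per1 by (auto simp: circle_periodic_def dest: spec[of _ "-pi"])
  have a1: "\<alpha> < 1"
  proof (rule ccontr)
    assume "\<not> \<alpha> < 1"
    then have a: "\<alpha> = 1" using le by simp
    define W where "W = (\<lambda>y. q y * sin y - V1 y * cos y)"
    have DW: "(W has_real_derivative sin y * sin y) (at y)" for y
      unfolding W_def using Dq[of y] D1'[of y] a
      by (auto intro!: derivative_eq_intros simp: algebra_simps)
    have cW: "continuous_on A W" for A unfolding W_def by (intro continuous_intros cq contV1)
    have "W 0 < W pi"
      by (rule DERIV_pos_imp_increasing_open[OF pi_gt_zero _ cW])
         (use DW sin_gt_zero in \<open>metis mult_pos_pos\<close>)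
    moreover have "W (-pi) < W 0"
    proof (rule DERIV_pos_imp_increasing_open[OF _ _ cW])
      fix x assume "- pi < x" "x < 0"
      then have "sin x < 0" using sin_gt_zero[of "-x"] by simp
      then show "\<exists>y. (W has_real_derivative y) (at x) \<and> 0 < y"
        using DW[of x] mult_neg_neg by blast
    qed simp
    ultimately show False using eV by (simp add: W_def)
  qed
  define Od where "Od = (\<lambda>y. V y - V (- y))"
  define Od1 where "Od1 = (\<lambda>y. V1 y + V1 (- y))"
  have neg: "((\<lambda>y. - y) has_real_derivative -1) (at y)" for y :: real by (auto intro!: derivative_eq_intros)
  have DO: "(Od has_real_derivative Od1 y) (at y)" for y
    unfolding Od_def Od1_def using DERIV_diff[OF D DERIV_chain2[OF D neg]] by simp
  have DO1: "(Od1 has_real_derivative - \<alpha>\<^sup>2 * Od y) (at y)" for y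
    unfolding Od1_def Od_def using DERIV_add[OF D1' DERIV_chain2[OF D1' neg]] by (simp add: q_def algebra_simps)
  define W where "W = (\<lambda>y. Od1 y * sin (\<alpha> * y) - \<alpha> * Od y * cos (\<alpha> * y))"
  have DW: "(W has_real_derivative 0) (at y)" for y
    unfolding W_def using DO[of y] DO1[of y]
    by (auto intro!: derivative_eq_intros simp: algebra_simps power2_eq_square)
  have "W pi = W 0" using DERIV_isconst_all[of W pi 0] DW by blast
  then have "Od1 pi * sin (\<alpha> * pi) = 0" using eV by (simp add: W_def Od_def)
  moreover have "sin (\<alpha> * pi) > 0" using \<alpha> a1 by (intro sin_gt_zero) auto
  ultimately have "V1 pi = 0" using eV by (simp add: Od1_def)
  then have K: "\<alpha> * pi < pi" "\<And>y. 0 \<le> y \<Longrightarrow> y \<le> pi \<Longrightarrow> V (0 + y) = V (0 - y)"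
    "\<And>y. 0 < y \<Longrightarrow> y < pi \<Longrightarrow> cos 0 * V1 (0 + y) < 0"
    using core[of pi 0] eV pos \<alpha> a1 by auto
  have b: "V1 y = 0" if "pi \<le> \<bar>y\<bar>" "\<bar>y\<bar> \<le> pi" for y
  proof -
    have "y = pi \<or> y = -pi" using that by linarith
    then show ?thesis using \<open>V1 pi = 0\<close> eV by auto
  qed
  show ?thesis unfolding droplet_def using K pos b by auto
qed

text \<open>Without a wide interval every component is short enough for
  \<open>component_centre\<close>, so all components are centred at multiples of
  \<open>2 * pi\<close>. Two components with the same centre coincide, hence there is one per
  period.\<close>

lemma droplet_or_wide:
  assumes ex: "V x0 > 0"
  shows "(\<exists>l. droplet l) \<or> (\<alpha> > 1 \<and> (\<exists>c. wide c))"
proof (rule ccontr)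
  assume no: "\<not> ?thesis"
  then have nd: "\<And>l. \<not> droplet l" and nw: "\<alpha> > 1 \<Longrightarrow> \<not> wide c" for c by auto
  have "\<exists>z. V z = 0"
  proof (rule ccontr)
    assume "\<nexists>z. V z = 0"
    then have pos: "\<And>x. V x > 0" using nonneg by (metis less_eq_real_def)
    show False
    proof (cases "\<alpha> \<le> 1")
      case True
      then show False using positive_droplet[OF pos] nd by blast
    next
      case False
      then show False using nw[of 0] pos by (simp add: wide_def)
    qed
  qed
  then obtain z where z: "V z = 0" by blast
  have comp: "\<exists>(k::int) l. \<bar>x - 2 * pi * of_int k\<bar> < l \<and> l \<le> pi \<and> \<alpha> * l \<le> pi \<and> V (2 * pi * of_int k + l) = 0 \<and> V (2 * pi * of_int k - l) = 0
      \<and> (\<forall>y. \<bar>y - 2 * pi * of_int k\<bar> < l \<longrightarrow> V y > 0)" if x: "V x > 0" for x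
  proof -
    obtain a b where ab: "a < x" "x < b" "V a = 0" "V b = 0" "b - a \<le> 2 * pi"
      and pos: "\<And>y. a < y \<Longrightarrow> y < b \<Longrightarrow> V y > 0"
      using component[OF x z] by blast
    have len: "\<alpha> * ((b - a) / 2) \<le> pi"
    proof (cases "\<alpha> \<le> 1")
      case True
      have "\<alpha> * ((b - a) / 2) \<le> 1 * ((b - a) / 2)"
        using ab True by (intro mult_right_mono) auto
      moreover have "(b - a) / 2 \<le> pi" using ab by simp
      ultimately show ?thesis by linarith
    next
      case False
      show ?thesis
      proof (rule ccontr)
        assume "\<not> ?thesis"
        then have *: "pi / \<alpha> < (b - a) / 2" using \<alpha> by (simp add: pos_divide_less_eq mult.commute)
        have "wide ((a + b) / 2)" unfolding wide_def
        proof (intro allI impI)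
          fix y assume "\<bar>y - (a + b) / 2\<bar> \<le> pi / \<alpha>"
          then have "\<bar>y - (a + b) / 2\<bar> < (b - a) / 2" using * by linarith
          then have "a < y" "y < b" by (simp_all add: abs_less_iff field_simps)
          then show "V y > 0" by (rule pos)
        qed
        then show False using nw False by simp
      qed
    qed
    have ab': "a < b" using ab by linarith
    obtain k :: int where k: "(a + b) / 2 = 2 * pi * of_int k"
      using component_centre[OF ab' ab(3,4) pos ab(5) len] by blast
    have eq: "2 * pi * of_int k + (b - a) / 2 = b" "2 * pi * of_int k - (b - a) / 2 = a"
      unfolding k[symmetric] by (simp_all add: field_simps)
    show ?thesis
    proof (intro exI[of _ k] exI[of _ "(b - a) / 2"] conjI allI impI)
      show "\<bar>x - 2 * pi * real_of_int k\<bar> < (b - a) / 2" using ab eq unfolding abs_less_iff by linarith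
      show "V y > 0" if "\<bar>y - 2 * pi * real_of_int k\<bar> < (b - a) / 2" for y
        by (rule pos) (use that eq in \<open>unfold abs_less_iff, linarith\<close>)+
    qed (use ab eq len in auto)
  qed
  obtain k0 :: int and l0 where k0: "\<bar>x0 - 2 * pi * of_int k0\<bar> < l0" "\<forall>y. \<bar>y - 2 * pi * of_int k0\<bar> < l0 \<longrightarrow> V y > 0"
    using comp[OF ex] by blast
  have "V (2 * pi * of_int k0) > 0" using k0 by auto
  then have V0: "V 0 > 0" using periodic_int[OF per, of 0 k0] by simp
  have comp0: "\<exists>(k::int) l. \<bar>x - 2 * pi * of_int k\<bar> < l \<and> l \<le> pi \<and> \<alpha> * l \<le> pi \<and> V l = 0 \<and> V (-l) = 0 \<and> (\<forall>y. \<bar>y\<bar> < l \<longrightarrow> V y > 0)"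
    if x: "V x > 0" for x
  proof -
    obtain k :: int and l where k: "\<bar>x - 2 * pi * of_int k\<bar> < l" "l \<le> pi" "\<alpha> * l \<le> pi" "V (2 * pi * of_int k + l) = 0"
      "V (2 * pi * of_int k - l) = 0" "\<forall>y. \<bar>y - 2 * pi * of_int k\<bar> < l \<longrightarrow> V y > 0"
      using comp[OF x] by blast
    have sh: "V (2 * pi * of_int k + y) = V y" for y
      using periodic_int[OF per, of y k] by (simp add: add.commute)
    have "V y > 0" if "\<bar>y\<bar> < l" for y
      using k(6)[rule_format, of "2 * pi * of_int k + y"] that sh[of y] by simp
    moreover have "V l = 0" "V (-l) = 0" using k(4,5) sh[of l] sh[of "-l"] by simp_all
    ultimately show ?thesis using k(1-3) by blast
  qed
  \<comment> \<open>A point of the window centred at 0 has distance at least \<open>pi\<close> from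
    every other multiple of \<open>2 * pi\<close>.\<close>
  have far: "k = 0" if "\<bar>y - 2 * pi * of_int k\<bar> < pi" "\<bar>y\<bar> \<le> pi" for y and k :: int
  proof (rule ccontr)
    assume "k \<noteq> 0"
    then have "\<bar>of_int k :: real\<bar> \<ge> 1" by (metis of_int_1_le_iff of_int_abs zero_less_abs_iff int_one_le_iff_zero_less)
    then have "2 * pi * \<bar>of_int k\<bar> \<ge> 2 * pi * 1" using pi_gt_zero by (intro mult_left_mono) auto
    moreover have "\<bar>2 * pi * of_int k\<bar> = 2 * pi * \<bar>of_int k\<bar>" by (simp add: abs_mult)
    ultimately show False using that by linarith
  qed
  obtain k :: int and l where l: "\<bar>0 - 2 * pi * of_int k\<bar> < l" "l \<le> pi" "\<alpha> * l \<le> pi" "V l = 0" "V (-l) = 0"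
    and pos: "\<And>y. \<bar>y\<bar> < l \<Longrightarrow> V y > 0"
    using comp0[OF V0] by blast
  have l0: "l > 0" using l(1) by (rule le_less_trans[OF abs_ge_zero])
  have out: "V y = 0" if y: "l \<le> \<bar>y\<bar>" "\<bar>y\<bar> \<le> pi" for y
  proof (rule ccontr)
    assume "V y \<noteq> 0"
    then have "V y > 0" using nonneg[of y] by linarith
    then obtain k' :: int and l' where l': "\<bar>y - 2 * pi * of_int k'\<bar> < l'" "l' \<le> pi" "V l' = 0"
      and pos': "\<And>y. \<bar>y\<bar> < l' \<Longrightarrow> V y > 0"
      using comp0 by blast
    have "l' > 0" using l'(1) by (rule le_less_trans[OF abs_ge_zero])
    \<comment> \<open>If one half-length were smaller, its endpoint would be a zero inside the other
      positivity interval.\<close>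
    have "l' = l" using pos[of l'] pos'[of l] l' l l0 \<open>l' > 0\<close> by (cases l l' rule: linorder_cases) auto
    moreover have "k' = 0" using far[of y k'] l' y by simp
    ultimately show False using l' y by simp
  qed
  have e: "V (0 + l) = V (0 - l)" "V1 (0 + l) = 0" "V1 (0 - l) = 0" using l V1_zero by auto
  have K: "\<alpha> * l < pi" "\<And>y. 0 \<le> y \<Longrightarrow> y \<le> l \<Longrightarrow> V (0 + y) = V (0 - y)"
    "\<And>y. 0 < y \<Longrightarrow> y < l \<Longrightarrow> cos 0 * V1 (0 + y) < 0"
    using core[OF l0 l(2,3) _ _ e] pos by auto
  have even: "V (- y) = V y" if "0 \<le> y" "y \<le> pi" for y
    using K(2)[of y] out[of y] out[of "-y"] that by (cases "y \<le> l") auto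
  have "droplet l" unfolding droplet_def
    using l0 l(2) K(1,3) pos out V1_zero even by auto
  then show False using nd by blast
qed

lemma droplet_even:
  assumes "droplet l"
  shows "V (- y) = V y"
proof -
  obtain k :: int where k: "y = reduce 0 y + 2 * pi * of_int k" using reduce_shift by blast
  define z where "z = reduce 0 y"
  have z: "\<bar>z\<bar> \<le> pi" using reduce_bounds[of 0 y] by (auto simp: z_def)
  have "V (-z) = V z"
    using assms z unfolding droplet_def by (cases "0 \<le> z") (auto dest: spec[of _ z] spec[of _ "-z"])
  moreover have "V y = V z" using periodic_int[OF per, of z k] k by (simp add: z_def)
  moreover have "- y = - z + 2 * pi * of_int (-k)" using k by (simp add: z_def)
  then have "V (-y) = V (-z)" using periodic_int[OF per, of "-z" "-k"] by metis
  ultimately show ?thesis by simp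
qed

section \<open>A priori bounds for steady profiles\<close>

text \<open>\<open>V1\<close> takes equal values at the ends of a component, or over a full period
  if there is no zero. By Rolle its derivative vanishes at some point between, and there the
  equation expresses the multiplier through \<open>V\<close> and the cosine.\<close>

lemma r_bound:
  assumes x: "V x > 0" and S: "\<And>y. V y \<le> S"
  shows "\<bar>r x\<bar> \<le> 1 + \<alpha>\<^sup>2 * S"
proof -
  obtain a b where ab: "a < x" "x < b" "V1 a = V1 b" and pos: "\<And>y. a < y \<Longrightarrow> y < b \<Longrightarrow> V y > 0"
  proof (cases "\<exists>z. V z = 0")
    case True
    then obtain z where "V z = 0" by blast
    from component[OF x this] that V1_zero show ?thesis by metis
  next
    case False
    then have "\<And>y. V y > 0" using nonneg by (metis less_eq_real_def)
    moreover have "V1 (x - pi) = V1 (x + pi)"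
      using per1[unfolded circle_periodic_def, rule_format, of "x - pi"] by (simp add: algebra_simps)
    ultimately show ?thesis using that[of "x - pi" "x + pi"] pi_gt_zero by simp
  qed
  have ab': "a < b" using ab by linarith
  obtain y where y: "a < y" "y < b" "(V1 has_real_derivative 0) (at y)"
  proof -
    have "\<exists>z. a < z \<and> z < b \<and> DERIV V1 z :> 0"
      by (rule Rolle[OF ab' ab(3) contV1]) (use D1 pos in \<open>meson real_differentiable_def\<close>)
    then show ?thesis using that by blast
  qed
  have "r y - \<alpha>\<^sup>2 * V y - cos y = 0"
    using DERIV_unique[OF D1[OF pos[OF y(1,2)]] y(3)] .
  moreover have "r x = r y" by (rule r_const[of a b]) (use pos ab y in auto)
  ultimately have "r x = \<alpha>\<^sup>2 * V y + cos y" by simp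
  moreover have "0 \<le> \<alpha>\<^sup>2 * V y" "\<alpha>\<^sup>2 * V y \<le> \<alpha>\<^sup>2 * S" using nonneg S by (auto intro!: mult_left_mono)
  ultimately show ?thesis using cos_ge_minus_one[of y] cos_le_one[of y] by linarith
qed

lemma V1_lipschitz:
  assumes S: "\<And>y. V y \<le> S"
  shows "\<bar>V1 x - V1 y\<bar> \<le> (2 + 2 * \<alpha>\<^sup>2 * S) * \<bar>x - y\<bar>"
proof -
  define L where "L = 2 + 2 * \<alpha>\<^sup>2 * S"
  have S0: "S \<ge> 0" using S[of 0] nonneg[of 0] by linarith
  then have L0: "L \<ge> 0" by (simp add: L_def)
  have bd: "\<bar>r z - \<alpha>\<^sup>2 * V z - cos z\<bar> \<le> L" if "V z > 0" for z
  proof -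
    have "0 \<le> \<alpha>\<^sup>2 * V z" "\<alpha>\<^sup>2 * V z \<le> \<alpha>\<^sup>2 * S" using nonneg S by (auto intro!: mult_left_mono)
    then show ?thesis using r_bound[OF that S] cos_ge_minus_one[of z] cos_le_one[of z] unfolding L_def by linarith
  qed
  have seg: "\<bar>V1 b - V1 a\<bar> \<le> L * (b - a)" if ab: "a \<le> b" and pos: "\<And>y. a < y \<Longrightarrow> y < b \<Longrightarrow> V y > 0" for a b
  proof (cases "a = b")
    case False
    then have lt: "a < b" using ab by simp
    obtain l z where z: "a < z" "z < b" "DERIV V1 z :> l" "V1 b - V1 a = (b - a) * l"
      using MVT[OF lt contV1] D1 pos by (meson real_differentiable_def)
    have "l = r z - \<alpha>\<^sup>2 * V z - cos z" using DERIV_unique[OF z(3) D1[OF pos[OF z(1,2)]]] .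
    then have "\<bar>l\<bar> \<le> L" using bd[OF pos[OF z(1,2)]] by simp
    then have "\<bar>l\<bar> * (b - a) \<le> L * (b - a)" using ab by (intro mult_right_mono) auto
    then show ?thesis using z(4) ab by (simp add: abs_mult mult.commute)
  qed simp
  have main: "\<bar>V1 y - V1 x\<bar> \<le> L * (y - x)" if xy: "x \<le> y" for x y
  proof (cases "\<exists>z\<in>{x..y}. V z = 0")
    case True
    define Z where "Z = {x..y} \<inter> V -` {0}"
    have cl: "closed Z" unfolding Z_def by (intro continuous_closed_preimage contV; simp)
    have ne: "Z \<noteq> {}" using True by (auto simp: Z_def)
    have bd: "bdd_above Z" "bdd_below Z" by (auto simp: Z_def)
    define z1 z2 where "z1 = Inf Z" and "z2 = Sup Z"
    have z1: "z1 \<in> Z" unfolding z1_def by (rule closed_contains_Inf[OF ne bd(2) cl])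
    have z2: "z2 \<in> Z" unfolding z2_def by (rule closed_contains_Sup[OF ne bd(1) cl])
    have z12: "z1 \<le> z2" unfolding z2_def by (rule cSup_upper[OF z1 bd(1)])
    have "V t > 0" if "x < t" "t < z1" for t
    proof (rule ccontr)
      assume "\<not> V t > 0"
      then have "t \<in> Z" using nonneg[of t] that z1 by (auto simp: Z_def)
      then show False using cInf_lower[OF _ bd(2), of t] that by (simp add: z1_def)
    qed
    then have 1: "\<bar>V1 z1 - V1 x\<bar> \<le> L * (z1 - x)" using z1 by (intro seg) (auto simp: Z_def)
    have "V t > 0" if "z2 < t" "t < y" for t
    proof (rule ccontr)
      assume "\<not> V t > 0"
      then have "t \<in> Z" using nonneg[of t] that z2 by (auto simp: Z_def)
      then show False using cSup_upper[OF _ bd(1), of t] that by (simp add: z2_def)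
    qed
    then have 2: "\<bar>V1 y - V1 z2\<bar> \<le> L * (y - z2)" using z2 by (intro seg) (auto simp: Z_def)
    have "V1 z1 = 0" "V1 z2 = 0" using z1 z2 V1_zero by (auto simp: Z_def)
    then have "\<bar>V1 y - V1 x\<bar> \<le> L * (z1 - x) + L * (y - z2)" using 1 2 by linarith
    also have "\<dots> = L * (y - x - (z2 - z1))" by (simp add: algebra_simps)
    also have "\<dots> \<le> L * (y - x)" using L0 z12 by (intro mult_left_mono) auto
    finally show ?thesis .
  next
    case False
    then show ?thesis using nonneg xy by (intro seg) (auto simp: less_le)
  qed
  show ?thesis
    using main[of x y] main[of y x] by (cases "x \<le> y") (auto simp: L_def abs_minus_commute)
qed

end

section \<open>Ordering of droplets by half-length\<close>

text \<open>The forcing cancels in the difference of two droplets. On the smaller one, the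
  derivative \<open>p\<close> of the difference solves the homogeneous equation and vanishes at 0 by
  evenness, so it is a multiple of \<open>sin (\<alpha> * y)\<close>. The sign of the multiple is
  read off at \<open>l\<close>, where \<open>V1\<close> is zero and \<open>U1\<close> is not
  positive. Hence the difference decreases towards \<open>pi\<close>, where \<open>V\<close>
  vanishes if \<open>l < pi\<close>.\<close>

lemma droplet_le:
  assumes s: "steady \<alpha> V V1 r" "steady \<alpha> U U1 r'"
    and d: "steady.droplet \<alpha> V V1 l" "steady.droplet \<alpha> U U1 m" and lm: "l \<le> m"
  shows "(\<forall>y. V y \<le> U y) \<or> (\<exists>k. \<forall>y. U y = V y + k)"
proof -
  interpret V: steady \<alpha> V V1 r by fact
  interpret U: steady \<alpha> U U1 r' by fact
  have l: "0 < l" "l \<le> pi" "\<alpha> * l < pi" and Vpos: "\<And>y. \<bar>y\<bar> < l \<Longrightarrow> V y > 0"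
    and V1out: "\<And>y. l \<le> \<bar>y\<bar> \<Longrightarrow> \<bar>y\<bar> \<le> pi \<Longrightarrow> V1 y = 0"
    and Vout: "\<And>y. l < pi \<Longrightarrow> l \<le> \<bar>y\<bar> \<Longrightarrow> \<bar>y\<bar> \<le> pi \<Longrightarrow> V y = 0"
    using d(1) unfolding V.droplet_def by blast+
  have m: "m \<le> pi" and Upos: "\<And>y. \<bar>y\<bar> < m \<Longrightarrow> U y > 0"
    and U1in: "\<And>y. 0 < y \<Longrightarrow> y < m \<Longrightarrow> U1 y < 0"
    and U1out: "\<And>y. m \<le> \<bar>y\<bar> \<Longrightarrow> \<bar>y\<bar> \<le> pi \<Longrightarrow> U1 y = 0"
    using d(2) unfolding U.droplet_def by blast+
  have U1le: "U1 y \<le> 0" if "0 < y" "y \<le> pi" for y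
    using U1in[of y] U1out[of y] that by (cases "y < m") auto
  have ev: "V (-y) = V y" "U (-y) = U y" for y
    using V.droplet_even[OF d(1)] U.droplet_even[OF d(2)] by auto
  have ev1: "V1 0 = 0" "U1 0 = 0"
  proof -
    have neg: "((\<lambda>y. - y) has_real_derivative -1) (at 0)" by (auto intro!: derivative_eq_intros)
    have "V1 0 = - V1 0"
      using DERIV_unique[OF V.D[of 0], of "- V1 0"] DERIV_chain2[where f = V and g = "\<lambda>y. -y" and x = 0 and s = UNIV and Db = "-1", OF V.D neg] ev(1) by simp
    then show "V1 0 = 0" by simp
    have "U1 0 = - U1 0"
      using DERIV_unique[OF U.D[of 0], of "- U1 0"] DERIV_chain2[where f = U and g = "\<lambda>y. -y" and x = 0 and s = UNIV and Db = "-1", OF U.D neg] ev(2) by simp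
    then show "U1 0 = 0" by simp
  qed
  define p where "p = (\<lambda>y. U1 y - V1 y)"
  define D where "D = (\<lambda>y. U y - V y)"
  have rV: "r y = r 0" if "\<bar>y\<bar> < l" for y
    by (rule V.r_const[of "-l" l]) (use Vpos that in auto)
  have rU: "r' y = r' 0" if "\<bar>y\<bar> < l" for y
    by (rule U.r_const[of "-m" m]) (use Upos that lm in auto)
  define k where "k = r' 0 - r 0"
  have Dp: "(p has_real_derivative k - \<alpha>\<^sup>2 * D y) (at y)" if "\<bar>y\<bar> < l" for y
  proof -
    have "V y > 0" "U y > 0" using Vpos[of y] Upos[of y] that lm by auto
    from DERIV_diff[OF U.D1[OF this(2)] V.D1[OF this(1)]] show ?thesis
      by (simp add: p_def D_def k_def rV[OF that] rU[OF that] algebra_simps)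
  qed
  have DD: "(D has_real_derivative p y) (at y)" for y
    unfolding D_def p_def by (rule DERIV_diff[OF U.D V.D])
  have cD: "continuous_on A D" "continuous_on A p" for A
    unfolding D_def p_def by (intro continuous_intros U.contV V.contV U.contV1 V.contV1)+
  \<comment> \<open>The Wronskian of \<open>p\<close> with \<open>sin (\<alpha> * y)\<close>; that
    it vanishes makes their quotient constant.\<close>
  define W where "W = (\<lambda>y. (k - \<alpha>\<^sup>2 * D y) * sin (\<alpha> * y) - \<alpha> * p y * cos (\<alpha> * y))"
  have cW: "continuous_on A W" for A unfolding W_def by (intro continuous_intros cD)
  have DW: "(W has_real_derivative 0) (at y)" if "0 < y" "y < l" for y
    unfolding W_def using Dp[of y] DD[of y] that
    by (auto intro!: derivative_eq_intros simp: algebra_simps power2_eq_square)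
  have W0: "W y = 0" if "0 \<le> y" "y \<le> l" for y
    using DERIV_isconst2[OF l(1) cW DW, of y] that ev1 by (simp add: W_def p_def)
  have sp: "sin (\<alpha> * y) > 0" if "0 < y" "y \<le> l" for y
  proof -
    have "\<alpha> * y \<le> \<alpha> * l" "0 < \<alpha> * y" using that V.\<alpha> by simp_all
    then show ?thesis using l by (intro sin_gt_zero) linarith+
  qed
  have ratio: "p y / sin (\<alpha> * y) = p l / sin (\<alpha> * l)" if y: "0 < y" "y \<le> l" for y
  proof (cases "y = l")
    case False
    then have yl: "y < l" using y by simp
    define g where "g = (\<lambda>y. p y / sin (\<alpha> * y))"
    have "g l = g y"
    proof (rule DERIV_isconst_end[OF yl])
      show "continuous_on {y..l} g" unfolding g_def
        by (intro continuous_intros cD) (use sp y in \<open>auto simp: less_imp_neq[THEN not_sym]\<close>)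
      fix x assume x: "y < x" "x < l"
      have sx: "sin (\<alpha> * x) > 0" using sp[of x] x y by simp
      have "(g has_real_derivative W x / (sin (\<alpha> * x))\<^sup>2) (at x)"
        unfolding g_def using Dp[of x] x y sx
        by (auto intro!: derivative_eq_intros simp: W_def power2_eq_square algebra_simps)
      then show "(g has_real_derivative 0) (at x)" using W0[of x] x y by simp
    qed
    then show ?thesis by (simp add: g_def)
  qed simp
  have pl: "p l \<le> 0"
  proof -
    have "V1 l = 0" using V1out[of l] l by simp
    moreover have "U1 l \<le> 0" using U1le l by blast
    ultimately show ?thesis by (simp add: p_def)
  qed
  have p_in: "p y \<le> 0" if "0 \<le> y" "y \<le> l" for y
  proof (cases "y = 0")
    case False
    then have s: "sin (\<alpha> * y) > 0" using sp[of y] that by simp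
    have "p y = p y / sin (\<alpha> * y) * sin (\<alpha> * y)" using s by simp
    also have "\<dots> = p l / sin (\<alpha> * l) * sin (\<alpha> * y)" using ratio[of y] False that by simp
    finally have "p y = p l / sin (\<alpha> * l) * sin (\<alpha> * y)" .
    also have "\<dots> \<le> 0" using pl sp[of l] sp[of y] l that False
      by (intro mult_nonpos_nonneg divide_nonpos_pos) auto
    finally show ?thesis .
  qed (simp add: p_def ev1)
  have p_out: "p y \<le> 0" if "l \<le> y" "y \<le> pi" for y
  proof -
    have "V1 y = 0" using V1out[of y] that l by simp
    moreover have "U1 y \<le> 0" using U1le[of y] that l by simp
    ultimately show ?thesis by (simp add: p_def)
  qed
  have p_le: "p y \<le> 0" if "0 \<le> y" "y \<le> pi" for y using p_in[of y] p_out[of y] that by (cases "y \<le> l") auto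
  have dec: "D pi \<le> D y" if "0 \<le> y" "y \<le> pi" for y
  proof (rule DERIV_nonpos_imp_nonincreasing[OF that(2)])
    fix x assume x: "y \<le> x" "x \<le> pi"
    have "p x \<le> 0" by (rule p_le) (use x that in linarith)+
    then show "\<exists>d. DERIV D x :> d \<and> d \<le> 0" using DD[of x] by blast
  qed
  have red: "D y = D \<bar>reduce 0 y\<bar>" for y
  proof -
    have "D y = D (reduce 0 y)"
      using periodic_reduce[OF V.per] periodic_reduce[OF U.per] by (simp add: D_def)
    moreover have "D \<bar>z\<bar> = D z" for z using ev[of z] by (simp add: D_def abs_if)
    ultimately show ?thesis by simp
  qed
  have rb: "0 \<le> \<bar>reduce 0 y\<bar>" "\<bar>reduce 0 y\<bar> \<le> pi" for y using reduce_bounds[of 0 y] by auto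
  show ?thesis
  proof (cases "l < pi")
    case True
    then have "V pi = 0" using Vout[of pi] l by simp
    then have "D pi \<ge> 0" using U.nonneg by (simp add: D_def)
    then have "D y \<ge> 0" for y using dec[OF rb[of y]] red[of y] by linarith
    then have "\<forall>y. V y \<le> U y" by (simp add: D_def)
    then show ?thesis ..
  next
    case False
    \<comment> \<open>Both droplets fill the circle; then \<open>p\<close> vanishes at
      \<open>pi\<close>, hence identically, and the profiles differ by a constant, which equal
      masses will exclude.\<close>
    then have "l = pi" "m = pi" using l lm m by auto
    then have "p l = 0" using V1out[of pi] U1out[of pi] by (simp add: p_def)
    then have p0: "p y = 0" if "0 < y" "y \<le> pi" for y using ratio[of y] sp[of y] that \<open>l = pi\<close> by simp
    have "D y = D pi" if "0 \<le> y" "y \<le> pi" for y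
    proof (cases "y < pi")
      case True
      have "D pi = D y"
      proof (rule DERIV_isconst_end[OF True cD(1)])
        fix x assume "y < x" "x < pi"
        then have "p x = 0" by (intro p0) (use that in linarith)+
        then show "DERIV D x :> 0" using DD[of x] by simp
      qed
      then show ?thesis by simp
    qed (use that in simp)
    then have c: "D y = D pi" for y using red[of y] rb[of y] by metis
    have "U y = V y + D pi" for y using c[of y] unfolding D_def by linarith
    then have "\<forall>y. U y = V y + D pi" ..
    then show ?thesis by blast
  qed
qed

lemma droplet_unique:
  assumes s: "steady \<alpha> V V1 r" "steady \<alpha> U U1 r'"
    and d: "steady.droplet \<alpha> V V1 l" "steady.droplet \<alpha> U U1 m"
    and mass: "integral period V = integral period U"
  shows "V = U"
proof -
  have *: "V = U"
    if s: "steady \<alpha> V V1 r" "steady \<alpha> U U1 r'"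
      and d: "steady.droplet \<alpha> V V1 l" "steady.droplet \<alpha> U U1 m" and lm: "l \<le> m"
      and mass: "integral period V = integral period U" for V U V1 U1 r r' l m
  proof -
    interpret V: steady \<alpha> V V1 r by fact
    interpret U: steady \<alpha> U U1 r' by fact
    have i: "V integrable_on period" "U integrable_on period"
      by (intro integrable_continuous_real V.contV U.contV)+
    have I0: "integral period (\<lambda>y. U y - V y) = 0" using mass i by (simp add: integral_diff)
    have "U y = V y" if y: "y \<in> period" for y
      using droplet_le[OF s d lm]
    proof
      assume le: "\<forall>y. V y \<le> U y"
      have c: "continuous_on period (\<lambda>y. U y - V y)" by (intro continuous_intros V.contV U.contV)
      have "U y - V y = 0"
        using integral_eq_0_iff[OF c] I0 le y pi_gt_zero by auto
      then show ?thesis by simp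
    next
      assume "\<exists>k. \<forall>y. U y = V y + k"
      then obtain k where k: "\<And>y. U y = V y + k" by blast
      then have "integral period (\<lambda>y. k) = 0" using I0 by simp
      then have "k = 0" by simp
      then show ?thesis using k by simp
    qed
    then have "U (reduce 0 y) = V (reduce 0 y)" for y using reduce_bounds[of 0 y] by simp
    then show "V = U" using periodic_reduce[OF V.per] periodic_reduce[OF U.per] by (metis ext)
  qed
  show ?thesis
  proof (cases "l \<le> m")
    case True
    then show ?thesis using *[OF s d] mass by blast
  next
    case False
    then have "m \<le> l" by simp
    from *[OF s(2,1) d(2,1) this mass[symmetric]] show ?thesis by simp
  qed
qed


section \<open>Continuous representatives and the energy\<close>

lemma AE_continuous_le:
  fixes f g :: "real \<Rightarrow> real"
  assumes "continuous_on UNIV f" "continuous_on UNIV g" and ae: "AE x in lebesgue. f x \<le> g x"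
  shows "f x \<le> g x"
proof -
  obtain N where N: "negligible N" "\<And>x. x \<notin> N \<Longrightarrow> f x \<le> g x"
    using AE_negligible[OF ae] by blast
  have "open {x. g x < f x}" using assms by (intro open_Collect_less)
  moreover have "negligible {x. g x < f x}" by (rule negligible_subset[OF N(1)]) (use N(2) in force)
  ultimately have "{x. g x < f x} = {}" using open_not_negligible by blast
  then show ?thesis by (metis (mono_tags) empty_Collect_eq not_le)
qed

lemma AE_continuous_eq:
  fixes f g :: "real \<Rightarrow> real"
  assumes "continuous_on UNIV f" "continuous_on UNIV g" and ae: "AE x in lebesgue. f x = g x"
  shows "f = g"
proof
  fix x
  have "AE x in lebesgue. f x \<le> g x" "AE x in lebesgue. g x \<le> f x" using ae by (eventually_elim, simp)+
  then show "f x = g x" using AE_continuous_le[of f g x] AE_continuous_le[of g f x] assms by simp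
qed

lemma continuous_rep_eq:
  assumes U: "continuous_on UNIV U" and ae: "AE x in lebesgue. U x = u x"
  shows "continuous_rep u = U"
  unfolding continuous_rep_def
proof (rule the_equality)
  fix w assume w: "continuous_on UNIV w \<and> (AE x in lebesgue. w x = u x)"
  then have "AE x in lebesgue. w x = u x" by simp
  with ae have "AE x in lebesgue. w x = U x" by eventually_elim simp
  then show "w = U" using AE_continuous_eq U w by blast
qed (use assms in auto)

lemma positivity_set_eq:
  assumes "continuous_on UNIV U" "AE x in lebesgue. U x = u x"
  shows "positivity_set u = {x. U x > 0}"
  unfolding positivity_set_def continuous_rep_eq[OF assms] ..

lemma L2_circleI_continuous:
  assumes "circle_periodic U" and c: "continuous_on UNIV U"
  shows "U \<in> L2_circle"
proof -
  have "(\<lambda>x. (U x)\<^sup>2) absolutely_integrable_on period"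
    by (intro absolutely_integrable_continuous_real continuous_intros continuous_on_subset[OF c]) auto
  moreover have "U \<in> borel_measurable lebesgue"
    using borel_measurable_continuous_onI[OF c] by (simp add: measurable_completion)
  ultimately show ?thesis using assms(1) by (simp add: L2_circle_def)
qed

lemma L2_circleD:
  assumes "g \<in> L2_circle"
  shows "circle_periodic g" "g \<in> borel_measurable lebesgue" "(\<lambda>x. (g x)\<^sup>2) absolutely_integrable_on period"
  using assms by (auto simp: L2_circle_def)

lemma has_weak_deriv_0: "u \<in> L1_loc P \<Longrightarrow> has_weak_deriv 0 P u u"
  by (simp add: has_weak_deriv_def)

text \<open>The energy of a representative with an explicit density. It is free of the choice inside
  \<open>weak_deriv\<close> and takes values in the reals, which suits expansions and
  limits.\<close>

definition en :: "real \<Rightarrow> (real \<Rightarrow> real) \<Rightarrow> (real \<Rightarrow> real) \<Rightarrow> real" where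
  "en \<alpha> U g = 1/2 * integral period (\<lambda>x. (g x)\<^sup>2 - \<alpha>\<^sup>2 * (U x)\<^sup>2) - integral period (\<lambda>x. U x * cos x)"

lemma ac_L1_loc:
  assumes a: "ac U g" and u: "circle_periodic u" and ae: "AE x in lebesgue. U x = u x"
  shows "u \<in> L1_loc P"
proof (rule L1_locI_abs_int[OF u])
  have "U absolutely_integrable_on period" by (intro absolutely_integrable_continuous_real ac_continuous[OF a])
  then show "u absolutely_integrable_on period"
    by (rule abs_int_AE) (use ae in eventually_elim, simp)
qed

lemma energy_ac:
  assumes a: "ac U g" and g: "g \<in> L2_circle" and u: "u \<in> L2_circle" and ae: "AE x in lebesgue. U x = u x"
  shows "u \<in> H_circle 1" "energy \<alpha> u = ereal (en \<alpha> U g)"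
proof -
  have w: "has_weak_deriv 1 UNIV u g" by (rule ac_weak_deriv[OF a L2_circleD(1)[OF u] ae])
  have L: "u \<in> L1_loc UNIV" by (rule ac_L1_loc[OF a L2_circleD(1)[OF u] ae])
  show H: "u \<in> H_circle 1"
    unfolding H_circle_def
  proof (safe intro!: u)
    fix j :: nat assume "j \<le> 1"
    then consider "j = 0" | "j = 1" by linarith
    then show "\<exists>v\<in>L2_circle. has_weak_deriv j UNIV u v"
      by cases (use has_weak_deriv_0[OF L] u w g in auto)
  qed
  have cU: "continuous_on A U" for A by (rule ac_continuous[OF a])
  have i1: "(\<lambda>x. (g x)\<^sup>2 - \<alpha>\<^sup>2 * (U x)\<^sup>2) absolutely_integrable_on period"
    by (rule set_integral_diff(1)[OF L2_circleD(3)[OF g] absolutely_integrable_continuous_real])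
       (intro continuous_intros cU)
  have i2: "(\<lambda>x. U x * cos x) absolutely_integrable_on period"
    by (intro absolutely_integrable_continuous_real continuous_intros cU)
  have "AE x in lebesgue. weak_deriv 1 UNIV u x = g x" by (rule weak_deriv_eq(2)[OF w])
  then have "AE x in lebesgue. x \<in> period \<longrightarrow> (weak_deriv 1 UNIV u x)\<^sup>2 - \<alpha>\<^sup>2 * (u x)\<^sup>2 = (g x)\<^sup>2 - \<alpha>\<^sup>2 * (U x)\<^sup>2"
    using ae by eventually_elim simp
  note 1 = abs_int_AE[OF i1 this]
  have "AE x in lebesgue. x \<in> period \<longrightarrow> u x * cos x = U x * cos x"
    using ae by eventually_elim simp
  note 2 = abs_int_AE[OF i2 this]
  show "energy \<alpha> u = ereal (en \<alpha> U g)"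
    using H 1(2) 2(2) set_lebesgue_integral_eq_integral(2)[OF 1(1)] set_lebesgue_integral_eq_integral(2)[OF 2(1)]
    by (simp add: energy_def en_def)
qed

lemma mass_class_rep:
  assumes u: "u \<in> mass_class M" and a: "ac U g" and ae: "AE x in lebesgue. U x = u x"
  shows "0 \<le> U x" "integral period U = M"
proof -
  have "AE x in lebesgue. 0 \<le> u x" using u by (simp add: mass_class_def)
  with ae have "AE x in lebesgue. 0 \<le> U x" by eventually_elim simp
  then show "0 \<le> U x" by (rule AE_continuous_le[of "\<lambda>x. 0" U, OF continuous_on_const ac_continuous[OF a]])
  have i: "U absolutely_integrable_on period" by (intro absolutely_integrable_continuous_real ac_continuous[OF a])
  have "AE x in lebesgue. x \<in> period \<longrightarrow> u x = U x" using ae by eventually_elim simp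
  note 1 = abs_int_AE[OF i this]
  show "integral period U = M"
    using u 1(2) set_lebesgue_integral_eq_integral(2)[OF 1(1)] by (simp add: mass_class_def)
qed

lemma mass_classI:
  assumes "circle_periodic U" "continuous_on UNIV U" "\<And>x. 0 \<le> U x" "integral period U = M"
  shows "U \<in> mass_class M"
proof -
  have "U absolutely_integrable_on period"
    by (intro absolutely_integrable_continuous_real continuous_on_subset[OF assms(2)]) auto
  then show ?thesis
    using assms set_lebesgue_integral_eq_integral(2)[of period U]
    by (simp add: mass_class_def L2_circleI_continuous)
qed

lemma H_circle_rep:
  assumes "u \<in> H_circle k" "1 \<le> k"
  obtains U g where "ac U g" "g \<in> L2_circle" "AE x in lebesgue. U x = u x" "has_weak_deriv 1 UNIV u g"
proof -
  obtain v where v: "v \<in> L2_circle" "has_weak_deriv 1 UNIV u v"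
    using assms unfolding H_circle_def by blast
  then show ?thesis using weak_deriv_ac[OF v(2)] that by metis
qed

lemma deriv_of_integral:
  fixes f h :: "real \<Rightarrow> real"
  assumes "a < x" "x < b" and h: "continuous_on {a..b} h"
    and f: "\<And>y. y \<in> {a..b} \<Longrightarrow> f y - f a = integral {a..y} h"
  shows "(f has_real_derivative h x) (at x)"
proof -
  have "((\<lambda>y. integral {a..y} h) has_real_derivative h x) (at x within {a..b})"
    by (rule integral_has_real_derivative[OF h]) (use assms in auto)
  then have "((\<lambda>y. f a + integral {a..y} h) has_real_derivative h x) (at x)"
    using assms(1,2) by (auto simp: at_within_Icc_at intro!: derivative_eq_intros)
  then show ?thesis
    by (rule has_field_derivative_transform_within_open[of _ _ _ "{a<..<b}"])
       (use assms(1,2) in \<open>auto simp: f[symmetric]\<close>)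
qed

section \<open>Strong steady states with zero dissipation are classical\<close>

lemma ac_deriv_continuous_rep:
  assumes a: "ac V g" and a1: "ac V1 h" and ae: "AE x in lebesgue. V1 x = g x"
  shows "(V has_real_derivative V1 x) (at x)" "ac V V1"
proof -
  have c: "continuous_on A V1" for A by (rule ac_continuous[OF a1])
  have eq: "integral {a..b} g = integral {a..b} V1" for a b
    by (rule abs_int_AE(2)[OF absolutely_integrable_continuous_real[OF c]])
       (use ae in eventually_elim, simp)
  show "(V has_real_derivative V1 x) (at x)" for x
    by (rule deriv_of_integral[of "x-1" _ "x+1"]) (use acD(5)[OF a] eq c in auto)
  then show "ac V V1" by (intro ac_C1 acD(1)[OF a] c)
qed

text \<open>Members of \<open>L1_loc P\<close> are known to be measurable only on compact subsets of
  \<open>P\<close>, so the integrand is cut off by \<open>K\<close> before the zero integral becomes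
  an almost everywhere statement. On \<open>K\<close> the factor \<open>v x powr n\<close> is
  positive and can be cancelled.\<close>

lemma zero_dissipation_AE:
  assumes v: "v \<in> borel_measurable lebesgue" and ae: "AE x in lebesgue. V x = v x" and P: "P = {x. V x > 0}"
    and d3: "d3 \<in> L1_loc P" and d1: "d1 \<in> L1_loc P" and K: "compact K" "K \<subseteq> P \<inter> period"
    and 0: "(\<integral>\<^sup>+x\<in>P \<inter> period. ennreal (v x powr n * (d3 x + \<alpha>\<^sup>2 * d1 x - sin x)\<^sup>2) \<partial>lebesgue) = 0"
  shows "AE x in lebesgue. x \<in> K \<longrightarrow> d3 x = sin x - \<alpha>\<^sup>2 * d1 x"
proof -
  define F where "F = (\<lambda>x. ennreal (v x powr n * (indicator K x *\<^sub>R d3 x + \<alpha>\<^sup>2 * (indicator K x *\<^sub>R d1 x) - indicator K x * sin x)\<^sup>2))"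
  have [measurable]: "v \<in> borel_measurable lebesgue" by fact
  have [measurable]: "(\<lambda>x. indicator K x *\<^sub>R d3 x) \<in> borel_measurable lebesgue" "(\<lambda>x. indicator K x *\<^sub>R d1 x) \<in> borel_measurable lebesgue"
    using d3 d1 K by (auto simp: L1_loc_def set_integrable_def borel_measurable_integrable)
  have [measurable]: "(sin :: real \<Rightarrow> real) \<in> borel_measurable lebesgue" by (simp add: measurable_completion)
  have [measurable]: "K \<in> sets lebesgue" using K by (intro fmeasurableD lmeasurable_compact)
  have m: "F \<in> borel_measurable lebesgue" unfolding F_def by measurable
  have "(\<integral>\<^sup>+x. F x \<partial>lebesgue) \<le> (\<integral>\<^sup>+x\<in>P \<inter> period. ennreal (v x powr n * (d3 x + \<alpha>\<^sup>2 * d1 x - sin x)\<^sup>2) \<partial>lebesgue)"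
  proof (rule nn_integral_mono)
    fix x show "F x \<le> ennreal (v x powr n * (d3 x + \<alpha>\<^sup>2 * d1 x - sin x)\<^sup>2) * indicator (P \<inter> period) x"
    proof (cases "x \<in> K")
      case True
      then have "x \<in> P \<inter> period" using K(2) by blast
      then have p1: "indicator (P \<inter> period) x = (1::ennreal)" by (rule indicator_simps)
      have k1: "indicator K x = (1::real)" using True by (rule indicator_simps)
      show ?thesis unfolding F_def p1 k1 by simp
    next
      case False
      then have "F x = 0" by (simp add: F_def)
      then show ?thesis by simp
    qed
  qed
  then have "(\<integral>\<^sup>+x. F x \<partial>lebesgue) = 0" using 0 by simp
  then have "AE x in lebesgue. F x = 0" using nn_integral_0_iff_AE[OF m] by simp
  with ae show ?thesis
  proof eventually_elim
    case (elim x)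
    show ?case
    proof
      assume x: "x \<in> K"
      then have "v x > 0" using elim(1) K(2) P by auto
      then have "v x powr n > 0" by simp
      moreover have "v x powr n * (d3 x + \<alpha>\<^sup>2 * d1 x - sin x)\<^sup>2 = 0"
      proof (rule antisym)
        show "v x powr n * (d3 x + \<alpha>\<^sup>2 * d1 x - sin x)\<^sup>2 \<le> 0"
          using elim(2) x unfolding F_def by (simp only: ennreal_eq_0_iff indicator_simps scaleR_one mult_1)
        show "0 \<le> v x powr n * (d3 x + \<alpha>\<^sup>2 * d1 x - sin x)\<^sup>2" by (intro mult_nonneg_nonneg) auto
      qed
      ultimately show "d3 x = sin x - \<alpha>\<^sup>2 * d1 x" by auto
    qed
  qed
qed

lemma ac_cos: "ac cos (\<lambda>x. - sin x)"
  by (rule ac_C1[OF periodic_cos]) (auto intro!: derivative_eq_intros continuous_intros)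

text \<open>This is the weak form of the statement that v_xx + \<alpha>^2 v + cos has derivative
  zero on the positivity set. The second derivative is global and the third is local, so the two are
  linked through \<open>v\<close> by moving all derivatives onto the test function.\<close>

lemma zero_dissipation_weak_equation:
  assumes L2: "v \<in> L2_circle" and w2: "has_weak_deriv 2 UNIV v v2"
    and a: "ac V V1" and ae: "AE x in lebesgue. V x = v x"
    and zd: "zero_dissipation \<alpha> n v" and \<phi>: "\<phi> \<in> test_functions {x. V x > 0}"
  shows "integral period (\<lambda>x. (v2 x + \<alpha>\<^sup>2 * V x + cos x) * deriv \<phi> x) = 0"
proof -
  define P where "P = {x. V x > 0}"
  have P: "positivity_set v = P" unfolding P_def by (rule positivity_set_eq[OF ac_continuous[OF a] ae])
  define d1 d3 where "d1 = weak_deriv 1 P v" and "d3 = weak_deriv 3 P v"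
  have H: "v \<in> H_loc 3 P" and 0: "dissipation \<alpha> n v = 0" using zd by (auto simp: zero_dissipation_def P)
  have w13: "has_weak_deriv 1 P v d1" "has_weak_deriv 3 P v d3"
  proof -
    have "\<forall>j\<le>3. \<exists>e. has_weak_deriv j P v e" using H unfolding H_loc_def by blast
    then have "\<exists>e. has_weak_deriv 1 P v e" "\<exists>e. has_weak_deriv 3 P v e" by simp_all
    then show "has_weak_deriv 1 P v d1" "has_weak_deriv 3 P v d3"
      unfolding d1_def d3_def weak_deriv_def by (auto intro: someI[of "has_weak_deriv _ P v"])
  qed
  have L: "d1 \<in> L1_loc P" "d3 \<in> L1_loc P" using w13 by (auto simp: has_weak_deriv_def)
  have \<phi>P: "\<phi> \<in> test_functions P" using \<phi> by (simp add: P_def)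
  have \<phi>U: "\<phi> \<in> test_functions UNIV" by (rule test_UNIV[OF \<phi>P])
  note sm = test_smooth[OF \<phi>P]
  have c: "continuous_on A \<phi>" "continuous_on A (deriv \<phi>)" for A
    using smooth_continuous[OF sm] smooth_continuous[OF smooth_deriv[OF sm]] by auto
  define K where "K = closure {x. \<phi> x \<noteq> 0} \<inter> period"
  have K: "compact K" "K \<subseteq> P \<inter> period"
    using \<phi>P by (auto simp: K_def test_functions_def intro: closed_Int_compact)
  have dis: "(\<integral>\<^sup>+x\<in>P \<inter> period. ennreal (v x powr n * (d3 x + \<alpha>\<^sup>2 * d1 x - sin x)\<^sup>2) \<partial>lebesgue) = 0"
    using 0 by (simp add: dissipation_def P d1_def d3_def)
  have "AE x in lebesgue. x \<in> K \<longrightarrow> d3 x = sin x - \<alpha>\<^sup>2 * d1 x"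
    by (rule zero_dissipation_AE[OF L2_circleD(2)[OF L2] ae P_def L(2,1) K dis])
  then have ae3: "AE x in lebesgue. x \<in> period \<longrightarrow> d3 x * \<phi> x = sin x * \<phi> x - \<alpha>\<^sup>2 * (d1 x * \<phi> x)"
  proof eventually_elim
    case (elim x)
    show ?case
    proof
      assume x: "x \<in> period"
      show "d3 x * \<phi> x = sin x * \<phi> x - \<alpha>\<^sup>2 * (d1 x * \<phi> x)"
      proof (cases "\<phi> x = 0")
        case False
        then have "x \<in> K" using x closure_subset[of "{x. \<phi> x \<noteq> 0}"] unfolding K_def by blast
        then have "d3 x = sin x - \<alpha>\<^sup>2 * d1 x" using elim by simp
        then show ?thesis by (simp only: left_diff_distrib mult.assoc)
      qed simp
    qed
  qed
  have i1: "(\<lambda>x. d1 x * \<phi> x) absolutely_integrable_on period" by (rule L1_loc_test_abs_int[OF L(1) \<phi>P])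
  have isn: "(\<lambda>x. sin x * \<phi> x) absolutely_integrable_on period"
    by (intro absolutely_integrable_continuous_real continuous_intros c)
  have i3: "(\<lambda>x. sin x * \<phi> x - \<alpha>\<^sup>2 * (d1 x * \<phi> x)) absolutely_integrable_on period"
    by (intro set_integral_diff(1) isn set_integrable_mult_right i1)
  note J = abs_int_AE[OF i3 ae3]
  have vi: "V absolutely_integrable_on period"
    by (intro absolutely_integrable_continuous_real ac_continuous[OF a])
  have "AE x in lebesgue. x \<in> period \<longrightarrow> v x * deriv \<phi> x = V x * deriv \<phi> x"
    using ae by eventually_elim simp
  note vV = abs_int_AE[OF abs_int_mult_cont(2)[OF vi c(2)] this]
  have e1: "integral period (\<lambda>x. V x * deriv \<phi> x) = - integral period (\<lambda>x. d1 x * \<phi> x)"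
    using w13(1) \<phi>P set_lebesgue_integral_eq_integral(2)[OF vV(1)] set_lebesgue_integral_eq_integral(2)[OF i1] vV(2)
    by (simp add: has_weak_deriv_def)
  \<comment> \<open>\<open>v2\<close> tested with the first derivative of \<open>\<phi>\<close> is
    \<open>v\<close> tested with its third derivative, which is minus \<open>d3\<close> tested with
    \<open>\<phi>\<close>.\<close>
  have e2: "integral period (\<lambda>x. v2 x * deriv \<phi> x) = - integral period (\<lambda>x. d3 x * \<phi> x)"
  proof -
    have "(LINT x:period|lebesgue. v x * (deriv ^^ 2) (deriv \<phi>) x) = (LINT x:period|lebesgue. v2 x * deriv \<phi> x)"
      using w2 test_deriv[OF \<phi>U] by (simp add: has_weak_deriv_def)
    moreover have "(deriv ^^ 2) (deriv \<phi>) = (deriv ^^ 3) \<phi>"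
      by (simp add: numeral_2_eq_2 numeral_3_eq_3)
    moreover have "(LINT x:period|lebesgue. v x * (deriv ^^ 3) \<phi> x) = - (LINT x:period|lebesgue. d3 x * \<phi> x)"
      using w13(2) \<phi>P by (simp add: has_weak_deriv_def)
    ultimately show ?thesis
      using set_lebesgue_integral_eq_integral(2)[OF J(1)]
        set_lebesgue_integral_eq_integral(2)[OF weak_deriv_period_integrals(2)[OF w2 test_deriv[OF \<phi>U]]] by simp
  qed
  have e3: "integral period (\<lambda>x. d3 x * \<phi> x) = integral period (\<lambda>x. sin x * \<phi> x) - \<alpha>\<^sup>2 * integral period (\<lambda>x. d1 x * \<phi> x)"
    unfolding J(2) using isn i1
    by (subst integral_diff) (auto simp: absolutely_integrable_on_def intro!: integrable_on_mult_right)
  have e4: "integral period (\<lambda>x. cos x * deriv \<phi> x) = integral period (\<lambda>x. sin x * \<phi> x)"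
    using ac_by_parts[OF ac_cos sm test_periodic[OF \<phi>P]] by simp
  have j2: "(\<lambda>x. v2 x * deriv \<phi> x) integrable_on period"
    using weak_deriv_period_integrals(2)[OF w2 test_deriv[OF \<phi>U]] by (simp add: absolutely_integrable_on_def)
  have jV: "(\<lambda>x. V x * deriv \<phi> x) integrable_on period" "(\<lambda>x. cos x * deriv \<phi> x) integrable_on period"
    by (intro integrable_continuous_real continuous_intros c ac_continuous[OF a])+
  have "((\<lambda>x. v2 x * deriv \<phi> x + \<alpha>\<^sup>2 * (V x * deriv \<phi> x) + cos x * deriv \<phi> x) has_integral
      integral period (\<lambda>x. v2 x * deriv \<phi> x) + \<alpha>\<^sup>2 * integral period (\<lambda>x. V x * deriv \<phi> x)
      + integral period (\<lambda>x. cos x * deriv \<phi> x)) period"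
    by (intro has_integral_add has_integral_mult_right integrable_integral j2 jV)
  moreover have "(v2 x + \<alpha>\<^sup>2 * V x + cos x) * deriv \<phi> x
      = v2 x * deriv \<phi> x + \<alpha>\<^sup>2 * (V x * deriv \<phi> x) + cos x * deriv \<phi> x" for x
    by (simp only: distrib_right mult.assoc)
  ultimately have "integral period (\<lambda>x. (v2 x + \<alpha>\<^sup>2 * V x + cos x) * deriv \<phi> x)
    = integral period (\<lambda>x. v2 x * deriv \<phi> x) + \<alpha>\<^sup>2 * integral period (\<lambda>x. V x * deriv \<phi> x)
      + integral period (\<lambda>x. cos x * deriv \<phi> x)"
    by (simp add: integral_unique)
  then show ?thesis using e1 e2 e3 e4 by simp
qed

text \<open>Two weak derivatives give a continuously differentiable representative. Near a positive
  point a bump localizes the combination \<open>r0\<close>, whose weak derivative is zero there; so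
  \<open>r0\<close> is almost everywhere a constant, and integrating it back makes \<open>V1\<close>
  classically differentiable.\<close>

lemma strong_steady_classical:
  assumes \<alpha>: "\<alpha> > 0" and ss: "strong_steady_state \<alpha> n M v" and zd: "zero_dissipation \<alpha> n v"
  obtains V V1 r where "steady \<alpha> V V1 r" "ac V V1" "AE x in lebesgue. V x = v x"
    "integral period V = M" "energy \<alpha> v = ereal (en \<alpha> V V1)"
proof -
  have mc: "v \<in> mass_class M" and H2: "v \<in> H_circle 2" using ss by (auto simp: strong_steady_state_def)
  have L2: "v \<in> L2_circle" using mc by (simp add: mass_class_def)
  obtain V g where V: "ac V g" "AE x in lebesgue. V x = v x" and w1: "has_weak_deriv 1 UNIV v g"
    using H_circle_rep[OF H2] by (metis one_le_numeral)
  obtain v2 where v2: "has_weak_deriv 2 UNIV v v2"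
    using H2 unfolding H_circle_def by blast
  obtain V1 where V1: "ac V1 v2" "AE x in lebesgue. V1 x = g x"
    using weak_deriv_ac[OF weak_deriv_2_iff[OF w1 v2]] by blast
  note D = ac_deriv_continuous_rep[OF V(1) V1]
  have cV: "continuous_on A V" "continuous_on A V1" for A using ac_continuous[OF V(1)] ac_continuous[OF V1(1)] by auto
  have V0: "0 \<le> V x" for x by (rule mass_class_rep(1)[OF mc V])
  define P where "P = {x. V x > 0}"
  have oP: "open P" unfolding P_def using cV by (intro open_Collect_less continuous_intros)
  define r0 where "r0 = (\<lambda>x. v2 x + \<alpha>\<^sup>2 * V x + cos x)"
  have r0p: "circle_periodic r0" unfolding r0_def
    using acD(1,2)[OF V1(1)] acD(1)[OF V(1)] by (simp add: circle_periodic_def)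
  have cosV: "(\<lambda>x. \<alpha>\<^sup>2 * V x + cos x) absolutely_integrable_on {a..b}" for a b
    by (intro absolutely_integrable_continuous_real continuous_intros cV)
  have r0i: "r0 absolutely_integrable_on period"
    using set_integral_add(1)[OF acD(3)[OF V1(1)] cosV] by (simp add: r0_def add.assoc)
  have r00: "integral period (\<lambda>x. r0 x * deriv \<phi> x) = 0" if "\<phi> \<in> test_functions P" for \<phi>
    using zero_dissipation_weak_equation[OF L2 v2 D(2) V(2) zd] that by (simp add: P_def r0_def)
  have loc: "\<exists>\<rho> \<kappa>. \<rho> > 0 \<and> (\<forall>x. \<bar>x - x0\<bar> < \<rho> \<longrightarrow> V x > 0 \<and> (V1 has_real_derivative \<kappa> - \<alpha>\<^sup>2 * V x - cos x) (at x))"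
    if x0: "V x0 > 0" for x0
  proof -
    obtain e where e: "e > 0" "ball x0 e \<subseteq> P" using oP x0 unfolding open_contains_ball P_def by blast
    define \<rho> where "\<rho> = min e pi / 2"
    have \<rho>: "0 < \<rho>" "\<rho> < e" "\<rho> < pi" using e pi_gt_zero by (auto simp: \<rho>_def min_def)
    have sub: "{x0 - \<rho>..x0 + \<rho>} \<subseteq> P" using e \<rho> by (auto simp: subset_iff dist_real_def)
    define b where "b = bump x0 \<rho>"
    have bt: "b \<in> test_functions P" unfolding b_def
    proof (rule bump_test_interval)
      fix x and k :: int assume "x \<in> P"
      then show "x + 2 * pi * of_int k \<in> P"
        using periodic_int[OF acD(1)[OF V(1)], of x k] by (simp add: P_def)
    qed (use \<rho> sub in auto)
    obtain A where A: "ac A (\<lambda>x. r0 x * deriv b x)" "AE x in lebesgue. A x = r0 x * b x"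
      by (rule localize_ac[OF r0p r0i r00 bt])
    have cA: "continuous_on S A" for S by (rule ac_continuous[OF A(1)])
    have cb: "continuous_on S b" "continuous_on S (deriv b)" and Db: "DERIV b x :> deriv b x" for S x
      unfolding b_def using smooth_continuous[OF smooth_bump] smooth_continuous[OF smooth_deriv[OF smooth_bump]]
        smooth_has_deriv[OF smooth_bump] by auto
    have bpos: "b x > 0" if "\<bar>x - x0\<bar> < \<rho>" for x
      using cos_greater_iff[of \<rho> "x - x0"] that \<rho> by (simp add: b_def bump_pos_iff)
    \<comment> \<open>The continuous version of \<open>r0\<close> where the bump is positive. Its
      derivative is zero because \<open>A\<close> and \<open>b\<close> have the same logarithmic
      derivative.\<close>
    define k where "k = (\<lambda>x. A x / b x)"
    have r0k: "AE x in lebesgue. \<bar>x - x0\<bar> < \<rho> \<longrightarrow> r0 x = k x"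
      using A(2)
    proof eventually_elim
      case (elim x)
      then show ?case using bpos[of x] by (auto simp: k_def)
    qed
    have DA: "(A has_real_derivative k x * deriv b x) (at x)" if x: "\<bar>x - x0\<bar> < \<rho>" for x
    proof -
      \<comment> \<open>Halfway between \<open>x\<close> and the ends of the bump: a compact
        interval around \<open>x\<close> on which \<open>b\<close> stays positive.\<close>
      define a c where "a = (x0 - \<rho> + x) / 2" and "c = (x0 + \<rho> + x) / 2"
      have ac: "a < x" "x < c" "x0 - \<rho> < a" "c < x0 + \<rho>"
        using x by (auto simp: a_def c_def abs_less_iff field_simps)
      have in': "\<bar>y - x0\<bar> < \<rho>" if "y \<in> {a..c}" for y using that ac by (auto simp: abs_less_iff)
      have ck: "continuous_on {a..c} (\<lambda>x. k x * deriv b x)"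
        unfolding k_def by (intro continuous_on_mult continuous_on_divide cA cb ballI) (rule less_imp_neq[THEN not_sym, OF bpos[OF in']])
      show ?thesis
      proof (rule deriv_of_integral[OF ac(1,2) ck])
        fix y assume y: "y \<in> {a..c}"
        have "A y - A a = integral {a..y} (\<lambda>x. r0 x * deriv b x)" using acD(5)[OF A(1), of a y] y by simp
        also have "\<dots> = integral {a..y} (\<lambda>x. k x * deriv b x)"
        proof (rule abs_int_AE(2))
          show "(\<lambda>x. k x * deriv b x) absolutely_integrable_on {a..y}"
            by (rule absolutely_integrable_continuous_real, rule continuous_on_subset[OF ck]) (use y in auto)
          show "AE x in lebesgue. x \<in> {a..y} \<longrightarrow> r0 x * deriv b x = k x * deriv b x"
            using r0k by eventually_elim (use in' y in auto)
        qed
        finally show "A y - A a = integral {a..y} (\<lambda>x. k x * deriv b x)" .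
      qed
    qed
    have Dk: "(k has_real_derivative 0) (at x)" if x: "\<bar>x - x0\<bar> < \<rho>" for x
    proof -
      have "(k has_real_derivative (k x * deriv b x * b x - A x * deriv b x) / (b x * b x)) (at x)"
        unfolding k_def[abs_def] by (rule DERIV_divide[OF DA[OF x, unfolded k_def] Db[of x]]) (use bpos[OF x] in simp)
      moreover have "k x * b x = A x" using bpos[OF x] by (simp add: k_def)
      then have "k x * deriv b x * b x - A x * deriv b x = 0" by (simp add: mult.commute mult.left_commute)
      ultimately show ?thesis by simp
    qed
    have "\<exists>\<kappa>. \<forall>x\<in>{x0 - \<rho><..<x0 + \<rho>}. k x = \<kappa>"
    proof (rule has_field_derivative_zero_constant)
      fix x assume "x \<in> {x0 - \<rho><..<x0 + \<rho>}"
      then have "\<bar>x - x0\<bar> < \<rho>" by (simp add: abs_less_iff)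
      then show "(k has_real_derivative 0) (at x within {x0 - \<rho><..<x0 + \<rho>})"
        by (rule has_field_derivative_at_within[OF Dk])
    qed simp
    then obtain \<kappa> where \<kappa>': "\<And>x. x \<in> {x0 - \<rho><..<x0 + \<rho>} \<Longrightarrow> k x = \<kappa>" by blast
    have \<kappa>: "k x = \<kappa>" if "\<bar>x - x0\<bar> < \<rho>" for x
      by (rule \<kappa>') (use that in \<open>simp add: abs_less_iff\<close>)
    have "(V1 has_real_derivative \<kappa> - \<alpha>\<^sup>2 * V x - cos x) (at x)" if x: "\<bar>x - x0\<bar> < \<rho>" for x
    proof -
      define a c where "a = (x0 - \<rho> + x) / 2" and "c = (x0 + \<rho> + x) / 2"
      have ac: "a < x" "x < c" "x0 - \<rho> < a" "c < x0 + \<rho>"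
        using x by (auto simp: a_def c_def abs_less_iff field_simps)
      have in': "\<bar>y - x0\<bar> < \<rho>" if "y \<in> {a..c}" for y using that ac by (auto simp: abs_less_iff)
      have ck: "continuous_on S (\<lambda>x. \<kappa> - \<alpha>\<^sup>2 * V x - cos x)" for S by (intro continuous_intros cV)
      show ?thesis
      proof (rule deriv_of_integral[OF ac(1,2) ck])
        fix y assume y: "y \<in> {a..c}"
        have "V1 y - V1 a = integral {a..y} v2" using acD(5)[OF V1(1), of a y] y by simp
        also have "\<dots> = integral {a..y} (\<lambda>x. \<kappa> - \<alpha>\<^sup>2 * V x - cos x)"
        proof (rule abs_int_AE(2)[OF absolutely_integrable_continuous_real[OF ck]])
          show "AE x in lebesgue. x \<in> {a..y} \<longrightarrow> v2 x = \<kappa> - \<alpha>\<^sup>2 * V x - cos x"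
            using r0k
          proof eventually_elim
            case (elim x)
            show ?case
            proof
              assume "x \<in> {a..y}"
              then have x: "\<bar>x - x0\<bar> < \<rho>" using in' y by auto
              then have "r0 x = \<kappa>" using elim \<kappa>[OF x] by simp
              then show "v2 x = \<kappa> - \<alpha>\<^sup>2 * V x - cos x" by (simp add: r0_def)
            qed
          qed
        qed
        finally show "V1 y - V1 a = integral {a..y} (\<lambda>x. \<kappa> - \<alpha>\<^sup>2 * V x - cos x)" .
      qed
    qed
    moreover have "V x > 0" if "\<bar>x - x0\<bar> < \<rho>" for x using sub that by (auto simp: P_def abs_less_iff subset_iff)
    ultimately show ?thesis using \<rho> by blast
  qed
  \<comment> \<open>Reading the multiplier off the classical derivative yields one global function
    from the local constants.\<close>
  define r where "r = (\<lambda>x. deriv V1 x + \<alpha>\<^sup>2 * V x + cos x)"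
  have "steady \<alpha> V V1 r"
  proof
    fix x show "0 \<le> V x" by (rule V0)
    show "(V has_real_derivative V1 x) (at x)" by (rule D(1))
    assume x: "V x > 0"
    obtain \<rho> \<kappa> where \<rho>: "\<rho> > 0" and loc': "\<And>y. \<bar>y - x\<bar> < \<rho> \<Longrightarrow> (V1 has_real_derivative \<kappa> - \<alpha>\<^sup>2 * V y - cos y) (at y)"
      using loc[OF x] by blast
    have rk: "r y = \<kappa>" if "\<bar>y - x\<bar> < \<rho>" for y
      using DERIV_imp_deriv[OF loc'[OF that]] by (simp add: r_def)
    show "(V1 has_real_derivative r x - \<alpha>\<^sup>2 * V x - cos x) (at x)"
      using loc'[of x] rk[of x] \<rho> by simp
    have "((\<lambda>x. \<kappa>) has_real_derivative 0) (at x)" by simp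
    then show "(r has_real_derivative 0) (at x)"
      by (rule has_field_derivative_transform_within_open[of _ _ _ "ball x \<rho>"])
         (use \<rho> rk in \<open>auto simp: dist_real_def abs_minus_commute\<close>)
  qed (use \<alpha> acD(1)[OF V(1)] cV in auto)
  moreover have "energy \<alpha> v = ereal (en \<alpha> V V1)"
    by (rule energy_ac(2)[OF D(2) L2_circleI_continuous[OF acD(1)[OF V1(1)] cV(2)] L2 V(2)])
  ultimately show ?thesis using that D(2) V(2) mass_class_rep(2)[OF mc V] by blast
qed


section \<open>Regularity of minimizers\<close>

text \<open>Admissible directions of variation. Boundedness of the density makes its products with
  integrable densities integrable.\<close>

definition bounded_ac :: "(real \<Rightarrow> real) \<Rightarrow> (real \<Rightarrow> real) \<Rightarrow> bool" where
  "bounded_ac \<eta> k \<longleftrightarrow> ac \<eta> k \<and> k \<in> borel_measurable lebesgue \<and> (\<exists>B. \<forall>x. \<bar>k x\<bar> \<le> B)"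

lemma bounded_ac_lincomb:
  assumes "bounded_ac \<eta> k" "bounded_ac \<theta> l"
  shows "bounded_ac (\<lambda>x. \<eta> x + t * \<theta> x) (\<lambda>x. k x + t * l x)"
proof -
  obtain B C where B: "\<And>x. \<bar>k x\<bar> \<le> B" and C: "\<And>x. \<bar>l x\<bar> \<le> C"
    using assms unfolding bounded_ac_def by blast
  have "\<bar>k x + t * l x\<bar> \<le> B + \<bar>t\<bar> * C" for x
  proof -
    have "\<bar>k x + t * l x\<bar> \<le> \<bar>k x\<bar> + \<bar>t\<bar> * \<bar>l x\<bar>" using abs_triangle_ineq[of "k x" "t * l x"] by (simp add: abs_mult)
    also have "\<dots> \<le> B + \<bar>t\<bar> * C" by (intro add_mono B mult_left_mono C) simp
    finally show ?thesis .
  qed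
  moreover have "(\<lambda>x. k x + t * l x) \<in> borel_measurable lebesgue"
    using assms unfolding bounded_ac_def by (intro borel_measurable_add borel_measurable_times borel_measurable_const) auto
  ultimately show ?thesis using assms ac_lincomb unfolding bounded_ac_def by blast
qed

lemma bounded_ac_uminus: "bounded_ac \<eta> k \<Longrightarrow> bounded_ac (\<lambda>x. - \<eta> x) (\<lambda>x. - k x)"
proof -
  assume a: "bounded_ac \<eta> k"
  have "bounded_ac (\<lambda>x. 0) (\<lambda>x. 0)" using ac_const by (auto simp: bounded_ac_def)
  from bounded_ac_lincomb[OF this a, of "-1"] show ?thesis by simp
qed

lemma abs_int_mult_bounded:
  fixes g k :: "real \<Rightarrow> real"
  assumes "g absolutely_integrable_on S" "S \<in> sets lebesgue" "k \<in> borel_measurable lebesgue" "\<And>x. \<bar>k x\<bar> \<le> B"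
  shows "(\<lambda>x. k x * g x) absolutely_integrable_on S"
proof (rule absolutely_integrable_bounded_measurable_product_real[OF _ assms(2) _ assms(1)])
  show "k \<in> borel_measurable (lebesgue_on S)" using assms(3) by (rule measurable_restrict_space1)
  show "bounded (k ` S)" using assms(4) by (auto simp: bounded_iff)
qed

lemma bounded_ac_ints:
  assumes k: "bounded_ac \<eta> k" and g: "g absolutely_integrable_on period"
  shows "(\<lambda>x. g x * k x) absolutely_integrable_on period" "(\<lambda>x. (k x)\<^sup>2) absolutely_integrable_on period"
proof -
  obtain B where B: "\<And>x. \<bar>k x\<bar> \<le> B" and m: "k \<in> borel_measurable lebesgue" and a: "ac \<eta> k"
    using k unfolding bounded_ac_def by blast
  show "(\<lambda>x. g x * k x) absolutely_integrable_on period"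
    using abs_int_mult_bounded[OF g _ m B] by (simp add: mult.commute)
  show "(\<lambda>x. (k x)\<^sup>2) absolutely_integrable_on period"
    using abs_int_mult_bounded[OF acD(3)[OF a] _ m B] by (simp add: power2_eq_square)
qed

text \<open>The variational problem for continuous representatives: competitors are
  \<open>ac\<close> pairs, and uniqueness becomes equality of functions.\<close>

locale minimizer =
  fixes \<alpha> M :: real and U g :: "real \<Rightarrow> real"
  assumes \<alpha>: "\<alpha> > 0" and M: "M > 0" and a: "ac U g" and L2: "g \<in> L2_circle" and nonneg: "0 \<le> U x" and mass: "integral period U = M"
    and min: "\<lbrakk>ac W h; h \<in> L2_circle; \<And>x. 0 \<le> W x; integral period W = M\<rbrakk> \<Longrightarrow> en \<alpha> U g \<le> en \<alpha> W h"
    and uniq: "\<lbrakk>ac W h; h \<in> L2_circle; \<And>x. 0 \<le> W x; integral period W = M; en \<alpha> W h = en \<alpha> U g\<rbrakk> \<Longrightarrow> W = U"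
begin

text \<open>The derivative of \<open>en\<close> at the minimizer in the direction
  \<open>\<eta>\<close> with density \<open>k\<close>.\<close>

definition L :: "(real \<Rightarrow> real) \<Rightarrow> (real \<Rightarrow> real) \<Rightarrow> real" where
  "L \<eta> k = integral period (\<lambda>x. g x * k x - \<alpha>\<^sup>2 * (U x * \<eta> x) - \<eta> x * cos x)"

lemma contU: "continuous_on A U" by (rule ac_continuous[OF a])

lemma perU: "circle_periodic U" by (rule acD(1)[OF a])

lemma L_has_integral:
  assumes "bounded_ac \<eta> k"
  shows "((\<lambda>x. g x * k x - \<alpha>\<^sup>2 * (U x * \<eta> x) - \<eta> x * cos x) has_integral L \<eta> k) period"
proof -
  have c\<eta>: "continuous_on A \<eta>" for A using assms ac_continuous unfolding bounded_ac_def by blast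
  have gk: "(\<lambda>x. g x * k x) integrable_on period"
    using bounded_ac_ints(1)[OF assms acD(3)[OF a]] by (simp add: absolutely_integrable_on_def)
  have "(\<lambda>x. \<alpha>\<^sup>2 * (U x * \<eta> x)) integrable_on period" "(\<lambda>x. \<eta> x * cos x) integrable_on period"
    by (intro integrable_continuous_real continuous_intros contU c\<eta>)+
  then have "(\<lambda>x. g x * k x - \<alpha>\<^sup>2 * (U x * \<eta> x) - \<eta> x * cos x) integrable_on period"
    by (rule integrable_diff[OF integrable_diff[OF gk]])
  then show ?thesis unfolding L_def by (rule integrable_integral)
qed

lemma L_lincomb:
  assumes "bounded_ac \<eta> k" "bounded_ac \<theta> l"
  shows "L (\<lambda>x. \<eta> x + t * \<theta> x) (\<lambda>x. k x + t * l x) = L \<eta> k + t * L \<theta> l"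
proof -
  have "((\<lambda>x. (g x * k x - \<alpha>\<^sup>2 * (U x * \<eta> x) - \<eta> x * cos x) + t * (g x * l x - \<alpha>\<^sup>2 * (U x * \<theta> x) - \<theta> x * cos x))
      has_integral (L \<eta> k + t * L \<theta> l)) period"
    by (intro has_integral_add has_integral_mult_right L_has_integral assms)
  then show ?thesis unfolding L_def[of "\<lambda>x. \<eta> x + t * \<theta> x"]
    by (intro integral_unique) (simp add: algebra_simps)
qed

lemma L_uminus: "bounded_ac \<eta> k \<Longrightarrow> L (\<lambda>x. - \<eta> x) (\<lambda>x. - k x) = - L \<eta> k"
proof -
  assume b: "bounded_ac \<eta> k"
  have z: "bounded_ac (\<lambda>x. 0) (\<lambda>x. 0)" using ac_const by (auto simp: bounded_ac_def)
  have "L (\<lambda>x. 0) (\<lambda>x. 0) = 0" by (simp add: L_def)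
  then show ?thesis using L_lincomb[OF z b, of "-1"] by simp
qed

text \<open>The energy is a polynomial of degree two, so its second-order expansion is exact. That
  matters for \<open>not_wide\<close>, where both correction terms vanish.\<close>

lemma en_expand:
  assumes b: "bounded_ac \<eta> k"
  shows "en \<alpha> (\<lambda>x. U x + t * \<eta> x) (\<lambda>x. g x + t * k x)
      = en \<alpha> U g + t * L \<eta> k + t\<^sup>2 / 2 * integral period (\<lambda>x. (k x)\<^sup>2 - \<alpha>\<^sup>2 * (\<eta> x)\<^sup>2)"
    and "(\<lambda>x. g x + t * k x) \<in> L2_circle"
proof -
  have c\<eta>: "continuous_on A \<eta>" for A using b ac_continuous unfolding bounded_ac_def by blast
  have ak: "ac \<eta> k" using b by (simp add: bounded_ac_def)
  note i = bounded_ac_ints[OF b acD(3)[OF a]]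
  have g2: "(\<lambda>x. (g x)\<^sup>2) absolutely_integrable_on period" by (rule L2_circleD(3)[OF L2])
  have gk: "(\<lambda>x. g x * k x) integrable_on period" and k2: "(\<lambda>x. (k x)\<^sup>2) integrable_on period"
    and g2': "(\<lambda>x. (g x)\<^sup>2) integrable_on period"
    using i g2 by (simp_all add: absolutely_integrable_on_def)
  have I0: "((\<lambda>x. (g x)\<^sup>2 - \<alpha>\<^sup>2 * (U x)\<^sup>2) has_integral integral period (\<lambda>x. (g x)\<^sup>2 - \<alpha>\<^sup>2 * (U x)\<^sup>2)) period"
    by (intro integrable_integral integrable_diff g2' integrable_continuous_real continuous_intros contU)
  have Ic: "((\<lambda>x. U x * cos x) has_integral integral period (\<lambda>x. U x * cos x)) period"
    by (intro integrable_integral integrable_continuous_real continuous_intros contU)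
  have Ie: "((\<lambda>x. \<eta> x * cos x) has_integral integral period (\<lambda>x. \<eta> x * cos x)) period"
    by (intro integrable_integral integrable_continuous_real continuous_intros c\<eta>)
  have IQ: "((\<lambda>x. (k x)\<^sup>2 - \<alpha>\<^sup>2 * (\<eta> x)\<^sup>2) has_integral integral period (\<lambda>x. (k x)\<^sup>2 - \<alpha>\<^sup>2 * (\<eta> x)\<^sup>2)) period"
    by (intro integrable_integral integrable_diff k2 integrable_continuous_real continuous_intros c\<eta>)
  note IL = L_has_integral[OF b]
  \<comment> \<open>\<open>L\<close> contains the linear potential term, which does not belong to
    the quadratic integrand; hence \<open>\<eta> x * cos x\<close> is added back.\<close>
  have "((\<lambda>x. ((g x)\<^sup>2 - \<alpha>\<^sup>2 * (U x)\<^sup>2) + 2 * t * ((g x * k x - \<alpha>\<^sup>2 * (U x * \<eta> x) - \<eta> x * cos x) + \<eta> x * cos x)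
        + t\<^sup>2 * ((k x)\<^sup>2 - \<alpha>\<^sup>2 * (\<eta> x)\<^sup>2)) has_integral
      (integral period (\<lambda>x. (g x)\<^sup>2 - \<alpha>\<^sup>2 * (U x)\<^sup>2) + 2 * t * (L \<eta> k + integral period (\<lambda>x. \<eta> x * cos x))
        + t\<^sup>2 * integral period (\<lambda>x. (k x)\<^sup>2 - \<alpha>\<^sup>2 * (\<eta> x)\<^sup>2))) period"
    by (intro has_integral_add has_integral_mult_right I0 IL Ie IQ)
  moreover have "((g x)\<^sup>2 - \<alpha>\<^sup>2 * (U x)\<^sup>2) + 2 * t * ((g x * k x - \<alpha>\<^sup>2 * (U x * \<eta> x) - \<eta> x * cos x) + \<eta> x * cos x)
        + t\<^sup>2 * ((k x)\<^sup>2 - \<alpha>\<^sup>2 * (\<eta> x)\<^sup>2) = (g x + t * k x)\<^sup>2 - \<alpha>\<^sup>2 * (U x + t * \<eta> x)\<^sup>2" for x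
    by (simp add: power2_eq_square algebra_simps)
  ultimately have 1: "((\<lambda>x. (g x + t * k x)\<^sup>2 - \<alpha>\<^sup>2 * (U x + t * \<eta> x)\<^sup>2) has_integral
      (integral period (\<lambda>x. (g x)\<^sup>2 - \<alpha>\<^sup>2 * (U x)\<^sup>2) + 2 * t * (L \<eta> k + integral period (\<lambda>x. \<eta> x * cos x))
        + t\<^sup>2 * integral period (\<lambda>x. (k x)\<^sup>2 - \<alpha>\<^sup>2 * (\<eta> x)\<^sup>2))) period" by simp
  have "((\<lambda>x. U x * cos x + t * (\<eta> x * cos x)) has_integral (integral period (\<lambda>x. U x * cos x) + t * integral period (\<lambda>x. \<eta> x * cos x))) period"
    by (intro has_integral_add has_integral_mult_right Ic Ie)
  moreover have "U x * cos x + t * (\<eta> x * cos x) = (U x + t * \<eta> x) * cos x" for x by (simp add: algebra_simps)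
  ultimately have 2: "((\<lambda>x. (U x + t * \<eta> x) * cos x) has_integral (integral period (\<lambda>x. U x * cos x) + t * integral period (\<lambda>x. \<eta> x * cos x))) period"
    by simp
  show "en \<alpha> (\<lambda>x. U x + t * \<eta> x) (\<lambda>x. g x + t * k x)
      = en \<alpha> U g + t * L \<eta> k + t\<^sup>2 / 2 * integral period (\<lambda>x. (k x)\<^sup>2 - \<alpha>\<^sup>2 * (\<eta> x)\<^sup>2)"
    unfolding en_def integral_unique[OF 1] integral_unique[OF 2] by (simp add: algebra_simps)
  have "(\<lambda>x. (g x)\<^sup>2 + (2 * t) * (g x * k x) + t\<^sup>2 * (k x)\<^sup>2) absolutely_integrable_on period"
    by (intro set_integral_add(1) set_integrable_mult_right g2 i)
  then have "(\<lambda>x. (g x + t * k x)\<^sup>2) absolutely_integrable_on period"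
    by (simp add: power2_eq_square algebra_simps)
  moreover have "(\<lambda>x. g x + t * k x) \<in> borel_measurable lebesgue"
    using b L2_circleD(2)[OF L2] unfolding bounded_ac_def by (intro borel_measurable_add borel_measurable_times borel_measurable_const) auto
  ultimately show "(\<lambda>x. g x + t * k x) \<in> L2_circle"
    using acD(2)[OF ac_lincomb[OF a ak, of t]] by (simp add: L2_circle_def)
qed

text \<open>Nonnegativity is at risk only where \<open>\<eta>\<close> is negative, and there
  \<open>U\<close> is at least \<open>\<epsilon>\<close>. The summand 1 in \<open>B + 1\<close>
  keeps the bound on \<open>t\<close> meaningful when \<open>B = 0\<close>.\<close>

lemma variation_admissible:
  assumes b: "bounded_ac \<eta> k" and z: "integral period \<eta> = 0" and B: "\<And>x. \<bar>\<eta> x\<bar> \<le> B"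
    and e: "\<epsilon> > 0" "\<And>x. \<eta> x < 0 \<Longrightarrow> U x \<ge> \<epsilon>" and t: "0 \<le> t" "t \<le> \<epsilon> / (B + 1)"
  shows "ac (\<lambda>x. U x + t * \<eta> x) (\<lambda>x. g x + t * k x)" "(\<lambda>x. g x + t * k x) \<in> L2_circle"
    "0 \<le> U x + t * \<eta> x" "integral period (\<lambda>x. U x + t * \<eta> x) = M"
proof -
  have ak: "ac \<eta> k" using b by (simp add: bounded_ac_def)
  show "ac (\<lambda>x. U x + t * \<eta> x) (\<lambda>x. g x + t * k x)" by (rule ac_lincomb[OF a ak])
  show "(\<lambda>x. g x + t * k x) \<in> L2_circle" by (rule en_expand(2)[OF b])
  have B0: "B \<ge> 0" using B[of 0] by linarith
  show "0 \<le> U x + t * \<eta> x"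
  proof (cases "\<eta> x < 0")
    case True
    have "t * (- \<eta> x) \<le> \<epsilon> / (B + 1) * (B + 1)"
      using t B[of x] e B0 True by (intro mult_mono) (auto simp: abs_le_iff)
    then have "t * (- \<eta> x) \<le> \<epsilon>" using B0 by simp
    then show ?thesis using e(2)[OF True] by simp
  next
    case False
    then show ?thesis using t nonneg[of x] by simp
  qed
  have "\<eta> integrable_on period" "U integrable_on period"
    by (intro integrable_continuous_real ac_continuous[OF ak] contU)+
  then show "integral period (\<lambda>x. U x + t * \<eta> x) = M"
    using z mass by (subst integral_add) (auto intro: integrable_on_mult_right)
qed

lemma first_variation:
  assumes b: "bounded_ac \<eta> k" and z: "integral period \<eta> = 0" and B: "\<And>x. \<bar>\<eta> x\<bar> \<le> B"
    and e: "\<epsilon> > 0" "\<And>x. \<eta> x < 0 \<Longrightarrow> U x \<ge> \<epsilon>"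
  shows "L \<eta> k \<ge> 0"
proof (rule ccontr)
  assume "\<not> ?thesis"
  then have Ln: "L \<eta> k < 0" by simp
  define Q where "Q = integral period (\<lambda>x. (k x)\<^sup>2 - \<alpha>\<^sup>2 * (\<eta> x)\<^sup>2)"
  have B0: "B \<ge> 0" using B[of 0] by linarith
  \<comment> \<open>The first bound keeps the competitor admissible; the second keeps the quadratic
    term below half of \<open>- L \<eta> k\<close>, so the energy would drop.\<close>
  define t where "t = min (\<epsilon> / (B + 1)) (- L \<eta> k / (\<bar>Q\<bar> + 1))"
  have t: "0 < t" "t \<le> \<epsilon> / (B + 1)" "t \<le> - L \<eta> k / (\<bar>Q\<bar> + 1)"
  proof -
    have "0 < \<epsilon> / (B + 1)" "0 < - L \<eta> k / (\<bar>Q\<bar> + 1)"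
      by (rule divide_pos_pos; use e B0 Ln in linarith)+
    then show "0 < t" "t \<le> \<epsilon> / (B + 1)" "t \<le> - L \<eta> k / (\<bar>Q\<bar> + 1)"
      unfolding t_def by linarith+
  qed
  have "en \<alpha> U g \<le> en \<alpha> (\<lambda>x. U x + t * \<eta> x) (\<lambda>x. g x + t * k x)"
    by (rule min[OF variation_admissible[OF b z B e]]) (use t in auto)
  then have "0 \<le> t * (L \<eta> k + t / 2 * Q)"
    unfolding en_expand(1)[OF b] Q_def[symmetric] by (simp add: power2_eq_square algebra_simps)
  then have "0 \<le> L \<eta> k + t / 2 * Q" using t(1) by (simp add: zero_le_mult_iff)
  moreover have "t * \<bar>Q\<bar> \<le> t * (\<bar>Q\<bar> + 1)" using t by (intro mult_left_mono) auto
  moreover have "t * (\<bar>Q\<bar> + 1) \<le> - L \<eta> k" using t(3) pos_le_divide_eq[of "\<bar>Q\<bar> + 1" t "- L \<eta> k"] by linarith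
  moreover have "t / 2 * Q \<le> t * \<bar>Q\<bar> / 2" using t(1) by (simp add: mult_left_mono)
  ultimately show False using Ln by linarith
qed

end

section \<open>Periodic extension and hat functions\<close>

text \<open>\<open>reduce\<close> sends the right end of the window to the left end, so agreement on
  the closed window needs equal end values.\<close>

lemma periodic_ext_eq:
  assumes "F (c - pi) = F (c + pi)" "x \<in> {c - pi..c + pi}"
  shows "F (reduce c x) = F x"
proof (cases "x < c + pi")
  case True
  then show ?thesis using assms reduce_id[of c x] by simp
next
  case False
  then have x: "x = c + pi" using assms by simp
  have "reduce c (c - pi + 2 * pi) = c - pi" unfolding reduce_periodic by (rule reduce_id) auto
  moreover have "c - pi + 2 * pi = c + pi" by simp
  ultimately have "reduce c x = c - pi" using x by metis
  then show ?thesis using assms x by metis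
qed

lemma periodic_ext_integral:
  assumes per: "circle_periodic h" and hi: "h absolutely_integrable_on period"
    and eq: "\<And>x. x \<in> {c - pi..c + pi} \<Longrightarrow> h x = H x"
  shows "integral period h = integral {c - pi..c + pi} H"
  using periodic_integral(1)[OF per hi, of c] integral_cong[of "{c - pi..c + pi}" h H] eq by simp

lemma periodic_ext_ac:
  fixes F G :: "real \<Rightarrow> real"
  assumes F: "F (c - pi) = F (c + pi)" and G: "G (c - pi) = G (c + pi)"
    and m: "G \<in> borel_measurable borel" and B: "\<And>x. \<bar>G x\<bar> \<le> B"
    and i: "\<And>x. x \<in> {c - pi..c + pi} \<Longrightarrow> (G has_integral F x - F (c - pi)) {c - pi..x}"
  shows "bounded_ac (\<lambda>x. F (reduce c x)) (\<lambda>x. G (reduce c x))"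
proof -
  have m': "(\<lambda>x. G (reduce c x)) \<in> borel_measurable lebesgue"
    using measurable_compose[OF reduce_measurable m] by (simp add: measurable_completion)
  have "(\<lambda>x. 1::real) absolutely_integrable_on {c - pi..c + pi}"
    by (intro absolutely_integrable_continuous_real continuous_intros)
  from abs_int_mult_bounded[OF this _ m' B]
  have gi: "(\<lambda>x. G (reduce c x)) absolutely_integrable_on {c - pi..c + pi}" by simp
  have "ac (\<lambda>x. F (reduce c x)) (\<lambda>x. G (reduce c x))"
  proof (rule ac_window[OF periodic_compose_reduce periodic_compose_reduce gi])
    fix x assume x: "x \<in> {c - pi..c + pi}"
    have "integral {c - pi..x} (\<lambda>x. G (reduce c x)) = integral {c - pi..x} G"
      by (rule integral_cong) (use periodic_ext_eq[OF G] x in auto)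
    then show "F (reduce c x) - F (reduce c (c - pi)) = integral {c - pi..x} (\<lambda>x. G (reduce c x))"
      using periodic_ext_eq[OF F x] periodic_ext_eq[OF F, of "c - pi"] integral_unique[OF i[OF x]] by simp
  qed
  then show ?thesis using m' B unfolding bounded_ac_def by blast
qed

definition hat :: "real \<Rightarrow> real \<Rightarrow> real \<Rightarrow> real" where
  "hat p d x = max 0 (d - \<bar>x - p\<bar>)"

definition hat' :: "real \<Rightarrow> real \<Rightarrow> real \<Rightarrow> real" where
  "hat' p d x = (if p - d < x \<and> x < p then 1 else if p < x \<and> x < p + d then -1 else 0)"

lemma hat'_has_integral:
  assumes d: "0 < d" and ab: "a \<le> b"
  shows "(hat' p d has_integral hat p d b - hat p d a) {a..b}"
proof (rule fundamental_theorem_of_calculus_interior_strong[of "{p - d, p, p + d}"])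
  show "continuous_on {a..b} (hat p d)" unfolding hat_def[abs_def] by (intro continuous_intros)
  fix x assume x: "x \<in> {a<..<b} - {p - d, p, p + d}"
  then consider "x < p - d" | "p - d < x" "x < p" | "p < x" "x < p + d" | "p + d < x" by force
  then have "(hat p d has_real_derivative hat' p d x) (at x)"
  proof cases
    case 1
    have "((\<lambda>x. 0) has_real_derivative 0) (at x)" by simp
    then have "(hat p d has_real_derivative 0) (at x)"
      by (rule has_field_derivative_transform_within_open[of _ _ _ "{..<p - d}"]) (use 1 d in \<open>auto simp: hat_def\<close>)
    then show ?thesis using 1 d by (simp add: hat'_def)
  next
    case 2
    have "((\<lambda>x. d + x - p) has_real_derivative 1) (at x)" by (auto intro!: derivative_eq_intros)
    then have "(hat p d has_real_derivative 1) (at x)"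
      by (rule has_field_derivative_transform_within_open[of _ _ _ "{p - d<..<p}"]) (use 2 d in \<open>auto simp: hat_def\<close>)
    then show ?thesis using 2 d by (simp add: hat'_def)
  next
    case 3
    have "((\<lambda>x. d - x + p) has_real_derivative -1) (at x)" by (auto intro!: derivative_eq_intros)
    then have "(hat p d has_real_derivative -1) (at x)"
      by (rule has_field_derivative_transform_within_open[of _ _ _ "{p<..<p + d}"]) (use 3 d in \<open>auto simp: hat_def\<close>)
    then show ?thesis using 3 d by (simp add: hat'_def)
  next
    case 4
    have "((\<lambda>x. 0) has_real_derivative 0) (at x)" by simp
    then have "(hat p d has_real_derivative 0) (at x)"
      by (rule has_field_derivative_transform_within_open[of _ _ _ "{p + d<..}"]) (use 4 d in \<open>auto simp: hat_def\<close>)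
    then show ?thesis using 4 d by (simp add: hat'_def)
  qed
  then show "(hat p d has_vector_derivative hat' p d x) (at x)"
    by (simp add: has_real_derivative_iff_has_vector_derivative)
qed (use ab in auto)

text \<open>The density of a hat is 1 on its left half and -1 on its right half, so testing with a
  hat amounts to taking a second difference. This is the discrete replacement for the second
  derivative that the minimizer is not yet known to have.\<close>

lemma hat'_pairing:
  fixes h H :: "real \<Rightarrow> real"
  assumes d: "0 < d" "d < pi" and h: "\<And>a b. a \<le> b \<Longrightarrow> (h has_integral H b - H a) {a..b}"
  shows "((\<lambda>x. h x * hat' p d x) has_integral 2 * H p - H (p - d) - H (p + d)) {p - pi..p + pi}"
proof -
  have 1: "((\<lambda>x. if x \<in> {p - d..p} then h x else 0) has_integral H p - H (p - d)) {p - pi..p + pi}"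
    by (subst has_integral_restrict) (use d h in auto)
  have 2: "((\<lambda>x. if x \<in> {p..p + d} then h x else 0) has_integral H (p + d) - H p) {p - pi..p + pi}"
    by (subst has_integral_restrict) (use d h in auto)
  have "((\<lambda>x. h x * hat' p d x) has_integral (H p - H (p - d)) - (H (p + d) - H p)) {p - pi..p + pi}"
    by (rule has_integral_spike_finite[of "{p - d, p, p + d}", OF _ _ has_integral_diff[OF 1 2]])
       (use d in \<open>auto simp: hat'_def\<close>)
  then show ?thesis by (simp add: algebra_simps)
qed

text \<open>One integration by parts moves a derivative onto the hat, and
  \<open>hat'_pairing\<close> accounts for the other: the hat is the kernel that expresses second
  differences through second derivatives.\<close>

lemma hat_integral:
  assumes d: "0 < d" "d < pi"
    and 1: "\<And>x. (\<Phi> has_real_derivative \<Phi>1 x) (at x)" and 2: "\<And>x. (\<Phi>1 has_real_derivative f x) (at x)"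
    and cf: "continuous_on UNIV f"
  shows "integral {p - pi..p + pi} (\<lambda>x. hat p d x * f x) = \<Phi> (p - d) + \<Phi> (p + d) - 2 * \<Phi> p"
proof -
  have hi: "\<And>a b. a \<le> b \<Longrightarrow> (\<Phi>1 has_integral \<Phi> b - \<Phi> a) {a..b}"
    by (rule fundamental_theorem_of_calculus)
       (use 1 in \<open>auto simp: has_real_derivative_iff_has_vector_derivative[symmetric] intro: has_field_derivative_at_within\<close>)
  have hb: "\<bar>hat' p d x\<bar> \<le> 1" for x by (simp add: hat'_def)
  have hm: "hat' p d \<in> borel_measurable lebesgue"
    unfolding hat'_def[abs_def] by (intro measurable_completion) measurable
  have "(\<lambda>x. 1::real) absolutely_integrable_on {p - pi..p + pi}"
    by (intro absolutely_integrable_continuous_real continuous_intros)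
  from abs_int_mult_bounded[OF this _ hm hb]
  have ha: "hat' p d absolutely_integrable_on {p - pi..p + pi}" by simp
  have "integral {p - pi..p + pi} (\<lambda>x. hat p d x * f x)
      = hat p d (p + pi) * \<Phi>1 (p + pi) - hat p d (p - pi) * \<Phi>1 (p - pi) - integral {p - pi..p + pi} (\<lambda>x. hat' p d x * \<Phi>1 x)"
  proof (rule integration_by_parts_ac[OF _ ha])
    show "p - pi \<le> p + pi" using pi_ge_zero by linarith
    fix x assume x: "x \<in> {p - pi..p + pi}"
    show "hat p d x = hat p d (p - pi) + integral {p - pi..x} (hat' p d)"
      using integral_unique[OF hat'_has_integral[OF d(1), of "p - pi" x p]] x by simp
    show "(\<Phi>1 has_real_derivative f x) (at x within {p - pi..p + pi})"
      by (rule has_field_derivative_at_within[OF 2])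
  qed (rule continuous_on_subset[OF cf], simp)
  moreover have "hat p d (p + pi) = 0" "hat p d (p - pi) = 0" using d by (simp_all add: hat_def)
  moreover have "integral {p - pi..p + pi} (\<lambda>x. hat' p d x * \<Phi>1 x) = 2 * \<Phi> p - \<Phi> (p - d) - \<Phi> (p + d)"
    using integral_unique[OF hat'_pairing[OF d hi, of p]] by (simp add: mult.commute)
  ultimately show ?thesis by simp
qed

lemma bounded_ac_hat:
  assumes d: "0 < d" "d < pi"
  shows "bounded_ac (\<lambda>x. hat p d (reduce p x)) (\<lambda>x. hat' p d (reduce p x))"
proof (rule periodic_ext_ac[where B = 1])
  show "hat' p d \<in> borel_measurable borel" unfolding hat'_def[abs_def] by measurable
  show "(hat' p d has_integral hat p d x - hat p d (p - pi)) {p - pi..x}" if "x \<in> {p - pi..p + pi}" for x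
    by (rule hat'_has_integral[OF d(1)]) (use that in simp)
qed (use d in \<open>auto simp: hat_def hat'_def\<close>)

lemma prim_has_deriv:
  assumes c: "continuous_on UNIV k"
  shows "(prim k has_real_derivative k x) (at x)"
proof (rule deriv_of_integral[of "x - 1" x "x + 1" k])
  have ki: "k integrable_on {a..b}" for a b
    by (intro integrable_continuous_real continuous_on_subset[OF c]) auto
  show "prim k y - prim k (x - 1) = integral {x - 1..y} k" if "y \<in> {x - 1..x + 1}" for y
    by (rule prim_diff[OF ki]) (use that in simp)
qed (auto intro: continuous_on_subset[OF c])

text \<open>A maximum principle after subtracting the chord. At the leftmost point where a positive
  maximum is attained, the midpoint identity would force the same height further to the left; the
  negative of the function is treated in the same way.\<close>

lemma midpoint_affine:
  fixes C :: "real \<Rightarrow> real"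
  assumes ab: "a < b" and c: "continuous_on {a..b} C"
    and mid: "\<And>p d. 0 < d \<Longrightarrow> a \<le> p - d \<Longrightarrow> p + d \<le> b \<Longrightarrow> C (p - d) + C (p + d) = 2 * C p"
    and x: "x \<in> {a..b}"
  shows "C x = C a + (C b - C a) / (b - a) * (x - a)"
proof -
  define s where "s = (C b - C a) / (b - a)"
  define D where "D = (\<lambda>x. C x - (C a + s * (x - a)))"
  have Dab: "D a = 0" "D b = 0" using ab by (simp_all add: D_def s_def)
  have cD: "continuous_on {a..b} D" unfolding D_def by (intro continuous_intros c)
  have midD: "D (p - d) + D (p + d) = 2 * D p" if "0 < d" "a \<le> p - d" "p + d \<le> b" for p d
    using mid[OF that] by (simp add: D_def algebra_simps)
  have le: "E x \<le> 0"
    if cE: "continuous_on {a..b} E" and E0: "E a = 0" "E b = 0"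
      and midE: "\<And>p d. 0 < d \<Longrightarrow> a \<le> p - d \<Longrightarrow> p + d \<le> b \<Longrightarrow> E (p - d) + E (p + d) = 2 * E p" and x: "x \<in> {a..b}" for E :: "real \<Rightarrow> real" and x
  proof (rule ccontr)
    assume "\<not> E x \<le> 0"
    then have Ex: "E x > 0" by simp
    obtain m where m: "m \<in> {a..b}" "\<And>y. y \<in> {a..b} \<Longrightarrow> E y \<le> E m"
      using continuous_attains_sup[OF compact_Icc _ cE] x by blast
    define S where "S = {a..b} \<inter> E -` {E m}"
    have clS: "closed S" unfolding S_def by (rule continuous_closed_preimage[OF cE]) auto
    have neS: "S \<noteq> {}" using m by (auto simp: S_def)
    have bdS: "bdd_below S" by (auto simp: S_def)
    define p where "p = Inf S"
    have pS: "p \<in> S" unfolding p_def by (rule closed_contains_Inf[OF neS bdS clS])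
    have Ep: "E p = E m" "p \<in> {a..b}" using pS by (auto simp: S_def)
    have "E m > 0" using m(2)[OF x] Ex by linarith
    then have "p \<noteq> a" "p \<noteq> b" using Ep E0 by auto
    then have pab: "a < p" "p < b" using Ep by auto
    \<comment> \<open>The largest symmetric neighbourhood of \<open>p\<close> inside the
      interval.\<close>
    define d where "d = min (p - a) (b - p)"
    have d: "0 < d" "a \<le> p - d" "p + d \<le> b" using pab by (auto simp: d_def)
    have "E (p - d) + E (p + d) = 2 * E m" using midE[OF d] Ep by simp
    moreover have "E (p - d) \<le> E m" "E (p + d) \<le> E m" using m(2) d by auto
    ultimately have "E (p - d) = E m" by linarith
    then have "p - d \<in> S" using d by (auto simp: S_def)
    then have "p \<le> p - d" unfolding p_def by (rule cInf_lower[OF _ bdS])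
    then show False using d by simp
  qed
  have "D x \<le> 0" by (rule le[OF cD Dab midD x])
  moreover have "- D x \<le> 0"
  proof (rule le[of "\<lambda>x. - D x"])
    show "continuous_on {a..b} (\<lambda>x. - D x)" by (intro continuous_intros cD)
    show "- D (p - d) + - D (p + d) = 2 * - D p" if "0 < d" "a \<le> p - d" "p + d \<le> b" for p d
      using midD[OF that] by linarith
  qed (use Dab x in auto)
  ultimately show ?thesis by (simp add: D_def s_def)
qed


section \<open>Multiplier, free boundary and regularity of the minimizer\<close>

context minimizer
begin

lemma hat_bounds: "0 < d \<Longrightarrow> 0 \<le> hat p d x" "0 < d \<Longrightarrow> hat p d x \<le> d"
  by (auto simp: hat_def)

lemma hat_ints:
  assumes d: "0 < d" "d < pi"
  shows "integral period (\<lambda>x. hat p d (reduce p x)) = d\<^sup>2"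
    and "L (\<lambda>x. hat p d (reduce p x)) (\<lambda>x. hat' p d (reduce p x))
      = 2 * U p - U (p - d) - U (p + d) - integral {p - pi..p + pi} (\<lambda>x. hat p d x * (\<alpha>\<^sup>2 * U x + cos x))"
proof -
  note bac = bounded_ac_hat[OF d, of p]
  have cH: "continuous_on A (\<lambda>x. hat p d (reduce p x))" for A
    using bac ac_continuous unfolding bounded_ac_def by blast
  have e: "hat p d (reduce p x) = hat p d x" "hat' p d (reduce p x) = hat' p d x" if "x \<in> {p - pi..p + pi}" for x
    by (rule periodic_ext_eq[OF _ that]; use d in \<open>simp add: hat_def hat'_def\<close>)+
  have "integral period (\<lambda>x. hat p d (reduce p x)) = integral {p - pi..p + pi} (\<lambda>x. hat p d x * 1)"
    by (rule periodic_ext_integral[OF periodic_compose_reduce absolutely_integrable_continuous_real[OF cH]]) (simp add: e)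
  also have "\<dots> = (p - d)\<^sup>2 / 2 + (p + d)\<^sup>2 / 2 - 2 * (p\<^sup>2 / 2)"
    by (rule hat_integral[OF d, of "\<lambda>x. x\<^sup>2 / 2" "\<lambda>x. x"]) (auto intro!: derivative_eq_intros continuous_intros)
  also have "\<dots> = d\<^sup>2" by (simp add: power2_eq_square field_simps)
  finally show "integral period (\<lambda>x. hat p d (reduce p x)) = d\<^sup>2" .
  define H where "H = (\<lambda>x. g x * hat' p d (reduce p x) - \<alpha>\<^sup>2 * (U x * hat p d (reduce p x)) - hat p d (reduce p x) * cos x)"
  have Hp: "circle_periodic H"
    using acD(2)[OF a] perU periodic_compose_reduce[of "hat p d" p] periodic_compose_reduce[of "hat' p d" p]
    by (simp add: H_def circle_periodic_def)
  have "(\<lambda>x. \<alpha>\<^sup>2 * (U x * hat p d (reduce p x)) + hat p d (reduce p x) * cos x) absolutely_integrable_on period"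
    by (intro absolutely_integrable_continuous_real continuous_intros contU cH)
  from set_integral_diff(1)[OF bounded_ac_ints(1)[OF bac acD(3)[OF a]] this]
  have Hi: "H absolutely_integrable_on period" by (simp add: H_def algebra_simps)
  have "L (\<lambda>x. hat p d (reduce p x)) (\<lambda>x. hat' p d (reduce p x)) = integral period H" by (simp add: L_def H_def)
  also have "\<dots> = integral {p - pi..p + pi} (\<lambda>x. g x * hat' p d x - hat p d x * (\<alpha>\<^sup>2 * U x + cos x))"
    by (rule periodic_ext_integral[OF Hp Hi]) (simp add: H_def e algebra_simps)
  also have "\<dots> = (2 * U p - U (p - d) - U (p + d)) - integral {p - pi..p + pi} (\<lambda>x. hat p d x * (\<alpha>\<^sup>2 * U x + cos x))"
  proof (rule integral_unique, rule has_integral_diff)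
    show "((\<lambda>x. g x * hat' p d x) has_integral 2 * U p - U (p - d) - U (p + d)) {p - pi..p + pi}"
    proof (rule hat'_pairing[OF d])
      fix a' b :: real assume "a' \<le> b"
      then show "(g has_integral U b - U a') {a'..b}"
        using acD(4,5)[OF a] integrable_integral by metis
    qed
    show "((\<lambda>x. hat p d x * (\<alpha>\<^sup>2 * U x + cos x)) has_integral integral {p - pi..p + pi} (\<lambda>x. hat p d x * (\<alpha>\<^sup>2 * U x + cos x))) {p - pi..p + pi}"
      unfolding hat_def by (intro integrable_integral integrable_continuous_real continuous_intros contU)
  qed
  finally show "L (\<lambda>x. hat p d (reduce p x)) (\<lambda>x. hat' p d (reduce p x))
      = 2 * U p - U (p - d) - U (p + d) - integral {p - pi..p + pi} (\<lambda>x. hat p d x * (\<alpha>\<^sup>2 * U x + cos x))" .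
qed

lemma positive_floor:
  assumes "d < pi" "\<And>x. x \<in> {p - d..p + d} \<Longrightarrow> U x > 0"
  obtains \<epsilon> where "\<epsilon> > 0" "\<And>x. hat p d (reduce p x) > 0 \<Longrightarrow> U x \<ge> \<epsilon>"
proof (cases "0 \<le> d")
  case True
  obtain m where m: "m \<in> {p - d..p + d}" "\<And>y. y \<in> {p - d..p + d} \<Longrightarrow> U m \<le> U y"
    using continuous_attains_inf[OF compact_Icc _ contU, of "p - d" "p + d"] True by auto
  show ?thesis
  proof (rule that[of "U m"])
    show "U m > 0" using assms m by blast
    fix x assume "hat p d (reduce p x) > 0"
    then have "reduce p x \<in> {p - d..p + d}" by (auto simp: hat_def max_def split: if_splits)
    then have "U m \<le> U (reduce p x)" by (rule m(2))
    then show "U m \<le> U x" using periodic_reduce[OF perU] by simp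
  qed
next
  case False
  then show ?thesis by (intro that[of 1]) (auto simp: hat_def max_def split: if_splits)
qed

text \<open>A hat of half-width \<open>d\<close> has mass \<open>d\<^sup>2\<close>, so it is
  balanced by a fixed hat inside the positivity set, scaled by
  \<open>d\<^sup>2 / d0\<^sup>2\<close>. Adding mass is allowed anywhere, which gives the
  inequality; where \<open>U\<close> is positive on the support, mass can also be removed, which
  gives equality.\<close>

lemma multiplier:
  obtains \<kappa> where
    "\<And>p d. 0 < d \<Longrightarrow> d < pi \<Longrightarrow> L (\<lambda>x. hat p d (reduce p x)) (\<lambda>x. hat' p d (reduce p x)) + \<kappa> * d\<^sup>2 \<ge> 0"
    "\<And>p d. 0 < d \<Longrightarrow> d < pi \<Longrightarrow> (\<And>x. x \<in> {p - d..p + d} \<Longrightarrow> U x > 0) \<Longrightarrow>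
       L (\<lambda>x. hat p d (reduce p x)) (\<lambda>x. hat' p d (reduce p x)) + \<kappa> * d\<^sup>2 = 0"
proof -
  have "\<exists>p0. U p0 > 0"
  proof (rule ccontr)
    assume "\<nexists>p0. U p0 > 0"
    then have "U = (\<lambda>x. 0)" using nonneg by (auto simp: not_less intro!: ext antisym)
    then have "integral period U = 0" by simp
    then show False using mass M by simp
  qed
  then obtain p0 where p0: "U p0 > 0" by blast
  have "open {x. U x > 0}" using contU by (intro open_Collect_less continuous_intros)
  then obtain e where e: "e > 0" "\<And>x. \<bar>x - p0\<bar> < e \<Longrightarrow> U x > 0"
    using p0 unfolding open_dist by (auto simp: dist_real_def)
  define d0 where "d0 = min e pi / 2"
  have d0: "0 < d0" "d0 < pi" "d0 < e" using e pi_gt_zero by (auto simp: d0_def min_def)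
  define \<eta>0 k0 where "\<eta>0 = (\<lambda>x. hat p0 d0 (reduce p0 x))" and "k0 = (\<lambda>x. hat' p0 d0 (reduce p0 x))"
  have "U x > 0" if "x \<in> {p0 - d0..p0 + d0}" for x by (rule e(2)) (use that d0 in auto)
  then obtain \<epsilon>0 where \<epsilon>0: "\<epsilon>0 > 0" "\<And>x. \<eta>0 x > 0 \<Longrightarrow> U x \<ge> \<epsilon>0"
    unfolding \<eta>0_def using positive_floor[OF d0(2), of p0] by blast
  have b0: "bounded_ac \<eta>0 k0" unfolding \<eta>0_def k0_def by (rule bounded_ac_hat[OF d0(1,2)])
  have bd0: "0 \<le> \<eta>0 x" "\<eta>0 x \<le> d0" for x unfolding \<eta>0_def using hat_bounds[OF d0(1)] by auto
  \<comment> \<open>Minus the first variation of the reference hat per unit of its mass.\<close>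
  define \<kappa> where "\<kappa> = - L \<eta>0 k0 / d0\<^sup>2"
  have main: "L (\<lambda>x. \<eta> x + (- (d\<^sup>2 / d0\<^sup>2)) * \<eta>0 x) (\<lambda>x. k x + (- (d\<^sup>2 / d0\<^sup>2)) * k0 x) = L \<eta> k + \<kappa> * d\<^sup>2"
    "bounded_ac (\<lambda>x. \<eta> x + (- (d\<^sup>2 / d0\<^sup>2)) * \<eta>0 x) (\<lambda>x. k x + (- (d\<^sup>2 / d0\<^sup>2)) * k0 x)"
    "integral period (\<lambda>x. \<eta> x + (- (d\<^sup>2 / d0\<^sup>2)) * \<eta>0 x) = 0"
    "\<bar>\<eta> x + (- (d\<^sup>2 / d0\<^sup>2)) * \<eta>0 x\<bar> \<le> d + d\<^sup>2 / d0\<^sup>2 * d0"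
    if d: "0 < d" "d < pi" and \<eta>: "\<eta> = (\<lambda>x. hat p d (reduce p x))" and k: "k = (\<lambda>x. hat' p d (reduce p x))" for \<eta> k p d x
  proof -
    have b: "bounded_ac \<eta> k" unfolding \<eta> k by (rule bounded_ac_hat[OF d])
    show "L (\<lambda>x. \<eta> x + (- (d\<^sup>2 / d0\<^sup>2)) * \<eta>0 x) (\<lambda>x. k x + (- (d\<^sup>2 / d0\<^sup>2)) * k0 x) = L \<eta> k + \<kappa> * d\<^sup>2"
      unfolding L_lincomb[OF b b0] by (simp add: \<kappa>_def)
    show "bounded_ac (\<lambda>x. \<eta> x + (- (d\<^sup>2 / d0\<^sup>2)) * \<eta>0 x) (\<lambda>x. k x + (- (d\<^sup>2 / d0\<^sup>2)) * k0 x)"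
      by (rule bounded_ac_lincomb[OF b b0])
    have c: "\<eta> integrable_on period" "\<eta>0 integrable_on period"
      using b b0 ac_continuous integrable_continuous_real unfolding bounded_ac_def by blast+
    have "((\<lambda>x. \<eta> x + (- (d\<^sup>2 / d0\<^sup>2)) * \<eta>0 x) has_integral integral period \<eta> + (- (d\<^sup>2 / d0\<^sup>2)) * integral period \<eta>0) period"
      by (intro has_integral_add has_integral_mult_right integrable_integral c)
    moreover have "integral period \<eta> = d\<^sup>2" "integral period \<eta>0 = d0\<^sup>2"
      unfolding \<eta> \<eta>0_def using hat_ints(1)[OF d] hat_ints(1)[OF d0(1,2)] by auto
    ultimately show "integral period (\<lambda>x. \<eta> x + (- (d\<^sup>2 / d0\<^sup>2)) * \<eta>0 x) = 0"
      using d0 by (simp add: integral_unique)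
    have "0 \<le> \<eta> x" "\<eta> x \<le> d" unfolding \<eta> using hat_bounds[OF d(1)] by auto
    moreover have "0 \<le> d\<^sup>2 / d0\<^sup>2 * \<eta>0 x" "d\<^sup>2 / d0\<^sup>2 * \<eta>0 x \<le> d\<^sup>2 / d0\<^sup>2 * d0"
      using bd0[of x] by (intro mult_nonneg_nonneg mult_left_mono; simp)+
    ultimately show "\<bar>\<eta> x + (- (d\<^sup>2 / d0\<^sup>2)) * \<eta>0 x\<bar> \<le> d + d\<^sup>2 / d0\<^sup>2 * d0" by linarith
  qed
  have ge: "L (\<lambda>x. hat p d (reduce p x)) (\<lambda>x. hat' p d (reduce p x)) + \<kappa> * d\<^sup>2 \<ge> 0"
    if d: "0 < d" "d < pi" for p d
  proof -
    note m = main[OF d refl refl, of p]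
    have "L (\<lambda>x. hat p d (reduce p x) + (- (d\<^sup>2 / d0\<^sup>2)) * \<eta>0 x) (\<lambda>x. hat' p d (reduce p x) + (- (d\<^sup>2 / d0\<^sup>2)) * k0 x) \<ge> 0"
    proof (rule first_variation[OF m(2,3,4) \<epsilon>0(1)])
      fix x assume "hat p d (reduce p x) + (- (d\<^sup>2 / d0\<^sup>2)) * \<eta>0 x < 0"
      then have "\<eta>0 x \<noteq> 0" using hat_bounds[OF d(1), of p "reduce p x"] by auto
      then have "\<eta>0 x > 0" using bd0[of x] by simp
      then show "\<epsilon>0 \<le> U x" by (rule \<epsilon>0(2))
    qed
    then show ?thesis unfolding m(1) .
  qed
  have le: "L (\<lambda>x. hat p d (reduce p x)) (\<lambda>x. hat' p d (reduce p x)) + \<kappa> * d\<^sup>2 \<le> 0"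
    if d: "0 < d" "d < pi" and pos: "\<And>x. x \<in> {p - d..p + d} \<Longrightarrow> U x > 0" for p d
  proof -
    note m = main[OF d refl refl, of p]
    obtain \<epsilon> where \<epsilon>: "\<epsilon> > 0" "\<And>x. hat p d (reduce p x) > 0 \<Longrightarrow> U x \<ge> \<epsilon>"
      using positive_floor[OF d(2) pos] by blast
    have "L (\<lambda>x. - (hat p d (reduce p x) + (- (d\<^sup>2 / d0\<^sup>2)) * \<eta>0 x)) (\<lambda>x. - (hat' p d (reduce p x) + (- (d\<^sup>2 / d0\<^sup>2)) * k0 x)) \<ge> 0"
    proof (rule first_variation[OF bounded_ac_uminus[OF m(2)] _ _ \<epsilon>(1)])
      show "integral period (\<lambda>x. - (hat p d (reduce p x) + (- (d\<^sup>2 / d0\<^sup>2)) * \<eta>0 x)) = 0" unfolding integral_neg m(3) by simp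
      show "\<bar>- (hat p d (reduce p x) + (- (d\<^sup>2 / d0\<^sup>2)) * \<eta>0 x)\<bar> \<le> d + d\<^sup>2 / d0\<^sup>2 * d0" for x
        unfolding abs_minus_cancel by (rule m(4))
      fix x assume neg: "- (hat p d (reduce p x) + (- (d\<^sup>2 / d0\<^sup>2)) * \<eta>0 x) < 0"
      have "0 \<le> d\<^sup>2 / d0\<^sup>2 * \<eta>0 x" using bd0 by (intro mult_nonneg_nonneg) auto
      then have "hat p d (reduce p x) > 0" using neg by linarith
      then show "\<epsilon> \<le> U x" by (rule \<epsilon>(2))
    qed
    then show ?thesis unfolding L_uminus[OF m(2)] m(1) by simp
  qed
  show ?thesis by (rule that[of \<kappa>]) (use ge le in \<open>auto intro: antisym\<close>)
qed

text \<open>Let \<open>\<Phi>\<close> be a second primitive of the right-hand side \<open>f\<close>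
  and \<open>C\<close> the difference of \<open>U\<close> and \<open>\<Phi>\<close>. The multiplier
  conditions say that second differences of \<open>C\<close> are nowhere positive, and are zero over
  positivity intervals. There \<open>C\<close> is affine and the equation holds classically. At a
  zero of \<open>U\<close> the one-sided bound, together with \<open>U\<close> being nonnegative,
  forces quadratic growth. The derivative is therefore zero there, and a Lipschitz argument shows
  that it also tends to zero.\<close>

lemma minimizer_steady: "\<exists>\<kappa>. steady \<alpha> U (deriv U) (\<lambda>x. \<kappa>)"
proof -
  obtain \<kappa> where ge: "\<And>p d. 0 < d \<Longrightarrow> d < pi \<Longrightarrow> L (\<lambda>x. hat p d (reduce p x)) (\<lambda>x. hat' p d (reduce p x)) + \<kappa> * d\<^sup>2 \<ge> 0"
    and eq: "\<And>p d. 0 < d \<Longrightarrow> d < pi \<Longrightarrow> (\<And>x. x \<in> {p - d..p + d} \<Longrightarrow> U x > 0) \<Longrightarrow>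
       L (\<lambda>x. hat p d (reduce p x)) (\<lambda>x. hat' p d (reduce p x)) + \<kappa> * d\<^sup>2 = 0"
    using multiplier by blast
  define f where "f = (\<lambda>x. \<kappa> - \<alpha>\<^sup>2 * U x - cos x)"
  have cf: "continuous_on A f" for A unfolding f_def by (intro continuous_intros contU)
  define \<Phi>1 where "\<Phi>1 = prim f"
  define \<Phi> where "\<Phi> = prim \<Phi>1"
  have D1: "(\<Phi>1 has_real_derivative f x) (at x)" for x unfolding \<Phi>1_def by (rule prim_has_deriv[OF cf])
  have c\<Phi>1: "continuous_on A \<Phi>1" for A by (meson D1 DERIV_isCont continuous_at_imp_continuous_on)
  have D0: "(\<Phi> has_real_derivative \<Phi>1 x) (at x)" for x unfolding \<Phi>_def by (rule prim_has_deriv[OF c\<Phi>1])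
  have c\<Phi>: "continuous_on A \<Phi>" for A by (meson D0 DERIV_isCont continuous_at_imp_continuous_on)
  define C where "C = (\<lambda>x. U x - \<Phi> x)"
  have key: "L (\<lambda>x. hat p d (reduce p x)) (\<lambda>x. hat' p d (reduce p x)) + \<kappa> * d\<^sup>2 = 2 * C p - C (p - d) - C (p + d)"
    if d: "0 < d" "d < pi" for p d
  proof -
    have ch: "continuous_on A (hat p d)" for A unfolding hat_def[abs_def] by (intro continuous_intros)
    have "integral {p - pi..p + pi} (\<lambda>x. hat p d x * 1) = (p - d)\<^sup>2 / 2 + (p + d)\<^sup>2 / 2 - 2 * (p\<^sup>2 / 2)"
      by (rule hat_integral[OF d, of "\<lambda>x. x\<^sup>2 / 2" "\<lambda>x. x"]) (auto intro!: derivative_eq_intros continuous_intros)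
    then have 1: "integral {p - pi..p + pi} (hat p d) = d\<^sup>2" by (simp add: power2_eq_square field_simps)
    have "integral {p - pi..p + pi} (\<lambda>x. hat p d x * f x) = \<Phi> (p - d) + \<Phi> (p + d) - 2 * \<Phi> p"
      by (rule hat_integral[OF d D0 D1 cf])
    moreover have "integral {p - pi..p + pi} (\<lambda>x. hat p d x * f x)
        = integral {p - pi..p + pi} (\<lambda>x. \<kappa> * hat p d x - hat p d x * (\<alpha>\<^sup>2 * U x + cos x))"
      by (simp add: f_def algebra_simps)
    moreover have "\<dots> = \<kappa> * integral {p - pi..p + pi} (hat p d) - integral {p - pi..p + pi} (\<lambda>x. hat p d x * (\<alpha>\<^sup>2 * U x + cos x))"
    proof -
      have "(\<lambda>x. \<kappa> * hat p d x) integrable_on {p - pi..p + pi}" "(\<lambda>x. hat p d x * (\<alpha>\<^sup>2 * U x + cos x)) integrable_on {p - pi..p + pi}"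
        by (intro integrable_continuous_real continuous_intros ch contU)+
      then show ?thesis by (simp add: integral_diff)
    qed
    ultimately show ?thesis using hat_ints(2)[OF d, of p] 1 by (simp add: C_def)
  qed
  obtain K where K: "\<And>x. \<bar>f x\<bar> \<le> K"
  proof -
    have "bounded (f ` period)" by (intro compact_imp_bounded compact_continuous_image cf) auto
    then obtain B where "\<forall>x\<in>period. \<bar>f x\<bar> \<le> B" by (auto simp: bounded_iff)
    then have B: "\<And>x. x \<in> period \<Longrightarrow> \<bar>f x\<bar> \<le> B" by blast
    have "circle_periodic f" using perU by (simp add: f_def circle_periodic_def)
    then have "f x = f (reduce 0 x)" for x using periodic_reduce by metis
    then have "\<bar>f x\<bar> \<le> B" for x using B[of "reduce 0 x"] reduce_bounds[of 0 x] by simp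
    then show ?thesis using that by blast
  qed
  have K0: "K \<ge> 0" using K[of 0] by linarith
  \<comment> \<open>Two mean value steps; the intermediate points are less than \<open>2 * d\<close>
    apart, which explains the factor 2.\<close>
  have second: "\<Phi> (p - d) + \<Phi> (p + d) - 2 * \<Phi> p \<le> 2 * K * d\<^sup>2" if d: "0 < d" for p d
  proof -
    obtain x where x: "p < x" "x < p + d" "\<Phi> (p + d) - \<Phi> p = (p + d - p) * \<Phi>1 x"
      using MVT2[of p "p + d" \<Phi> \<Phi>1] d D0 by auto
    obtain y where y: "p - d < y" "y < p" "\<Phi> p - \<Phi> (p - d) = (p - (p - d)) * \<Phi>1 y"
      using MVT2[of "p - d" p \<Phi> \<Phi>1] d D0 by auto
    obtain z where z: "y < z" "z < x" "\<Phi>1 x - \<Phi>1 y = (x - y) * f z"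
      using MVT2[of y x \<Phi>1 f] x y D1 by auto
    have "(x - y) * f z \<le> (x - y) * K"
      using x y z K[of z] by (intro mult_left_mono) (auto simp: abs_le_iff)
    also have "\<dots> \<le> (2 * d) * K" using x y K0 by (intro mult_right_mono) auto
    finally have "(x - y) * f z \<le> (2 * d) * K" .
    then have "d * ((x - y) * f z) \<le> d * (2 * d * K)" using d by (intro mult_left_mono) auto
    moreover have "\<Phi> (p - d) + \<Phi> (p + d) - 2 * \<Phi> p = d * (\<Phi>1 x - \<Phi>1 y)"
      using x(3) y(3) by (simp add: algebra_simps)
    ultimately show ?thesis using z(3) by (simp add: power2_eq_square algebra_simps)
  qed
  \<comment> \<open>The second difference at a zero is a sum of two nonnegative values, so its upper
    bound applies to each of them.\<close>
  have zero_bd: "U y \<le> 2 * K * (y - z)\<^sup>2" if z: "U z = 0" and y: "\<bar>y - z\<bar> < pi" for y z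
  proof (cases "y = z")
    case False
    define d where "d = \<bar>y - z\<bar>"
    have d: "0 < d" "d < pi" using False y by (auto simp: d_def)
    have "0 \<le> 2 * C z - C (z - d) - C (z + d)" using ge[OF d, of z] key[OF d, of z] by simp
    then have "U (z - d) + U (z + d) \<le> 2 * K * d\<^sup>2" using second[OF d(1), of z] z by (simp add: C_def)
    moreover have "y = z - d \<or> y = z + d" by (auto simp: d_def)
    ultimately have "U y \<le> 2 * K * d\<^sup>2" using nonneg[of "z - d"] nonneg[of "z + d"] by auto
    then show ?thesis by (simp add: d_def)
  qed (simp add: z)
  have Dz: "(U has_real_derivative 0) (at z)" if z: "U z = 0" for z
  proof -
    have "((\<lambda>y. (U y - U z) / (y - z)) \<longlongrightarrow> 0) (at z)"
    proof (rule Lim_null_comparison)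
      show "((\<lambda>y. 2 * K * \<bar>y - z\<bar>) \<longlongrightarrow> 0) (at z)" by (auto intro!: tendsto_eq_intros)
      have "\<forall>\<^sub>F y in at z. \<bar>y - z\<bar> < pi"
        unfolding eventually_at dist_real_def by (rule exI[of _ pi]) simp
      then show "\<forall>\<^sub>F y in at z. norm ((U y - U z) / (y - z)) \<le> 2 * K * \<bar>y - z\<bar>"
      proof eventually_elim
        case (elim y)
        have *: "U y \<le> 2 * K * \<bar>y - z\<bar> * \<bar>y - z\<bar>" using zero_bd[OF z elim] by (simp add: power2_eq_square mult.assoc)
        show ?case
        proof (cases "y = z")
          case False
          then have "\<bar>y - z\<bar> > 0" by simp
          then show ?thesis using * nonneg[of y] z by (simp add: pos_divide_le_eq)
        qed simp
      qed
    qed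
    then show ?thesis by (simp add: has_field_derivative_iff)
  qed
  have loc: "\<exists>e B. e > 0 \<and> (\<forall>x. \<bar>x - x0\<bar> < e \<longrightarrow> (U has_real_derivative \<Phi>1 x + B) (at x))" if x0: "U x0 > 0" for x0
  proof -
    have "open {x. U x > 0}" using contU by (intro open_Collect_less continuous_intros)
    then obtain e0 where e0: "e0 > 0" "\<And>x. \<bar>x - x0\<bar> < e0 \<Longrightarrow> U x > 0"
      using x0 unfolding open_dist by (auto simp: dist_real_def)
    define e where "e = min e0 pi / 2"
    have e: "0 < e" "e < pi" "e < e0" using e0 pi_gt_zero by (auto simp: e_def min_def)
    define B where "B = (C (x0 + e) - C (x0 - e)) / ((x0 + e) - (x0 - e))"
    have aff: "C x = C (x0 - e) + B * (x - (x0 - e))" if "x \<in> {x0 - e..x0 + e}" for x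
      unfolding B_def
    proof (rule midpoint_affine[OF _ _ _ that])
      show "continuous_on {x0 - e..x0 + e} C" unfolding C_def by (intro continuous_intros contU c\<Phi>)
      fix p d :: real assume d: "0 < d" "x0 - e \<le> p - d" "p + d \<le> x0 + e"
      have d': "d < pi" using d e by linarith
      have "U x > 0" if "x \<in> {p - d..p + d}" for x by (rule e0(2)) (use that d e in auto)
      from eq[OF d(1) d' this] show "C (p - d) + C (p + d) = 2 * C p" using key[OF d(1) d', of p] by simp
    qed (use e in simp)
    have "(U has_real_derivative \<Phi>1 x + B) (at x)" if x: "\<bar>x - x0\<bar> < e" for x
    proof -
      have "((\<lambda>x. \<Phi> x + (C (x0 - e) + B * (x - (x0 - e)))) has_real_derivative \<Phi>1 x + B) (at x)"
        using D0[of x] by (auto intro!: derivative_eq_intros)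
      then show ?thesis
      proof (rule has_field_derivative_transform_within_open[of _ _ _ "{x0 - e<..<x0 + e}"])
        fix y assume "y \<in> {x0 - e<..<x0 + e}"
        then show "\<Phi> y + (C (x0 - e) + B * (y - (x0 - e))) = U y" using aff[of y] by (simp add: C_def)
      qed (use x in \<open>auto simp: abs_less_iff\<close>)
    qed
    then show ?thesis using e by blast
  qed
  have dU: "(U has_real_derivative deriv U x) (at x)" for x
  proof (cases "U x = 0")
    case True
    then show ?thesis using Dz[OF True] DERIV_imp_deriv[OF Dz[OF True]] by simp
  next
    case False
    then have "U x > 0" using nonneg[of x] by simp
    from loc[OF this] obtain e B where "e > 0" "\<And>y. \<bar>y - x\<bar> < e \<Longrightarrow> (U has_real_derivative \<Phi>1 y + B) (at y)" by blast
    then have D: "(U has_real_derivative \<Phi>1 x + B) (at x)" by simp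
    show ?thesis using D DERIV_imp_deriv[OF D] by simp
  qed
  have dz0: "deriv U z = 0" if "U z = 0" for z using DERIV_imp_deriv[OF Dz[OF that]] .
  have dU1: "(deriv U has_real_derivative f x) (at x)" if x: "U x > 0" for x
  proof -
    obtain e B where e: "e > 0" "\<And>y. \<bar>y - x\<bar> < e \<Longrightarrow> (U has_real_derivative \<Phi>1 y + B) (at y)" using loc[OF x] by blast
    have "((\<lambda>y. \<Phi>1 y + B) has_real_derivative f x) (at x)" using D1[of x] by (auto intro!: derivative_eq_intros)
    then show ?thesis
      by (rule has_field_derivative_transform_within_open[of _ _ _ "ball x e"])
         (use e DERIV_imp_deriv[OF e(2)] in \<open>simp_all add: dist_real_def abs_minus_commute\<close>)
  qed
  have lip: "\<bar>deriv U x - deriv U y\<bar> \<le> K * \<bar>x - y\<bar>" if pos: "\<And>t. t \<in> closed_segment x y \<Longrightarrow> U t > 0" for x y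
  proof -
    have "norm (deriv U x - deriv U y) \<le> K * norm (x - y)"
      by (rule field_differentiable_bound[of "closed_segment x y" "deriv U" f])
         (use dU1 pos K in \<open>auto intro: has_field_derivative_at_within\<close>)
    then show ?thesis by simp
  qed
  \<comment> \<open>Quadratic growth gives some interior point with derivative at most
    \<open>2 * K * (b - c)\<close>; the Lipschitz bound \<open>K\<close> carries this to the
    endpoint \<open>x\<close>, whence the factor 3.\<close>
  have edge: "\<bar>deriv U x\<bar> \<le> 3 * K * (b - c)"
    if ab: "c < b" "b - c < pi" and pos: "\<And>t. c < t \<Longrightarrow> t < b \<Longrightarrow> U t > 0"
      and x: "(x = b \<and> U c = 0) \<or> (x = c \<and> U b = 0)" and Ux: "U x > 0" for b c x
  proof -
    obtain \<xi> where \<xi>: "c < \<xi>" "\<xi> < b" "U b - U c = (b - c) * deriv U \<xi>"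
      using MVT2[OF ab(1), of U "deriv U"] dU by auto
    have "\<bar>U b - U c\<bar> \<le> 2 * K * (b - c)\<^sup>2"
      using x
    proof
      assume "x = b \<and> U c = 0"
      then show ?thesis using zero_bd[of c b] ab nonneg[of b] by simp
    next
      assume "x = c \<and> U b = 0"
      then show ?thesis using zero_bd[of b c] ab nonneg[of c] power2_commute[of b c] by simp
    qed
    moreover have "\<bar>U b - U c\<bar> = (b - c) * \<bar>deriv U \<xi>\<bar>" using \<xi>(3) ab by (simp add: abs_mult)
    moreover have "2 * K * (b - c)\<^sup>2 = (b - c) * (2 * K * (b - c))" by (simp add: power2_eq_square)
    ultimately have "(b - c) * \<bar>deriv U \<xi>\<bar> \<le> (b - c) * (2 * K * (b - c))" by linarith
    then have 1: "\<bar>deriv U \<xi>\<bar> \<le> 2 * K * (b - c)" by (rule mult_left_le_imp_le) (use ab in simp)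
    have "U t > 0" if "t \<in> closed_segment x \<xi>" for t
    proof (cases "t = x")
      case False
      have "min x \<xi> \<le> t" "t \<le> max x \<xi>"
        using that by (auto simp: closed_segment_eq_real_ivl split: if_splits)
      moreover have "x = b \<or> x = c" using x by blast
      ultimately have "c < t" "t < b" using \<xi>(1,2) False by (auto simp: min_def max_def split: if_splits)
      then show ?thesis by (rule pos)
    qed (use Ux in simp)
    then have "\<bar>deriv U x - deriv U \<xi>\<bar> \<le> K * \<bar>x - \<xi>\<bar>" by (rule lip)
    also have "\<dots> \<le> K * (b - c)" using x \<xi> K0 by (intro mult_left_mono) auto
    finally have "\<bar>deriv U x - deriv U \<xi>\<bar> \<le> K * (b - c)" .
    moreover have "3 * K * (b - c) = 2 * K * (b - c) + K * (b - c)" by (simp add: algebra_simps)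
    ultimately show ?thesis using 1 by linarith
  qed
  \<comment> \<open>\<open>edge\<close> needs positivity up to the zero, so \<open>z\<close> is
    replaced by the zero nearest to \<open>x\<close> on the same side, which only shortens the
    distance.\<close>
  have near: "\<bar>deriv U x\<bar> \<le> 3 * K * \<bar>x - z\<bar>" if z: "U z = 0" and x: "\<bar>x - z\<bar> < pi" for x z
  proof (cases "U x = 0")
    case True
    then show ?thesis using dz0 K0 by simp
  next
    case False
    then have Ux: "U x > 0" using nonneg[of x] by simp
    have "x \<noteq> z" using z False by auto
    then consider "z < x" | "x < z" by linarith
    then show ?thesis
    proof cases
      case 1
      define Z where "Z = {z..x} \<inter> U -` {0}"
      have cl: "closed Z" unfolding Z_def by (intro continuous_closed_preimage contU; simp)
      have zZ: "z \<in> Z" using z 1 by (simp add: Z_def)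
      have bd: "bdd_above Z" by (auto simp: Z_def)
      define s where "s = Sup Z"
      have s: "s \<in> Z" unfolding s_def by (rule closed_contains_Sup[OF _ bd cl]) (use zZ in auto)
      have sz: "z \<le> s" "s < x" "U s = 0" using s Ux by (auto simp: Z_def less_le)
      have pos: "U t > 0" if "s < t" "t < x" for t
      proof (rule ccontr)
        assume "\<not> U t > 0"
        then have "t \<in> Z" using nonneg[of t] that sz by (auto simp: Z_def)
        then show False using cSup_upper[OF _ bd, of t] that by (simp add: s_def)
      qed
      have "\<bar>deriv U x\<bar> \<le> 3 * K * (x - s)" by (rule edge[OF _ _ pos _ Ux]) (use sz x 1 in auto)
      also have "\<dots> \<le> 3 * K * \<bar>x - z\<bar>" using sz K0 by (intro mult_left_mono) auto
      finally show ?thesis .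
    next
      case 2
      define Z where "Z = {x..z} \<inter> U -` {0}"
      have cl: "closed Z" unfolding Z_def by (intro continuous_closed_preimage contU; simp)
      have zZ: "z \<in> Z" using z 2 by (simp add: Z_def)
      have bd: "bdd_below Z" by (auto simp: Z_def)
      define s where "s = Inf Z"
      have s: "s \<in> Z" unfolding s_def by (rule closed_contains_Inf[OF _ bd cl]) (use zZ in auto)
      have sz: "s \<le> z" "x < s" "U s = 0" using s Ux by (auto simp: Z_def less_le)
      have pos: "U t > 0" if "x < t" "t < s" for t
      proof (rule ccontr)
        assume "\<not> U t > 0"
        then have "t \<in> Z" using nonneg[of t] that sz by (auto simp: Z_def)
        then show False using cInf_lower[OF _ bd, of t] that by (simp add: s_def)
      qed
      have "\<bar>deriv U x\<bar> \<le> 3 * K * (s - x)" by (rule edge[OF _ _ pos _ Ux]) (use sz x 2 in auto)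
      also have "\<dots> \<le> 3 * K * \<bar>x - z\<bar>" using sz K0 by (intro mult_left_mono) auto
      finally show ?thesis .
    qed
  qed
  have "isCont (deriv U) z" for z
  proof (cases "U z = 0")
    case True
    have "(deriv U \<longlongrightarrow> 0) (at z)"
    proof (rule Lim_null_comparison)
      show "((\<lambda>y. 3 * K * \<bar>y - z\<bar>) \<longlongrightarrow> 0) (at z)" by (auto intro!: tendsto_eq_intros)
      have "\<forall>\<^sub>F y in at z. \<bar>y - z\<bar> < pi" unfolding eventually_at dist_real_def by (rule exI[of _ pi]) simp
      then show "\<forall>\<^sub>F y in at z. norm (deriv U y) \<le> 3 * K * \<bar>y - z\<bar>"
      proof eventually_elim
        case (elim y)
        show ?case using near[OF True elim] by simp
      qed
    qed
    then show ?thesis using dz0[OF True] by (simp add: isCont_def)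
  next
    case False
    then have "U z > 0" using nonneg[of z] by simp
    from DERIV_isCont[OF dU1[OF this]] show ?thesis .
  qed
  then have cd: "continuous_on UNIV (deriv U)" by (simp add: continuous_at_imp_continuous_on)
  have "steady \<alpha> U (deriv U) (\<lambda>x. \<kappa>)"
  proof unfold_locales
    fix x assume "U x > 0"
    from dU1[OF this] show "(deriv U has_real_derivative \<kappa> - \<alpha>\<^sup>2 * U x - cos x) (at x)" unfolding f_def .
  qed (rule \<alpha> perU nonneg dU cd DERIV_const)+
  then show ?thesis by blast
qed

text \<open>On a positivity interval of length \<open>2 * pi / \<alpha>\<close> the sine of frequency \<open>\<alpha>\<close> is a mass
  preserving perturbation that leaves the energy unchanged, against uniqueness.\<close>

lemma not_wide:
  assumes \<alpha>1: "\<alpha> > 1" and pos: "\<And>x. \<bar>x - c\<bar> \<le> pi / \<alpha> \<Longrightarrow> U x > 0"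
  shows False
proof -
  define d where "d = pi / \<alpha>"
  have d: "0 < d" "d < pi" "\<alpha> * d = pi" using \<alpha>1 by (auto simp: d_def field_simps)
  \<comment> \<open>One full wave of the sine, extended by zero. It vanishes at both ends of the
    interval, so it is continuous although its derivative jumps.\<close>
  define F where "F = (\<lambda>x. if \<bar>x - c\<bar> \<le> d then sin (\<alpha> * (x - c)) else 0)"
  define G where "G = (\<lambda>x. if \<bar>x - c\<bar> < d then \<alpha> * cos (\<alpha> * (x - c)) else 0)"
  have FG: "(G has_integral F y - F (c - pi)) {c - pi..y}" if y: "c - pi \<le> y" for y
  proof (rule fundamental_theorem_of_calculus_interior_strong[of "{c - d, c + d}"])
    have F': "F = (\<lambda>x. sin (\<alpha> * (max (c - d) (min (c + d) x) - c)))"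
    proof
      fix x
      have s: "sin (\<alpha> * (- d)) = 0" "sin (\<alpha> * d) = 0" using d by simp_all
      consider "\<bar>x - c\<bar> < d" | "x = c - d" | "x = c + d" | "x < c - d" | "x > c + d" by (force simp: abs_less_iff)
      then show "F x = sin (\<alpha> * (max (c - d) (min (c + d) x) - c))"
        using d s by cases (auto simp: F_def max_def min_def abs_less_iff)
    qed
    show "continuous_on {c - pi..y} F" unfolding F' by (intro continuous_intros)
    fix x assume x: "x \<in> {c - pi<..<y} - {c - d, c + d}"
    then consider "\<bar>x - c\<bar> < d" | "x < c - d" | "c + d < x" by (force simp: abs_less_iff)
    then have "(F has_real_derivative G x) (at x)"
    proof cases
      case 1
      have "((\<lambda>x. sin (\<alpha> * (x - c))) has_real_derivative \<alpha> * cos (\<alpha> * (x - c))) (at x)"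
        by (auto intro!: derivative_eq_intros)
      then have "(F has_real_derivative \<alpha> * cos (\<alpha> * (x - c))) (at x)"
        by (rule has_field_derivative_transform_within_open[of _ _ _ "{c - d<..<c + d}"]) (use 1 in \<open>auto simp: F_def abs_less_iff\<close>)
      then show ?thesis using 1 by (simp add: G_def)
    next
      case 2
      have "((\<lambda>x. 0) has_real_derivative 0) (at x)" by simp
      then have "(F has_real_derivative 0) (at x)"
        by (rule has_field_derivative_transform_within_open[of _ _ _ "{..<c - d}"]) (use 2 in \<open>auto simp: F_def\<close>)
      then show ?thesis using 2 d by (simp add: G_def)
    next
      case 3
      have "((\<lambda>x. 0) has_real_derivative 0) (at x)" by simp
      then have "(F has_real_derivative 0) (at x)"
        by (rule has_field_derivative_transform_within_open[of _ _ _ "{c + d<..}"]) (use 3 in \<open>auto simp: F_def\<close>)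
      then show ?thesis using 3 d by (simp add: G_def)
    qed
    then show "(F has_vector_derivative G x) (at x)" by (simp add: has_real_derivative_iff_has_vector_derivative)
  qed (use y in auto)
  have mG: "G \<in> borel_measurable borel" unfolding G_def[abs_def] by measurable
  have bG: "\<bar>G x\<bar> \<le> \<alpha>" for x
    using \<alpha> abs_cos_le_one[of "\<alpha> * (x - c)"] by (simp add: G_def abs_mult)
  have per: "F (c - pi) = F (c + pi)" "G (c - pi) = G (c + pi)" using d by (simp_all add: F_def G_def)
  define \<eta> k where "\<eta> = (\<lambda>x. F (reduce c x))" and "k = (\<lambda>x. G (reduce c x))"
  have b: "bounded_ac \<eta> k" unfolding \<eta>_def k_def
    by (rule periodic_ext_ac[OF per mG bG]) (use FG in auto)
  have ak: "ac \<eta> k" using b by (simp add: bounded_ac_def)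
  have c\<eta>: "continuous_on A \<eta>" for A by (rule ac_continuous[OF ak])
  have restr: "integral {c - pi..c + pi} H = integral {c - d..c + d} H'"
    if "\<And>x. \<bar>x - c\<bar> < d \<Longrightarrow> H x = H' x" "\<And>x. \<bar>x - c\<bar> > d \<Longrightarrow> H x = 0" for H H' :: "real \<Rightarrow> real"
  proof -
    have "integral {c - d..c + d} H' = integral {c - pi..c + pi} (\<lambda>x. if x \<in> {c - d..c + d} then H' x else 0)"
    proof -
      have I: "{c - d..c + d} \<inter> {c - pi..c + pi} = {c - d..c + d}" using d by auto
      show ?thesis unfolding Henstock_Kurzweil_Integration.integral_restrict_Int I by (rule refl)
    qed
    also have "\<dots> = integral {c - pi..c + pi} H"
    proof (rule integral_spike[of "{c - d, c + d}"])
      show "negligible {c - d, c + d}" by simp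
      fix x assume "x \<in> {c - pi..c + pi} - {c - d, c + d}"
      then consider "\<bar>x - c\<bar> < d" | "\<bar>x - c\<bar> > d" by fastforce
      then show "H x = (if x \<in> {c - d..c + d} then H' x else 0)"
      proof cases
        case 1
        then have "x \<in> {c - d..c + d}" by auto
        then show ?thesis using that(1)[OF 1] by simp
      next
        case 2
        then have "x \<notin> {c - d..c + d}" by auto
        then show ?thesis unfolding that(2)[OF 2] by (rule if_not_P[symmetric])
      qed
    qed
    finally show ?thesis by simp
  qed
  have z: "integral period \<eta> = 0"
  proof -
    have "integral period \<eta> = integral {c - pi..c + pi} F"
    proof (rule periodic_ext_integral[OF acD(1)[OF ak] absolutely_integrable_continuous_real[OF c\<eta>]])
      show "\<eta> x = F x" if "x \<in> {c - pi..c + pi}" for x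
        unfolding \<eta>_def by (rule periodic_ext_eq[OF per(1) that])
    qed
    also have "\<dots> = integral {c - d..c + d} (\<lambda>x. sin (\<alpha> * (x - c)))"
      by (rule restr) (auto simp: F_def)
    also have "\<dots> = - cos (\<alpha> * (c + d - c)) / \<alpha> - (- cos (\<alpha> * (c - d - c)) / \<alpha>)"
    proof (rule integral_unique, rule fundamental_theorem_of_calculus)
      fix x
      have "((\<lambda>x. - cos (\<alpha> * (x - c)) / \<alpha>) has_real_derivative sin (\<alpha> * (x - c))) (at x within {c - d..c + d})"
        using \<alpha> by (auto intro!: derivative_eq_intros)
      then show "((\<lambda>x. - cos (\<alpha> * (x - c)) / \<alpha>) has_vector_derivative sin (\<alpha> * (x - c))) (at x within {c - d..c + d})"
        by (simp add: has_real_derivative_iff_has_vector_derivative)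
    qed (use d in simp)
    also have "\<dots> = 0" by simp
    finally show ?thesis .
  qed
  \<comment> \<open>Inside the interval the integrand is \<alpha>^2 (cos^2 - sin^2) = \<alpha>^2 cos
    (2 \<alpha> (x - c)), and the interval consists of full periods of it.\<close>
  have Q: "integral period (\<lambda>x. (k x)\<^sup>2 - \<alpha>\<^sup>2 * (\<eta> x)\<^sup>2) = 0"
  proof -
    have "integral period (\<lambda>x. (k x)\<^sup>2 - \<alpha>\<^sup>2 * (\<eta> x)\<^sup>2) = integral {c - pi..c + pi} (\<lambda>x. (G x)\<^sup>2 - \<alpha>\<^sup>2 * (F x)\<^sup>2)"
    proof (rule periodic_ext_integral)
      show "circle_periodic (\<lambda>x. (k x)\<^sup>2 - \<alpha>\<^sup>2 * (\<eta> x)\<^sup>2)"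
        using acD(1,2)[OF ak] by (simp add: circle_periodic_def)
      show "(\<lambda>x. (k x)\<^sup>2 - \<alpha>\<^sup>2 * (\<eta> x)\<^sup>2) absolutely_integrable_on period"
        by (rule set_integral_diff(1)[OF bounded_ac_ints(2)[OF b acD(3)[OF a]] absolutely_integrable_continuous_real])
           (intro continuous_intros c\<eta>)
      show "(k x)\<^sup>2 - \<alpha>\<^sup>2 * (\<eta> x)\<^sup>2 = (G x)\<^sup>2 - \<alpha>\<^sup>2 * (F x)\<^sup>2" if "x \<in> {c - pi..c + pi}" for x
        using periodic_ext_eq[OF per(1) that] periodic_ext_eq[OF per(2) that] by (simp add: \<eta>_def k_def)
    qed
    also have "\<dots> = integral {c - d..c + d} (\<lambda>x. \<alpha>\<^sup>2 * cos (2 * (\<alpha> * (x - c))))"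
    proof (rule restr)
      fix x assume "\<bar>x - c\<bar> < d"
      then have "(G x)\<^sup>2 - \<alpha>\<^sup>2 * (F x)\<^sup>2 = \<alpha>\<^sup>2 * ((cos (\<alpha> * (x - c)))\<^sup>2 - (sin (\<alpha> * (x - c)))\<^sup>2)"
        by (simp add: F_def G_def power_mult_distrib right_diff_distrib)
      then show "(G x)\<^sup>2 - \<alpha>\<^sup>2 * (F x)\<^sup>2 = \<alpha>\<^sup>2 * cos (2 * (\<alpha> * (x - c)))"
        unfolding cos_double .
    qed (auto simp: F_def G_def)
    also have "\<dots> = \<alpha> / 2 * sin (2 * (\<alpha> * (c + d - c))) - \<alpha> / 2 * sin (2 * (\<alpha> * (c - d - c)))"
    proof (rule integral_unique, rule fundamental_theorem_of_calculus)
      fix x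
      have "((\<lambda>x. \<alpha> / 2 * sin (2 * (\<alpha> * (x - c)))) has_real_derivative \<alpha> / 2 * (cos (2 * (\<alpha> * (x - c))) * (2 * \<alpha>))) (at x within {c - d..c + d})"
        by (auto intro!: derivative_eq_intros)
      then show "((\<lambda>x. \<alpha> / 2 * sin (2 * (\<alpha> * (x - c)))) has_vector_derivative \<alpha>\<^sup>2 * cos (2 * (\<alpha> * (x - c)))) (at x within {c - d..c + d})"
        unfolding has_real_derivative_iff_has_vector_derivative
        by (rule back_subst) (simp add: power2_eq_square)
    qed (use d in simp)
    also have "\<dots> = 0"
    proof -
      have "\<alpha> * (c + d - c) = pi" "\<alpha> * (c - d - c) = - pi" using d(3) by simp_all
      then show ?thesis by simp
    qed
    finally show ?thesis .
  qed
  obtain m where m: "m \<in> {c - d..c + d}" "\<And>y. y \<in> {c - d..c + d} \<Longrightarrow> U m \<le> U y"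
    using continuous_attains_inf[OF compact_Icc _ contU, of "c - d" "c + d"] d by auto
  have Um: "U m > 0" using pos[of m] m(1) by (auto simp: d_def abs_le_iff)
  have fl: "U m \<le> U x" if "\<eta> x \<noteq> 0" for x
  proof -
    have "\<bar>reduce c x - c\<bar> \<le> d" using that by (auto simp: \<eta>_def F_def split: if_splits)
    then have "U m \<le> U (reduce c x)" by (intro m(2)) (auto simp: abs_le_iff)
    then show ?thesis using periodic_reduce[OF perU] by simp
  qed
  have B: "\<bar>\<eta> x\<bar> \<le> 1" for x by (simp add: \<eta>_def F_def)
  have "L \<eta> k \<ge> 0" by (rule first_variation[OF b z B Um]) (use fl in auto)
  moreover have "L (\<lambda>x. - \<eta> x) (\<lambda>x. - k x) \<ge> 0"
    by (rule first_variation[OF bounded_ac_uminus[OF b] _ _ Um]) (use fl z B in auto)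
  ultimately have L0: "L \<eta> k = 0" using L_uminus[OF b] by simp
  \<comment> \<open>The bound \<open>\<epsilon> / (B + 1)\<close> with
    \<open>\<epsilon> = U m\<close> and \<open>B = 1\<close>.\<close>
  define t where "t = U m / (1 + 1)"
  have t: "0 < t" "0 \<le> t" "t \<le> U m / (1 + 1)" using Um by (auto simp: t_def)
  note adm = variation_admissible[OF b z B Um _ t(2,3)]
  have "(\<lambda>x. U x + t * \<eta> x) = U"
  proof (rule uniq[OF adm])
    show "en \<alpha> (\<lambda>x. U x + t * \<eta> x) (\<lambda>x. g x + t * k x) = en \<alpha> U g"
      unfolding en_expand(1)[OF b] L0 Q by simp
  qed (use fl in auto)
  \<comment> \<open>At \<open>c + d / 2\<close> the wave has its peak value 1.\<close>
  from fun_cong[OF this, of "c + d / 2"] have "\<eta> (c + d / 2) = 0" using t(1) by simp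
  moreover have "reduce c (c + d / 2) = c + d / 2" using d by (intro reduce_id) auto
  ultimately have "sin (\<alpha> * d / 2) = 0" using d by (simp add: \<eta>_def F_def)
  moreover have "\<alpha> * d / 2 = pi / 2" using d(3) by simp
  ultimately show False by simp
qed

end


text \<open>The constant competitor \<open>M / (2 * pi)\<close> has finite energy, so the minimizer
  lies in \<open>H_circle 1\<close> and has an absolutely continuous representative. Uniqueness
  almost everywhere becomes equality by continuity.\<close>

lemma unique_minimizer_rep:
  assumes um: "unique_minimizer \<alpha> M u" and \<alpha>: "\<alpha> > 0" and M: "M > 0"
  obtains U g where "minimizer \<alpha> M U g" "AE x in lebesgue. U x = u x" "energy \<alpha> u = ereal (en \<alpha> U g)"
proof -
  have mc: "u \<in> mass_class M" and mn: "\<And>v. v \<in> mass_class M \<Longrightarrow> energy \<alpha> u \<le> energy \<alpha> v"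
    and uq: "\<And>v. v \<in> mass_class M \<Longrightarrow> (\<And>w. w \<in> mass_class M \<Longrightarrow> energy \<alpha> v \<le> energy \<alpha> w) \<Longrightarrow> AE x in lebesgue. v x = u x"
    using um unfolding unique_minimizer_def by blast+
  have L2: "u \<in> L2_circle" using mc by (simp add: mass_class_def)
  have en: "energy \<alpha> W = ereal (en \<alpha> W h)" "W \<in> mass_class M"
    if "ac W h" "h \<in> L2_circle" "\<And>x. 0 \<le> W x" "integral period W = M" for W h
    using energy_ac(2)[OF that(1,2) L2_circleI_continuous[OF acD(1)[OF that(1)] ac_continuous[OF that(1)]]]
      mass_classI[OF acD(1)[OF that(1)] ac_continuous[OF that(1)] that(3,4)] by auto
  have "integral period (\<lambda>x. M / (2 * pi)) = M" by simp
  moreover have "(\<lambda>x. 0) \<in> L2_circle" by (intro L2_circleI_continuous periodic_const continuous_intros)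
  ultimately have "energy \<alpha> (\<lambda>x. M / (2 * pi)) = ereal (en \<alpha> (\<lambda>x. M / (2 * pi)) (\<lambda>x. 0))" "(\<lambda>x. M / (2 * pi)) \<in> mass_class M"
    using en[OF ac_const[of "M / (2 * pi)"]] M by auto
  then have le: "energy \<alpha> u \<le> ereal (en \<alpha> (\<lambda>x. M / (2 * pi)) (\<lambda>x. 0))" using mn by metis
  have "u \<in> H_circle 1"
  proof (rule ccontr)
    assume "u \<notin> H_circle 1"
    then have "energy \<alpha> u = \<infinity>" by (simp add: energy_def)
    then show False using le by simp
  qed
  then obtain U g where U: "ac U g" "g \<in> L2_circle" "AE x in lebesgue. U x = u x"
    using H_circle_rep[of u 1] by blast
  have eu: "energy \<alpha> u = ereal (en \<alpha> U g)" by (rule energy_ac(2)[OF U(1,2) L2 U(3)])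
  have "minimizer \<alpha> M U g"
  proof
    show "0 < \<alpha>" "0 < M" "ac U g" "g \<in> L2_circle" by fact+
    show "0 \<le> U x" for x by (rule mass_class_rep(1)[OF mc U(1,3)])
    show "integral period U = M" by (rule mass_class_rep(2)[OF mc U(1,3)])
    fix W h assume W: "ac W h" "h \<in> L2_circle" "\<And>x. 0 \<le> W x" "integral period W = M"
    note eW = en[OF W]
    show "en \<alpha> U g \<le> en \<alpha> W h" using mn[OF eW(2)] eW(1) eu by simp
    assume eq: "en \<alpha> W h = en \<alpha> U g"
    have "AE x in lebesgue. W x = u x"
      by (rule uq[OF eW(2)]) (use mn eW(1) eq eu in auto)
    with U(3) have "AE x in lebesgue. W x = U x" by eventually_elim simp
    then show "W = U" by (rule AE_continuous_eq[OF ac_continuous[OF W(1)] ac_continuous[OF U(1)]])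
  qed
  then show ?thesis using that U(3) eu by blast
qed

section \<open>Droplets are strong steady states with zero dissipation\<close>

lemma L2_circle_L2_loc:
  assumes "v \<in> L2_circle"
  shows "v \<in> L2_loc P"
proof -
  note v = L2_circleD[OF assms]
  have "circle_periodic (\<lambda>x. (v x)\<^sup>2)" using v(1) by (simp add: circle_periodic_def)
  from L1_locI_abs_int[OF this v(3), of P]
  have "(\<lambda>x. (v x)\<^sup>2) absolutely_integrable_on K" if "compact K" "K \<subseteq> P" for K
    using that by (simp add: L1_loc_def)
  moreover have "set_borel_measurable lebesgue K v" if "compact K" for K
    unfolding set_borel_measurable_def
    using v(2) that by (intro borel_measurable_scaleR borel_measurable_indicator) (auto intro: fmeasurableD lmeasurable_compact)
  ultimately show ?thesis using v(1) by (simp add: L2_loc_def)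
qed

lemma has_weak_deriv_restrict:
  assumes "has_weak_deriv j UNIV u v"
  shows "has_weak_deriv j P u v"
proof -
  have "u \<in> L1_loc P" "v \<in> L1_loc P" using assms by (auto simp: has_weak_deriv_def L1_loc_def)
  moreover have "test_functions P \<subseteq> test_functions UNIV" using test_UNIV by blast
  ultimately show ?thesis using assms by (auto simp: has_weak_deriv_def)
qed

lemma ac_smooth_mult:
  assumes a: "ac p p1" and \<psi>: "\<psi> \<in> test_functions UNIV"
  shows "ac (\<lambda>x. p x * \<psi> x) (\<lambda>x. p1 x * \<psi> x + p x * deriv \<psi> x)"
  unfolding ac_def
proof (intro conjI allI impI)
  have c: "continuous_on A \<psi>" "continuous_on A (deriv \<psi>)" for A
    using smooth_continuous[OF test_smooth[OF \<psi>]] smooth_continuous[OF smooth_deriv[OF test_smooth[OF \<psi>]]] by auto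
  have i1: "(\<lambda>x. p1 x * \<psi> x) absolutely_integrable_on {a..b}" for a b by (rule abs_int_mult_cont(2)[OF acD(3)[OF a] c(1)])
  have i2: "(\<lambda>x. p x * deriv \<psi> x) absolutely_integrable_on {a..b}" for a b
    by (intro absolutely_integrable_continuous_real continuous_intros c ac_continuous[OF a])
  show "circle_periodic (\<lambda>x. p x * \<psi> x)" "circle_periodic (\<lambda>x. p1 x * \<psi> x + p x * deriv \<psi> x)"
    using acD(1,2)[OF a] test_periodic[OF \<psi>] periodic_deriv[OF test_periodic[OF \<psi>]] by (auto intro: periodic_mult periodic_add)
  show "(\<lambda>x. p1 x * \<psi> x + p x * deriv \<psi> x) absolutely_integrable_on period"
    by (rule set_integral_add(1)[OF i1 i2])
  fix x y :: real assume xy: "x \<le> y"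
  have "integral {x..y} (\<lambda>x. p x * deriv \<psi> x) = p y * \<psi> y - p x * \<psi> x - integral {x..y} (\<lambda>x. p1 x * \<psi> x)"
  proof (rule integration_by_parts_ac[OF xy acD(3)[OF a] _ _ c(2)])
    show "p z = p x + integral {x..z} p1" if "z \<in> {x..y}" for z using acD(5)[OF a, of x z] that by simp
    show "(\<psi> has_real_derivative deriv \<psi> z) (at z within {x..y})" for z
      by (rule has_field_derivative_at_within[OF smooth_has_deriv[OF test_smooth[OF \<psi>]]])
  qed
  moreover have "integral {x..y} (\<lambda>x. p1 x * \<psi> x + p x * deriv \<psi> x) = integral {x..y} (\<lambda>x. p1 x * \<psi> x) + integral {x..y} (\<lambda>x. p x * deriv \<psi> x)"
    using i1[of x y] i2[of x y] by (intro integral_add) (simp_all add: absolutely_integrable_on_def)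
  ultimately show "p y * \<psi> y - p x * \<psi> x = integral {x..y} (\<lambda>x. p1 x * \<psi> x + p x * deriv \<psi> x)" by simp
qed

lemma AE_not_in_finite: "finite S \<Longrightarrow> AE x in lebesgue. (x::real) \<notin> S"
  unfolding eventually_ae_filter_negligible by (intro exI[of _ S]) auto

text \<open>The variational argument yields a single multiplier for the whole circle, hence the
  constant \<open>\<kappa>\<close> in place of \<open>r\<close>.\<close>

locale droplet_state = steady \<alpha> U U1 "\<lambda>x. \<kappa>" for \<alpha> \<kappa> :: real and U U1 :: "real \<Rightarrow> real" +
  fixes l :: real
  assumes drop: "droplet l"
begin

lemma l: "0 < l" "l \<le> pi" and pos: "\<bar>y\<bar> < l \<Longrightarrow> U y > 0"
  and U1_neg: "0 < y \<Longrightarrow> y < l \<Longrightarrow> U1 y < 0"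
  and U1_out: "l \<le> \<bar>y\<bar> \<Longrightarrow> \<bar>y\<bar> \<le> pi \<Longrightarrow> U1 y = 0"
  and U_out: "l < \<bar>y\<bar> \<Longrightarrow> \<bar>y\<bar> \<le> pi \<Longrightarrow> U y = 0"
  using drop unfolding droplet_def by (blast, blast, blast, blast, blast, force)

lemma U1_odd: "U1 (- y) = - U1 y"
proof -
  have n: "((\<lambda>y. - y) has_real_derivative -1) (at y)" by (auto intro!: derivative_eq_intros)
  have "((\<lambda>y. U (- y)) has_real_derivative U1 (- y) * (-1)) (at y)" by (rule DERIV_chain2[OF D n])
  then have "(U has_real_derivative U1 (- y) * (-1)) (at y)" using droplet_even[OF drop] by simp
  from DERIV_unique[OF this D] show ?thesis by simp
qed

lemma open_interval_cases:
  assumes "x \<in> {-pi<..<y} - {-l, 0, l}" "y \<le> pi"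
  obtains "0 < \<bar>x\<bar>" "\<bar>x\<bar> < l" | "l < \<bar>x\<bar>" "\<bar>x\<bar> < pi"
  using assms by (cases "\<bar>x\<bar> < l") (auto simp: abs_if split: if_splits)

lemma has_deriv_zero_out:
  fixes f :: "real \<Rightarrow> real"
  assumes x: "l < \<bar>x\<bar>" "\<bar>x\<bar> < pi" and f: "\<And>y. l < \<bar>y\<bar> \<Longrightarrow> \<bar>y\<bar> < pi \<Longrightarrow> f y = 0"
  shows "(f has_real_derivative 0) (at x)"
proof -
  have "open {y::real. l < \<bar>y\<bar> \<and> \<bar>y\<bar> < pi}"
    by (intro open_Collect_conj open_Collect_less continuous_intros)
  moreover have "((\<lambda>y. 0) has_real_derivative 0) (at x)" by simp
  ultimately show ?thesis
    using has_field_derivative_transform_within_open[of "\<lambda>y. 0" 0 x "{y. l < \<bar>y\<bar> \<and> \<bar>y\<bar> < pi}" f] x f by auto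
qed

text \<open>The weak second derivative of the droplet. It may jump at the contact points
  \<open>l\<close> and \<open>-l\<close>, which is compatible with membership in
  \<open>H_circle 2\<close>.\<close>

definition U2 :: "real \<Rightarrow> real" where
  "U2 x = (if \<bar>reduce 0 x\<bar> < l then \<kappa> - \<alpha>\<^sup>2 * U (reduce 0 x) - cos (reduce 0 x) else 0)"

lemma U2_in: "\<bar>x\<bar> < l \<Longrightarrow> U2 x = \<kappa> - \<alpha>\<^sup>2 * U x - cos x"
  using l by (auto simp: U2_def reduce_id abs_less_iff)

lemma bounded_ac_U1: "bounded_ac U1 U2"
proof -
  define G where "G = (\<lambda>y. if \<bar>y\<bar> < l then \<kappa> - \<alpha>\<^sup>2 * U y - cos y else 0)"
  have "bounded ((\<lambda>y. \<kappa> - \<alpha>\<^sup>2 * U y - cos y) ` period)"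
    by (intro compact_imp_bounded compact_continuous_image continuous_intros contV) auto
  then obtain B where B: "\<forall>y\<in>period. \<bar>\<kappa> - \<alpha>\<^sup>2 * U y - cos y\<bar> \<le> B" by (auto simp: bounded_iff)
  have "\<bar>\<kappa> - \<alpha>\<^sup>2 * U 0 - cos 0\<bar> \<le> B" by (rule B[rule_format]) simp
  then have B0: "0 \<le> B" by (rule order_trans[OF abs_ge_zero])
  have mU: "U \<in> borel_measurable borel" by (rule borel_measurable_continuous_onI[OF contV])
  have "bounded_ac (\<lambda>x. U1 (reduce 0 x)) (\<lambda>x. G (reduce 0 x))"
  proof (rule periodic_ext_ac)
    show "U1 (0 - pi) = U1 (0 + pi)" using U1_out[of pi] U1_out[of "-pi"] l by simp
    show "G (0 - pi) = G (0 + pi)" using l by (simp add: G_def)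
    show "G \<in> borel_measurable borel" unfolding G_def[abs_def] using mU by measurable
    show "\<bar>G y\<bar> \<le> B" for y
    proof (cases "\<bar>y\<bar> < l")
      case True
      then have "y \<in> period" using l by auto
      then show ?thesis using B True by (simp add: G_def)
    qed (simp add: G_def B0)
    fix x assume x: "x \<in> {0 - pi..0 + pi}"
    show "(G has_integral U1 x - U1 (0 - pi)) {0 - pi..x}"
    proof (rule fundamental_theorem_of_calculus_interior_strong[of "{-l, 0, l}"])
      show "continuous_on {0 - pi..x} U1" by (rule contV1)
      fix y assume "y \<in> {0 - pi<..<x} - {-l, 0, l}"
      then have y: "y \<in> {-pi<..<x} - {-l, 0, l}" by simp
      have "(U1 has_real_derivative G y) (at y)"
        using y
      proof (rule open_interval_cases)
        show "x \<le> pi" using x by simp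
        assume "0 < \<bar>y\<bar>" "\<bar>y\<bar> < l"
        then show ?thesis using D1[OF pos] by (simp add: G_def)
      next
        assume "l < \<bar>y\<bar>" "\<bar>y\<bar> < pi"
        then show ?thesis using has_deriv_zero_out[of y U1] U1_out by (simp add: G_def)
      qed
      then show "(U1 has_vector_derivative G y) (at y)" by (simp add: has_real_derivative_iff_has_vector_derivative)
    qed (use x in auto)
  qed
  moreover have "(\<lambda>x. U1 (reduce 0 x)) = U1" using periodic_reduce[OF per1] by auto
  moreover have "(\<lambda>x. G (reduce 0 x)) = U2" by (auto simp: G_def U2_def)
  ultimately show ?thesis by simp
qed

lemma U2_L2: "U2 \<in> L2_circle"
proof -
  have a: "ac U1 U2" using bounded_ac_U1 by (simp add: bounded_ac_def)
  then show ?thesis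
    using bounded_ac_ints(2)[OF bounded_ac_U1 acD(3)[OF a]] bounded_ac_U1 acD(2)[OF a]
    by (simp add: L2_circle_def bounded_ac_def)
qed

definition p1 :: "real \<Rightarrow> real \<Rightarrow> real" where
  "p1 n x = (if 0 < \<bar>reduce 0 x\<bar> \<and> \<bar>reduce 0 x\<bar> < l
     then n * U (reduce 0 x) powr (n - 1) * U1 (reduce 0 x) else 0)"

lemma p1_out: "l \<le> \<bar>x\<bar> \<Longrightarrow> \<bar>x\<bar> < pi \<Longrightarrow> p1 n x = 0"
  using l by (auto simp: p1_def reduce_id abs_less_iff)

text \<open>The density of the derivative of \<open>U\<^sup>n\<close> may be unbounded for small \<open>n\<close>; it is integrable
  because \<open>U\<^sup>n\<close> is monotone on each half of the droplet.\<close>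

lemma ac_powr:
  assumes n: "n > 0"
  shows "ac (\<lambda>x. U x powr n) (p1 n)"
proof -
  define G where "G = (\<lambda>y. if 0 < \<bar>y\<bar> \<and> \<bar>y\<bar> < l then n * U y powr (n - 1) * U1 y else 0)"
  have p1G: "p1 n x = G (reduce 0 x)" for x by (simp add: p1_def G_def)
  have Gper: "G (0 - pi) = G (0 + pi)" using l by (simp add: G_def)
  have eq: "p1 n x = G x" if "x \<in> {-pi..pi}" for x
    unfolding p1G using periodic_ext_eq[OF Gper, of x] that by simp
  have cp: "continuous_on A (\<lambda>x. U x powr n)" for A
    by (intro continuous_on_powr' contV continuous_intros) (use nonneg n in auto)
  have I: "(G has_integral U x powr n - U y powr n) {y..x}" if xy: "-pi \<le> y" "y \<le> x" "x \<le> pi" for x y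
  proof (rule fundamental_theorem_of_calculus_interior_strong[of "{-l, 0, l}"])
    show "continuous_on {y..x} (\<lambda>x. U x powr n)" by (rule cp)
    fix z assume "z \<in> {y<..<x} - {-l, 0, l}"
    then have z: "z \<in> {-pi<..<x} - {-l, 0, l}" using xy by auto
    have "((\<lambda>x. U x powr n) has_real_derivative G z) (at z)"
      using z xy(3)
    proof (rule open_interval_cases)
      assume z: "0 < \<bar>z\<bar>" "\<bar>z\<bar> < l"
      have "((\<lambda>x. x powr n) has_real_derivative n * U z powr (n - 1)) (at (U z))"
        by (rule has_real_derivative_powr[OF pos[OF z(2)]])
      from DERIV_chain2[OF this D] show ?thesis using z by (simp add: G_def)
    next
      assume z: "l < \<bar>z\<bar>" "\<bar>z\<bar> < pi"
      have "((\<lambda>x. U x powr n) has_real_derivative 0) (at z)"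
        by (rule has_deriv_zero_out[OF z]) (use U_out n in auto)
      then show ?thesis using z by (simp add: G_def)
    qed
    then show "((\<lambda>x. U x powr n) has_vector_derivative G z) (at z)"
      by (simp add: has_real_derivative_iff_has_vector_derivative)
  qed (use xy in auto)
  have G0: "G y \<le> 0" if "0 \<le> y" for y
  proof (cases "0 < y \<and> y < l")
    case True
    have "n * U y powr (n - 1) * U1 y \<le> 0"
      by (rule mult_nonneg_nonpos) (use n U1_neg[of y] True in simp_all)
    then show ?thesis by (simp add: G_def)
  qed (use that in \<open>auto simp: G_def\<close>)
  have G1: "0 \<le> G y" if "y \<le> 0" for y
  proof (cases "y < 0 \<and> - y < l")
    case True
    have "0 \<le> n * U y powr (n - 1) * U1 y"
      by (rule mult_nonneg_nonneg) (use n U1_neg[of "-y"] U1_odd[of y] True in simp_all)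
    then show ?thesis by (simp add: G_def)
  qed (use that in \<open>auto simp: G_def\<close>)
  \<comment> \<open>A function of one sign that is integrable in the gauge sense is absolutely
    integrable, so each half needs no estimate of the density.\<close>
  have a1: "G absolutely_integrable_on {-pi..0}"
    by (rule nonnegative_absolutely_integrable_1[OF has_integral_integrable[OF I[of "-pi" 0]]]) (use G1 in auto)
  have "(\<lambda>x. - G x) absolutely_integrable_on {0..pi}"
    by (rule nonnegative_absolutely_integrable_1[OF has_integral_integrable[OF has_integral_neg[OF I[of 0 pi]]]]) (use G0 in auto)
  then have a2: "G absolutely_integrable_on {0..pi}" using set_integrable_mult_right[of "-1" lebesgue "{0..pi}" "\<lambda>x. - G x"] by simp
  have a: "G absolutely_integrable_on {-pi..pi}" by (rule abs_int_combine[OF _ _ a1 a2]) auto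
  show ?thesis
  proof (rule ac_window[where c = 0])
    show "circle_periodic (\<lambda>x. U x powr n)" using per by (simp add: circle_periodic_def)
    show "circle_periodic (p1 n)" unfolding p1_def[abs_def] circle_periodic_def by (simp add: reduce_periodic)
    show "p1 n absolutely_integrable_on {0 - pi..0 + pi}"
      using abs_int_AE(1)[OF a, of "p1 n"] eq by (simp add: always_eventually)
    fix x assume x: "x \<in> {0 - pi..0 + pi}"
    have "integral {0 - pi..x} (p1 n) = integral {0 - pi..x} G" by (rule integral_cong) (use x eq in auto)
    then show "U x powr n - U (0 - pi) powr n = integral {0 - pi..x} (p1 n)"
      using integral_unique[OF I[of "0 - pi" x]] x by simp
  qed
qed

lemma ac_U: "ac U U1"
  by (rule ac_C1[OF per D contV1])

lemma weak_derivs: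
  assumes ae: "AE x in lebesgue. U x = u x" and u: "u \<in> L2_circle"
  shows "has_weak_deriv 0 UNIV u u" "has_weak_deriv 1 UNIV u U1" "has_weak_deriv 2 UNIV u U2"
proof -
  show 1: "has_weak_deriv 1 UNIV u U1" by (rule ac_weak_deriv[OF ac_U L2_circleD(1)[OF u] ae])
  have a: "ac U1 U2" using bounded_ac_U1 by (simp add: bounded_ac_def)
  have "has_weak_deriv 1 UNIV U1 U2" by (rule ac_weak_deriv[OF a per1]) simp
  then show "has_weak_deriv 2 UNIV u U2" by (rule weak_deriv_compose[OF 1])
  show "has_weak_deriv 0 UNIV u u" by (rule has_weak_deriv_0[OF ac_L1_loc[OF ac_U L2_circleD(1)[OF u] ae]])
qed

text \<open>On the droplet the first factor of the integrand equals \<open>\<kappa>\<close>, and off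
  the droplet \<open>w\<close> vanishes, so the integrand is \<open>\<kappa> * w x\<close> almost
  everywhere. Its integral is zero because \<open>w\<close> is the density of a periodic
  function.\<close>

lemma strong_steady:
  assumes ae: "AE x in lebesgue. U x = u x" and mc: "u \<in> mass_class M" and n: "n > 0"
  shows "strong_steady_state \<alpha> n M u"
  unfolding strong_steady_state_def
proof (intro conjI ballI mc)
  have L2: "u \<in> L2_circle" using mc by (simp add: mass_class_def)
  have U1L: "U1 \<in> L2_circle" by (rule L2_circleI_continuous[OF per1 contV1])
  note w = weak_derivs[OF ae L2]
  show "u \<in> H_circle 2" unfolding H_circle_def
  proof (safe intro!: L2)
    fix j :: nat assume "j \<le> 2"
    then consider "j = 0" | "j = 1" | "j = 2" by linarith
    then show "\<exists>v\<in>L2_circle. has_weak_deriv j UNIV u v"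
    proof cases
      case 1 show ?thesis using w(1) L2 unfolding 1 by (rule rev_bexI[rotated])
    next
      case 2 show ?thesis using w(2) U1L unfolding 2 by (rule rev_bexI[rotated])
    next
      case 3 show ?thesis using w(3) U2_L2 unfolding 3 by (rule rev_bexI[rotated])
    qed
  qed
  show "energy \<alpha> u < \<infinity>" using energy_ac(2)[OF ac_U U1L L2 ae] by simp
  fix \<phi> assume \<phi>: "\<phi> \<in> test_functions UNIV"
  define \<psi> where "\<psi> = deriv \<phi>"
  have \<psi>: "\<psi> \<in> test_functions UNIV" unfolding \<psi>_def by (rule test_deriv[OF \<phi>])
  define w where "w = (\<lambda>x. p1 n x * \<psi> x + U x powr n * deriv \<psi> x)"
  have aw: "ac (\<lambda>x. U x powr n * \<psi> x) w" unfolding w_def by (rule ac_smooth_mult[OF ac_powr[OF n] \<psi>])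
  have ae': "AE x in lebesgue. U x powr n * \<psi> x = u x powr n * \<psi> x" using ae by eventually_elim simp
  have per': "circle_periodic (\<lambda>x. u x powr n * \<psi> x)"
    using L2_circleD(1)[OF L2] test_periodic[OF \<psi>] by (simp add: circle_periodic_def)
  have W: "has_weak_deriv 1 UNIV (\<lambda>x. u x powr n * \<psi> x) w" by (rule ac_weak_deriv[OF aw per' ae'])
  have wi: "(\<lambda>x. \<kappa> * w x) absolutely_integrable_on period" by (intro set_integrable_mult_right acD(3)[OF aw])
  have "AE x in lebesgue. weak_deriv 2 UNIV u x = U2 x" by (rule weak_deriv_eq(2)[OF w(3)])
  moreover have "AE x in lebesgue. (x::real) \<notin> {-l, l, pi, -pi}" by (rule AE_not_in_finite) simp
  ultimately have "AE x in lebesgue. x \<in> period \<longrightarrow> (weak_deriv 2 UNIV u x + \<alpha>\<^sup>2 * u x + cos x) * w x = \<kappa> * w x"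
    using ae
  proof eventually_elim
    case (elim x)
    show ?case
    proof
      assume x: "x \<in> period"
      then have xp: "\<bar>x\<bar> < pi" using elim(2) by (auto simp: abs_less_iff)
      show "(weak_deriv 2 UNIV u x + \<alpha>\<^sup>2 * u x + cos x) * w x = \<kappa> * w x"
      proof (cases "\<bar>x\<bar> < l")
        case True
        then show ?thesis using elim U2_in[OF True] by simp
      next
        case False
        then have x': "l < \<bar>x\<bar>" using elim(2) by auto
        then have "U x = 0" "p1 n x = 0" using U_out[OF x'] p1_out[of x n] xp by auto
        then have "w x = 0" using n by (simp add: w_def)
        then show ?thesis by simp
      qed
    qed
  qed
  note J = abs_int_AE[OF wi this]
  have "integral period w = U pi powr n * \<psi> pi - U (- pi) powr n * \<psi> (- pi)"
    using acD(5)[OF aw, of "-pi" pi] by simp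
  also have "\<dots> = 0"
    using per[unfolded circle_periodic_def, rule_format, of "-pi"]
      test_periodic[OF \<psi>, unfolded circle_periodic_def, rule_format, of "-pi"] by simp
  finally have "integral period (\<lambda>x. \<kappa> * w x) = 0" by simp
  then have "(LINT x:period|lebesgue. (weak_deriv 2 UNIV u x + \<alpha>\<^sup>2 * u x + cos x) * w x) = 0"
    using J(2) set_lebesgue_integral_eq_integral(2)[OF J(1)] by simp
  then show "\<exists>w. has_weak_deriv 1 UNIV (\<lambda>x. u x powr n * deriv \<phi> x) w \<and>
            set_integrable lebesgue period (\<lambda>x. (weak_deriv 2 UNIV u x + \<alpha>\<^sup>2 * u x + cos x) * w x) \<and>
            (LINT x:period|lebesgue. (weak_deriv 2 UNIV u x + \<alpha>\<^sup>2 * u x + cos x) * w x) = 0"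
    using W J(1) unfolding \<psi>_def by blast
qed

text \<open>The dissipation refers to a derivative picked by choice on the positivity set, so any
  two candidates must be compared there. Bumps detect the difference on compact parts of the
  droplet, and countably many of them exhaust it.\<close>

lemma weak_deriv_unique_local:
  assumes v: "has_weak_deriv j {x. U x > 0} u v" and w: "has_weak_deriv j {x. U x > 0} u w"
  shows "AE x in lebesgue. \<bar>x\<bar> < l \<longrightarrow> v x = w x"
proof -
  define P where "P = {x. U x > 0}"
  have vP: "has_weak_deriv j P u v" and wP: "has_weak_deriv j P u w" using v w by (simp_all add: P_def)
  define d where "d = (\<lambda>x. v x - w x)"
  have Lv: "v \<in> L1_loc P" and Lw: "w \<in> L1_loc P" using vP wP by (auto simp: has_weak_deriv_def)
  have Ld: "d \<in> L1_loc P" unfolding L1_loc_def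
  proof (intro CollectI conjI allI impI)
    show "circle_periodic d" using Lv Lw by (simp add: L1_loc_def d_def circle_periodic_def)
    fix K assume "compact K \<and> K \<subseteq> P"
    then have "v absolutely_integrable_on K" "w absolutely_integrable_on K" using Lv Lw by (auto simp: L1_loc_def)
    then show "d absolutely_integrable_on K" unfolding d_def by (rule set_integral_diff(1))
  qed
  have d0: "integral period (\<lambda>x. d x * \<phi> x) = 0" if \<phi>: "\<phi> \<in> test_functions P" for \<phi>
  proof -
    note iv = L1_loc_test_abs_int[OF Lv \<phi>] and iw = L1_loc_test_abs_int[OF Lw \<phi>]
    have "(LINT x:period|lebesgue. u x * (deriv ^^ j) \<phi> x) = (-1) ^ j * (LINT x:period|lebesgue. v x * \<phi> x)"
      "(LINT x:period|lebesgue. u x * (deriv ^^ j) \<phi> x) = (-1) ^ j * (LINT x:period|lebesgue. w x * \<phi> x)"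
      using vP wP \<phi> unfolding has_weak_deriv_def by blast+
    then have "(-1) ^ j * (LINT x:period|lebesgue. v x * \<phi> x) = (-1) ^ j * (LINT x:period|lebesgue. w x * \<phi> x)"
      by (rule trans[OF sym])
    then have "integral period (\<lambda>x. v x * \<phi> x) = integral period (\<lambda>x. w x * \<phi> x)"
      using set_lebesgue_integral_eq_integral(2)[OF iv] set_lebesgue_integral_eq_integral(2)[OF iw] by simp
    then show ?thesis using iv iw
      by (simp add: d_def left_diff_distrib integral_diff absolutely_integrable_on_def)
  qed
  \<comment> \<open>Radii that increase to \<open>l\<close> but stay strictly between 0 and
    \<open>l\<close>, so that each closed support lies in the positivity set.\<close>
  define R where "R = (\<lambda>k::nat. l * (1 - 1 / (real k + 2)))"
  have R: "0 < R k" "R k < l" for k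
  proof -
    have "0 < 1 / (real k + 2)" "1 / (real k + 2) < 1" by simp_all
    then show "0 < R k" "R k < l" unfolding R_def using l by (simp_all add: mult_less_cancel_left2)
  qed
  have b: "bump 0 (R k) \<in> test_functions P" for k
  proof (rule bump_test_interval)
    show "x + 2 * pi * of_int i \<in> P" if "x \<in> P" for x and i :: int
      using that periodic_int[OF per, of x i] by (simp add: P_def)
    show "{0 - R k..0 + R k} \<subseteq> P" using R[of k] pos by (auto simp: P_def abs_less_iff)
  qed (use R[of k] l in auto)
  have "AE x in lebesgue. \<forall>k. x \<in> period \<longrightarrow> bump 0 (R k) x \<noteq> 0 \<longrightarrow> d x = 0"
    unfolding AE_all_countable by (intro allI localize_zero[OF Ld d0 b])
  then show ?thesis
  proof eventually_elim
    case (elim x)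
    show ?case
    proof
      assume x: "\<bar>x\<bar> < l"
      obtain k where k: "1 / (1 - \<bar>x\<bar> / l) < real k" using reals_Archimedean2 by blast
      have q: "0 < 1 - \<bar>x\<bar> / l" using x l by simp
      have "1 / (real k + 2) < 1 - \<bar>x\<bar> / l"
      proof -
        have "1 < real k * (1 - \<bar>x\<bar> / l)" using k q by (simp add: pos_divide_less_eq)
        also have "\<dots> \<le> (real k + 2) * (1 - \<bar>x\<bar> / l)" using q by (intro mult_right_mono) auto
        finally show ?thesis by (simp add: pos_divide_less_eq mult.commute)
      qed
      then have "l * (\<bar>x\<bar> / l) < R k" unfolding R_def using l by (intro mult_strict_left_mono) auto
      then have "\<bar>x\<bar> < R k" using l by simp
      then have "bump 0 (R k) x \<noteq> 0"
        using cos_greater_iff[of "R k" x] R[of k] l by (simp add: bump_nonzero_iff)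
      moreover have "x \<in> period" using x l by (auto simp: abs_less_iff)
      ultimately have "d x = 0" using elim by blast
      then show "v x = w x" by (simp add: d_def)
    qed
  qed
qed

text \<open>The required third derivative \<open>sin x - \<alpha>\<^sup>2 * U1 x\<close> is
  continuous on the whole circle. On supports of test functions in the positivity set
  \<open>U2\<close> agrees with the differentiable \<open>f\<close>, so one integration by parts
  identifies the weak third derivative.\<close>

lemma zero_diss:
  assumes ae: "AE x in lebesgue. U x = u x" and L2: "u \<in> L2_circle"
  shows "zero_dissipation \<alpha> n u"
proof -
  define P where "P = {x. U x > 0}"
  have P: "positivity_set u = P" unfolding P_def by (rule positivity_set_eq[OF contV ae])
  define U3 where "U3 = (\<lambda>x. - \<alpha>\<^sup>2 * U1 x + sin x)"
  have U1L: "U1 \<in> L2_circle" by (rule L2_circleI_continuous[OF per1 contV1])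
  have c3: "continuous_on A U3" for A unfolding U3_def by (intro continuous_intros contV1)
  have p3: "circle_periodic U3" using per1 by (simp add: U3_def circle_periodic_def)
  have U3L: "U3 \<in> L2_circle" by (rule L2_circleI_continuous[OF p3 c3])
  note w = weak_derivs[OF ae L2]
  note wP = w[THEN has_weak_deriv_restrict, of P]
  define f where "f = (\<lambda>x. \<kappa> - \<alpha>\<^sup>2 * U x - cos x)"
  have af: "ac f U3"
  proof (rule ac_C1)
    show "circle_periodic f" using per by (simp add: f_def circle_periodic_def)
    show "(f has_real_derivative U3 x) (at x)" for x
      unfolding f_def U3_def using D[of x] by (auto intro!: derivative_eq_intros)
  qed (rule c3)
  have w3: "has_weak_deriv 3 P u U3"
    unfolding has_weak_deriv_def
  proof (intro conjI ballI)
    show "u \<in> L1_loc P" using wP(2) by (simp add: has_weak_deriv_def)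
    show "U3 \<in> L1_loc P" by (rule L1_locI_continuous[OF p3 c3])
    fix \<phi> assume \<phi>: "\<phi> \<in> test_functions P"
    have d\<phi>: "deriv \<phi> \<in> test_functions P" by (rule test_deriv[OF \<phi>])
    have c: "continuous_on A \<phi>" "continuous_on A (deriv \<phi>)" for A
      using smooth_continuous[OF test_smooth[OF \<phi>]] smooth_continuous[OF test_smooth[OF d\<phi>]] by auto
    have in_P: "U x > 0" if "deriv \<phi> x \<noteq> 0" for x
      using d\<phi> closure_subset[of "{x. deriv \<phi> x \<noteq> 0}"] that by (auto simp: test_functions_def P_def)
    have fi: "(\<lambda>x. f x * deriv \<phi> x) absolutely_integrable_on period"
      by (intro absolutely_integrable_continuous_real continuous_intros c ac_continuous[OF af])
    have "AE x in lebesgue. (x::real) \<notin> {-l, l, pi, -pi}" by (rule AE_not_in_finite) simp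
    then have "AE x in lebesgue. x \<in> period \<longrightarrow> U2 x * deriv \<phi> x = f x * deriv \<phi> x"
    proof eventually_elim
      case (elim x)
      show ?case
      proof
        assume "x \<in> period"
        then have xp: "\<bar>x\<bar> < pi" using elim by (auto simp: abs_less_iff)
        show "U2 x * deriv \<phi> x = f x * deriv \<phi> x"
        proof (cases "\<bar>x\<bar> < l")
          case True
          then show ?thesis using U2_in[OF True] by (simp add: f_def)
        next
          case False
          then have "l < \<bar>x\<bar>" using elim by auto
          then have "U x = 0" using U_out xp by simp
          then have "deriv \<phi> x = 0" using in_P[of x] by auto
          then show ?thesis by simp
        qed
      qed
    qed
    note J = abs_int_AE[OF fi this]
    have i3: "(\<lambda>x. U3 x * \<phi> x) absolutely_integrable_on period"
      by (intro absolutely_integrable_continuous_real continuous_intros c c3)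
    have "(LINT x:period|lebesgue. u x * (deriv ^^ 2) (deriv \<phi>) x) = (LINT x:period|lebesgue. U2 x * deriv \<phi> x)"
      using w(3) test_UNIV[OF d\<phi>] by (simp add: has_weak_deriv_def)
    also have "\<dots> = - integral period (\<lambda>x. U3 x * \<phi> x)"
      using set_lebesgue_integral_eq_integral(2)[OF J(1)] J(2) ac_by_parts[OF af test_smooth[OF \<phi>] test_periodic[OF \<phi>]] by simp
    also have "\<dots> = - (LINT x:period|lebesgue. U3 x * \<phi> x)"
      using set_lebesgue_integral_eq_integral(2)[OF i3] by simp
    also have "(deriv ^^ 2) (deriv \<phi>) = (deriv ^^ 3) \<phi>"
      by (simp add: numeral_2_eq_2 numeral_3_eq_3)
    finally show "(LINT x:period|lebesgue. u x * (deriv ^^ 3) \<phi> x) = (- 1) ^ 3 * (LINT x:period|lebesgue. U3 x * \<phi> x)"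
      by simp
  qed
  have H: "u \<in> H_loc 3 P" unfolding H_loc_def
  proof (safe intro!: L2_circle_L2_loc[OF L2])
    fix j :: nat assume "j \<le> 3"
    then consider "j = 0" | "j = 1" | "j = 2" | "j = 3" by linarith
    then show "\<exists>v\<in>L2_loc P. has_weak_deriv j P u v"
    proof cases
      case 1 show ?thesis using wP(1) L2_circle_L2_loc[OF L2, of P] unfolding 1 by (rule rev_bexI[rotated])
    next
      case 2 show ?thesis using wP(2) L2_circle_L2_loc[OF U1L, of P] unfolding 2 by (rule rev_bexI[rotated])
    next
      case 3 show ?thesis using wP(3) L2_circle_L2_loc[OF U2_L2, of P] unfolding 3 by (rule rev_bexI[rotated])
    next
      case 4 show ?thesis using w3 L2_circle_L2_loc[OF U3L, of P] unfolding 4 by (rule rev_bexI[rotated])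
    qed
  qed
  define d1 d3 where "d1 = weak_deriv 1 P u" and "d3 = weak_deriv 3 P u"
  have s1: "has_weak_deriv 1 P u d1" unfolding d1_def weak_deriv_def by (rule someI[of "has_weak_deriv 1 P u", OF wP(2)])
  have s3: "has_weak_deriv 3 P u d3" unfolding d3_def weak_deriv_def by (rule someI[of "has_weak_deriv 3 P u", OF w3])
  have "AE x in lebesgue. \<bar>x\<bar> < l \<longrightarrow> d1 x = U1 x"
    by (rule weak_deriv_unique_local[OF s1[unfolded P_def] wP(2)[unfolded P_def]])
  moreover have "AE x in lebesgue. \<bar>x\<bar> < l \<longrightarrow> d3 x = U3 x"
    by (rule weak_deriv_unique_local[OF s3[unfolded P_def] w3[unfolded P_def]])
  moreover have "AE x in lebesgue. (x::real) \<notin> {-l, l, pi, -pi}" by (rule AE_not_in_finite) simp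
  ultimately have "AE x in lebesgue. ennreal (u x powr n * (d3 x + \<alpha>\<^sup>2 * d1 x - sin x)\<^sup>2) * indicator (P \<inter> period) x = 0"
  proof eventually_elim
    case (elim x)
    show ?case
    proof (cases "x \<in> P \<inter> period")
      case True
      then have xp: "\<bar>x\<bar> < pi" using elim by (auto simp: abs_less_iff)
      have "\<bar>x\<bar> < l"
      proof (rule ccontr)
        assume "\<not> \<bar>x\<bar> < l"
        then have "l < \<bar>x\<bar>" using elim by auto
        then have "U x = 0" using U_out xp by simp
        then show False using True by (simp add: P_def)
      qed
      then have "d3 x + \<alpha>\<^sup>2 * d1 x - sin x = 0" using elim by (simp add: U3_def)
      then show ?thesis by simp
    qed simp
  qed
  then have "(\<integral>\<^sup>+x. ennreal (u x powr n * (d3 x + \<alpha>\<^sup>2 * d1 x - sin x)\<^sup>2) * indicator (P \<inter> period) x \<partial>lebesgue) = (\<integral>\<^sup>+x. 0 \<partial>(lebesgue::real measure))"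
    by (rule nn_integral_cong_AE)
  then have "dissipation \<alpha> n u = 0" by (simp add: dissipation_def P d1_def d3_def)
  then show ?thesis using H by (simp add: zero_dissipation_def P)
qed

end


section \<open>The energy gap\<close>

text \<open>The minimum lies below the mean, and the oscillation is at most the integral of
  \<open>\<bar>V1\<bar>\<close>, which Young's inequality bounds by the Dirichlet integral. The
  energy bounds that integral in terms of the maximum \<open>m\<close> itself, linearly because the
  square of \<open>V\<close> integrates to at most \<open>m * M\<close>.\<close>

lemma (in steady) sup_bound:
  assumes M: "M > 0" "integral period V = M" and E: "en \<alpha> V V1 \<le> E"
  shows "V x \<le> 2 * (M / (2 * pi) + pi * \<alpha>\<^sup>2 * M + (E + M) / (\<alpha>\<^sup>2 * M))"
proof -
  obtain x0 where x0: "x0 \<in> period" "\<And>y. y \<in> period \<Longrightarrow> V y \<le> V x0"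
    using continuous_attains_sup[OF compact_Icc _ contV, of "-pi" pi] by auto
  define m where "m = V x0"
  have le: "V y \<le> m" for y
    using x0(2)[of "reduce 0 y"] reduce_bounds[of 0 y] periodic_reduce[OF per] by (simp add: m_def)
  obtain y0 where y0: "y0 \<in> period" "\<And>y. y \<in> period \<Longrightarrow> V y0 \<le> V y"
    using continuous_attains_inf[OF compact_Icc _ contV, of "-pi" pi] by auto
  have i1: "(V1 has_integral V b - V a) {a..b}" if "a \<le> b" for a b
    by (rule fundamental_theorem_of_calculus[OF that])
       (use D in \<open>auto simp: has_real_derivative_iff_has_vector_derivative[symmetric] intro: has_field_derivative_at_within\<close>)
  have "integral period (\<lambda>x. V y0) \<le> integral period V"
    by (intro integral_le integrable_continuous_real contV continuous_intros) (use y0 in auto)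
  then have y0M: "V y0 \<le> M / (2 * pi)" using M by (simp add: field_simps)
  \<comment> \<open>The Young parameter for which the term linear in \<open>m\<close> on the right
    is exactly \<open>m / 2\<close> and can be absorbed.\<close>
  define k where "k = 1 / (2 * \<alpha>\<^sup>2 * M)"
  have k: "k > 0" "k * (\<alpha>\<^sup>2 * M) = 1 / 2" using M \<alpha> by (auto simp: k_def)
  define q where "q = (\<lambda>x. 1 / (4 * k) + k * (V1 x)\<^sup>2)"
  have qi: "q integrable_on {a..b}" for a b
    unfolding q_def by (intro integrable_continuous_real continuous_intros contV1)
  have q0: "0 \<le> q x" for x unfolding q_def using k by simp
  have qV: "\<bar>V1 x\<bar> \<le> q x" for x
  proof -
    have "0 \<le> k * (\<bar>V1 x\<bar> - 1 / (2 * k))\<^sup>2" using k by simp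
    also have "\<dots> = q x - \<bar>V1 x\<bar>" using k unfolding q_def by (simp add: power2_eq_square algebra_simps)
    finally show ?thesis by simp
  qed
  have seg: "\<bar>V b - V a\<bar> \<le> integral period q" if ab: "a \<le> b" "a \<in> period" "b \<in> period" for a b
  proof -
    have "norm (integral {a..b} V1) \<le> integral {a..b} q"
      by (rule integral_norm_bound_integral) (use i1[OF ab(1)] qi qV in auto)
    also have "\<dots> \<le> integral period q" by (rule integral_subset_le) (use ab qi q0 in auto)
    finally show ?thesis using integral_unique[OF i1[OF ab(1)]] by simp
  qed
  have "m - V y0 \<le> integral period q"
    using seg[of x0 y0] seg[of y0 x0] x0(1) y0(1) unfolding m_def by (cases "x0 \<le> y0") auto
  moreover have "integral period q = pi / (2 * k) + k * integral period (\<lambda>x. (V1 x)\<^sup>2)"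
  proof -
    have "integral period q = integral period (\<lambda>x. 1 / (4 * k)) + integral period (\<lambda>x. k * (V1 x)\<^sup>2)"
      unfolding q_def by (intro integral_add integrable_continuous_real continuous_intros contV1)
    then show ?thesis using k by (simp add: field_simps)
  qed
  moreover have "integral period (\<lambda>x. (V1 x)\<^sup>2) \<le> 2 * E + \<alpha>\<^sup>2 * (m * M) + 2 * M"
  proof -
    have e1: "integral period (\<lambda>x. (V1 x)\<^sup>2 - \<alpha>\<^sup>2 * (V x)\<^sup>2) = integral period (\<lambda>x. (V1 x)\<^sup>2) - integral period (\<lambda>x. \<alpha>\<^sup>2 * (V x)\<^sup>2)"
      by (intro integral_diff integrable_continuous_real continuous_intros contV contV1)
    have e2: "integral period (\<lambda>x. \<alpha>\<^sup>2 * (V x)\<^sup>2) = \<alpha>\<^sup>2 * integral period (\<lambda>x. (V x)\<^sup>2)" by simp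
    have "integral period (\<lambda>x. (V1 x)\<^sup>2) = 2 * en \<alpha> V V1 + \<alpha>\<^sup>2 * integral period (\<lambda>x. (V x)\<^sup>2) + 2 * integral period (\<lambda>x. V x * cos x)"
    proof -
      have "2 * en \<alpha> V V1 = integral period (\<lambda>x. (V1 x)\<^sup>2 - \<alpha>\<^sup>2 * (V x)\<^sup>2) - 2 * integral period (\<lambda>x. V x * cos x)"
        unfolding en_def by (simp add: right_diff_distrib)
      then show ?thesis using e1 e2 by linarith
    qed
    moreover have "integral period (\<lambda>x. (V x)\<^sup>2) \<le> integral period (\<lambda>x. m * V x)"
      by (intro integral_le integrable_continuous_real continuous_intros contV)
         (use le nonneg in \<open>auto simp: power2_eq_square intro: mult_right_mono\<close>)
    moreover have "integral period (\<lambda>x. m * V x) = m * M" using M by simp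
    moreover have "integral period (\<lambda>x. V x * cos x) \<le> integral period V"
      by (intro integral_le integrable_continuous_real continuous_intros contV) (use nonneg in \<open>auto intro: mult_left_le\<close>)
    moreover have "\<alpha>\<^sup>2 * integral period (\<lambda>x. (V x)\<^sup>2) \<le> \<alpha>\<^sup>2 * (m * M)"
      by (rule mult_left_mono) (use calculation in auto)
    ultimately show ?thesis using E M by linarith
  qed
  then have "k * integral period (\<lambda>x. (V1 x)\<^sup>2) \<le> k * (2 * E + \<alpha>\<^sup>2 * (m * M) + 2 * M)"
    using k by (intro mult_left_mono) auto
  moreover have "k * (2 * E + \<alpha>\<^sup>2 * (m * M) + 2 * M) = 2 * k * (E + M) + m / 2"
    using k(2) by (simp add: algebra_simps)
  moreover have "pi / (2 * k) = pi * \<alpha>\<^sup>2 * M" "2 * k * (E + M) = (E + M) / (\<alpha>\<^sup>2 * M)"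
    using M \<alpha> by (simp_all add: k_def field_simps)
  ultimately have "m / 2 \<le> M / (2 * pi) + pi * \<alpha>\<^sup>2 * M + (E + M) / (\<alpha>\<^sup>2 * M)" using y0M by linarith
  then have "m \<le> 2 * (M / (2 * pi) + pi * \<alpha>\<^sup>2 * M + (E + M) / (\<alpha>\<^sup>2 * M))"
    by (simp only: mult.commute[of 2] divide_le_eq_numeral1 if_True)
  then show ?thesis by (rule order_trans[OF le])
qed

lemma integral_uniform_limit:
  fixes f :: "nat \<Rightarrow> real \<Rightarrow> real"
  assumes "uniform_limit {a..b} f g sequentially" "\<And>n. continuous_on {a..b} (f n)"
  shows "(\<lambda>n. integral {a..b} (f n)) \<longlonglongrightarrow> integral {a..b} g"
proof -
  have ul: "uniform_limit (cbox a b) f g sequentially" using assms(1) by simp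
  have c: "continuous_on (cbox a b) (f n)" for n using assms(2) by simp
  obtain I J where IJ: "\<And>n. (f n has_integral I n) (cbox a b)" "(g has_integral J) (cbox a b)" "I \<longlonglongrightarrow> J"
    using uniform_limit_integral_cbox[OF ul c sequentially_bot] by metis
  have "(\<lambda>n. integral {a..b} (f n)) = I" "integral {a..b} g = J"
    using integral_unique[OF IJ(1)] integral_unique[OF IJ(2)] by auto
  then show ?thesis using IJ(3) by simp
qed

text \<open>Compactness: the bound on the second derivative makes the profiles and their derivatives
  equi-Lipschitz.\<close>

lemma steady_compactness:
  assumes st: "\<And>k. steady \<alpha> (V k) (V1 k) (r k)" and S: "\<And>k x. V k x \<le> S"
  obtains A B \<sigma> where "strict_mono (\<sigma> :: nat \<Rightarrow> nat)" "uniform_limit UNIV (\<lambda>k. V (\<sigma> k)) A sequentially"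
    "uniform_limit UNIV (\<lambda>k. V1 (\<sigma> k)) B sequentially" "circle_periodic A" "circle_periodic B"
proof -
  define L where "L = 2 + 2 * \<alpha>\<^sup>2 * S"
  have S0: "S \<ge> 0" using order_trans[OF steady.nonneg[OF st, of 0 0] S] .
  have L0: "L \<ge> 0" using S0 by (simp add: L_def)
  have lip1: "\<bar>V1 k x - V1 k y\<bar> \<le> L * \<bar>x - y\<bar>" for k x y
    unfolding L_def by (rule steady.V1_lipschitz[OF st S])
  have V1b: "\<bar>V1 k x\<bar> \<le> L * (2 * pi)" for k x
  proof -
    interpret steady \<alpha> "V k" "V1 k" "r k" by (rule st)
    have "V k pi = V k (- pi)" using per[unfolded circle_periodic_def, rule_format, of "-pi"] by simp
    \<comment> \<open>A periodic profile has a critical point, so the Lipschitz bound on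
      \<open>V1\<close> becomes a uniform bound.\<close>
    then obtain z where z: "-pi < z" "z < pi" "V1 k z = 0"
      using MVT2[of "-pi" pi "V k" "V1 k"] D by auto
    have "\<bar>V1 k (reduce 0 x) - V1 k z\<bar> \<le> L * \<bar>reduce 0 x - z\<bar>" by (rule lip1)
    also have "\<dots> \<le> L * (2 * pi)"
      using reduce_bounds[of 0 x] z L0 by (intro mult_left_mono) (auto simp: abs_le_iff)
    finally show ?thesis using z periodic_reduce[OF per1] by simp
  qed
  have lip: "\<bar>V k x - V k y\<bar> \<le> L * (2 * pi) * \<bar>x - y\<bar>" for k x y
  proof -
    interpret steady \<alpha> "V k" "V1 k" "r k" by (rule st)
    have "norm (V k x - V k y) \<le> L * (2 * pi) * norm (x - y)"
      by (rule field_differentiable_bound[of UNIV "V k" "V1 k"]) (use D V1b in auto)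
    then show ?thesis by simp
  qed
  define C where "C = L * (2 * pi) + L + 1"
  have "0 \<le> L * (2 * pi)" by (rule mult_nonneg_nonneg[OF L0]) simp
  then have C: "C > 0" using L0 unfolding C_def by linarith
  \<comment> \<open>Profile and derivative are paired, so that one application of Arzela-Ascoli
    gives a common subsequence.\<close>
  define F where "F = (\<lambda>k x. (V k x, V1 k x))"
  have nF: "norm (F k x - F k y) \<le> C * \<bar>x - y\<bar>" for k x y
  proof -
    have "norm (F k x - F k y) \<le> norm (V k x - V k y) + norm (V1 k x - V1 k y)"
      unfolding F_def by (simp add: norm_Pair sqrt_sum_squares_le_sum_abs)
    also have "\<dots> \<le> L * (2 * pi) * \<bar>x - y\<bar> + L * \<bar>x - y\<bar>" using lip[of k x y] lip1[of k x y] by simp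
    also have "\<dots> \<le> C * \<bar>x - y\<bar>" unfolding C_def by (simp add: algebra_simps)
    finally show ?thesis .
  qed
  have bF: "norm (F k x) \<le> S + L * (2 * pi)" for k x
  proof -
    have "norm (F k x) \<le> \<bar>V k x\<bar> + \<bar>V1 k x\<bar>" unfolding F_def by (simp add: norm_Pair sqrt_sum_squares_le_sum_abs)
    also have "\<dots> \<le> S + L * (2 * pi)" using S[of k x] V1b[of k x] steady.nonneg[OF st, of k x] by simp
    finally show ?thesis .
  qed
  obtain h \<sigma> where h: "strict_mono (\<sigma> :: nat \<Rightarrow> nat)"
    "\<And>e. 0 < e \<Longrightarrow> \<exists>N. \<forall>n x. n \<ge> N \<and> x \<in> period \<longrightarrow> norm (F (\<sigma> n) x - h x) < e"
  proof (rule Arzela_Ascoli[of period F "S + L * (2 * pi)"])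
    show "compact period" by simp
    show "norm (F n x) \<le> S + L * (2 * pi)" for n x by (rule bF)
    fix x e :: real assume e: "0 < e"
    show "\<exists>d>0. \<forall>n y. y \<in> period \<and> norm (x - y) < d \<longrightarrow> norm (F n x - F n y) < e"
    proof (intro exI conjI allI impI)
      show "0 < e / C" using e C by simp
      fix n y assume "y \<in> period \<and> norm (x - y) < e / C"
      then have "C * \<bar>x - y\<bar> < e" using C by (simp add: pos_less_divide_eq mult.commute)
      then show "norm (F n x - F n y) < e" using nF[of n x y] by linarith
    qed
  qed (use that in blast)
  define A B where "A = (\<lambda>x. fst (h (reduce 0 x)))" and "B = (\<lambda>x. snd (h (reduce 0 x)))"
  have near: "\<exists>N. \<forall>n\<ge>N. \<forall>x. \<bar>V (\<sigma> n) x - A x\<bar> < e \<and> \<bar>V1 (\<sigma> n) x - B x\<bar> < e" if e: "0 < e" for e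
  proof -
    obtain N where N: "\<And>n x. n \<ge> N \<Longrightarrow> x \<in> period \<Longrightarrow> norm (F (\<sigma> n) x - h x) < e" using h(2)[OF e] by blast
    have "\<bar>V (\<sigma> n) x - A x\<bar> < e \<and> \<bar>V1 (\<sigma> n) x - B x\<bar> < e" if n: "n \<ge> N" for n x
    proof -
      interpret steady \<alpha> "V (\<sigma> n)" "V1 (\<sigma> n)" "r (\<sigma> n)" by (rule st)
      have "reduce 0 x \<in> period" using reduce_bounds[of 0 x] by simp
      from N[OF n this] have *: "norm (F (\<sigma> n) (reduce 0 x) - h (reduce 0 x)) < e" .
      have "\<bar>V (\<sigma> n) (reduce 0 x) - A x\<bar> \<le> norm (F (\<sigma> n) (reduce 0 x) - h (reduce 0 x))"
        using norm_fst_le[of "fst (F (\<sigma> n) (reduce 0 x) - h (reduce 0 x))" "snd (F (\<sigma> n) (reduce 0 x) - h (reduce 0 x))"]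
        by (simp add: F_def A_def minus_prod_def)
      moreover have "\<bar>V1 (\<sigma> n) (reduce 0 x) - B x\<bar> \<le> norm (F (\<sigma> n) (reduce 0 x) - h (reduce 0 x))"
        using norm_snd_le[of "snd (F (\<sigma> n) (reduce 0 x) - h (reduce 0 x))" "fst (F (\<sigma> n) (reduce 0 x) - h (reduce 0 x))"]
        by (simp add: F_def B_def minus_prod_def)
      ultimately show ?thesis using * periodic_reduce[OF per] periodic_reduce[OF per1] by simp
    qed
    then show ?thesis by blast
  qed
  show ?thesis
  proof (rule that[OF h(1)])
    show "uniform_limit UNIV (\<lambda>k. V (\<sigma> k)) A sequentially" "uniform_limit UNIV (\<lambda>k. V1 (\<sigma> k)) B sequentially"
      unfolding uniform_limit_sequentially_iff dist_real_def using near by blast+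
    show "circle_periodic A" "circle_periodic B"
      unfolding A_def B_def by (rule periodic_compose_reduce)+
  qed
qed

text \<open>Since derivatives converge uniformly too, the energy is continuous along the sequence
  and not merely lower semicontinuous. The limit is recorded only as an \<open>ac\<close> pair,
  which is all that minimality needs.\<close>

lemma steady_limit:
  assumes st: "\<And>k. steady \<alpha> (V k) (V1 k) (r k)" and A: "uniform_limit UNIV V A sequentially" and B: "uniform_limit UNIV V1 B sequentially"
    and per: "circle_periodic A" "circle_periodic B"
  shows "ac A B" "continuous_on UNIV B" "\<And>x. 0 \<le> A x" "(\<lambda>k. integral period (V k)) \<longlonglongrightarrow> integral period A"
    "(\<lambda>k. en \<alpha> (V k) (V1 k)) \<longlonglongrightarrow> en \<alpha> A B"
proof -
  have cV: "continuous_on S (V k)" and cV1: "continuous_on S (V1 k)" for k S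
    using steady.contV[OF st] steady.contV1[OF st] by auto
  have cA: "continuous_on UNIV A" by (rule uniform_limit_theorem[OF _ A]) (use cV in auto)
  show cB: "continuous_on UNIV B" by (rule uniform_limit_theorem[OF _ B]) (use cV1 in auto)
  have cA': "continuous_on S A" and cB': "continuous_on S B" for S
    using cA cB continuous_on_subset by blast+
  have uA: "uniform_limit S V A sequentially" and uB: "uniform_limit S V1 B sequentially" for S
    using uniform_limit_on_subset[OF A] uniform_limit_on_subset[OF B] by auto
  have pA: "(\<lambda>k. V k x) \<longlonglongrightarrow> A x" for x by (rule tendsto_uniform_limitI[OF A]) simp
  show "0 \<le> A x" for x by (rule LIMSEQ_le_const[OF pA]) (use steady.nonneg[OF st] in auto)
  show "(\<lambda>k. integral period (V k)) \<longlonglongrightarrow> integral period A" by (rule integral_uniform_limit[OF uA cV])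
  show "ac A B" unfolding ac_def
  proof (intro conjI per allI impI)
    show "B absolutely_integrable_on period" by (intro absolutely_integrable_continuous_real cB')
    fix a b :: real assume ab: "a \<le> b"
    have "integral {a..b} (V1 k) = V k b - V k a" for k
    proof -
      interpret steady \<alpha> "V k" "V1 k" "r k" by (rule st)
      have "(V1 k has_integral V k b - V k a) {a..b}"
        by (rule fundamental_theorem_of_calculus[OF ab])
           (use D in \<open>auto simp: has_real_derivative_iff_has_vector_derivative[symmetric] intro: has_field_derivative_at_within\<close>)
      then show ?thesis by (rule integral_unique)
    qed
    moreover have "(\<lambda>k. integral {a..b} (V1 k)) \<longlonglongrightarrow> integral {a..b} B" by (rule integral_uniform_limit[OF uB cV1])
    moreover have "(\<lambda>k. V k b - V k a) \<longlonglongrightarrow> A b - A a" by (intro tendsto_diff pA)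
    ultimately show "A b - A a = integral {a..b} B" using LIMSEQ_unique by simp
  qed
  have bA: "bounded (A ` period)" "bounded (B ` period)" "bounded (cos ` period)"
    by (intro compact_imp_bounded compact_continuous_image cA' cB' continuous_intros; simp)+
  have uc: "uniform_limit period (\<lambda>k x. \<alpha>\<^sup>2) (\<lambda>x. \<alpha>\<^sup>2) sequentially" "uniform_limit period (\<lambda>k. cos) cos sequentially"
    by (rule uniform_limit_const)+
  have uAA: "uniform_limit period (\<lambda>k x. V k x * V k x) (\<lambda>x. A x * A x) sequentially"
    by (rule uniform_lim_mult[OF uA uA bA(1) bA(1)])
  have bAA: "bounded ((\<lambda>x. A x * A x) ` period)" "bounded ((\<lambda>x. \<alpha>\<^sup>2) ` period)"
    by (intro compact_imp_bounded compact_continuous_image cA' continuous_intros; simp)+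
  have u1: "uniform_limit period (\<lambda>k x. V1 k x * V1 k x - \<alpha>\<^sup>2 * (V k x * V k x)) (\<lambda>x. B x * B x - \<alpha>\<^sup>2 * (A x * A x)) sequentially"
    by (intro uniform_limit_minus uniform_lim_mult uB bA uc uAA bAA)
  have u2: "uniform_limit period (\<lambda>k x. V k x * cos x) (\<lambda>x. A x * cos x) sequentially"
    by (rule uniform_lim_mult[OF uA uc(2) bA(1) bA(3)])
  have "(\<lambda>k. integral period (\<lambda>x. V1 k x * V1 k x - \<alpha>\<^sup>2 * (V k x * V k x))) \<longlonglongrightarrow> integral period (\<lambda>x. B x * B x - \<alpha>\<^sup>2 * (A x * A x))"
    by (rule integral_uniform_limit[OF u1]) (intro continuous_intros cV cV1)
  moreover have "(\<lambda>k. integral period (\<lambda>x. V k x * cos x)) \<longlonglongrightarrow> integral period (\<lambda>x. A x * cos x)"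
    by (rule integral_uniform_limit[OF u2]) (intro continuous_intros cV)
  ultimately show "(\<lambda>k. en \<alpha> (V k) (V1 k)) \<longlonglongrightarrow> en \<alpha> A B"
    unfolding en_def power2_eq_square by (intro tendsto_intros)
qed

section \<open>Limits of wide steady states\<close>

text \<open>Moving away from 0 by \<open>l\<close>, or up to \<open>pi\<close> if that would
  overshoot, reaches a point at distance at least \<open>l\<close> from 0 on the circle. The cosine
  measures this distance without reference to a window.\<close>

lemma far_point:
  fixes c l :: real
  assumes c: "\<bar>c\<bar> \<le> pi" and l: "0 < l" "l \<le> pi"
  obtains x where "\<bar>x - c\<bar> \<le> l" "cos x \<le> cos l"
proof -
  have *: "\<exists>x. \<bar>x - c\<bar> \<le> l \<and> cos x \<le> cos l" if c: "0 \<le> c" "c \<le> pi" for c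
  proof (cases "c + l \<le> pi")
    case True
    then have "cos (c + l) \<le> cos l" using c l by (intro cos_monotone_0_pi_le) auto
    then show ?thesis using l by (intro exI[of _ "c + l"]) auto
  next
    case False
    have "cos pi \<le> cos l" by simp
    then show ?thesis using False c by (intro exI[of _ pi]) auto
  qed
  show ?thesis
  proof (cases "0 \<le> c")
    case True
    then show ?thesis using *[of c] c that by auto
  next
    case False
    then obtain x where "\<bar>x - (- c)\<bar> \<le> l" "cos x \<le> cos l" using *[of "- c"] c by auto
    then show ?thesis using that[of "- x"] by (simp add: abs_minus_commute)
  qed
qed

lemma (in droplet_state) vanish_out:
  assumes "cos y < cos l"
  shows "U y = 0" "U1 y = 0"
proof -
  obtain k :: int where k: "y = reduce 0 y + 2 * pi * of_int k" using reduce_shift by blast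
  have "cos (reduce 0 y) = cos y" using periodic_reduce[OF periodic_cos] .
  moreover have b: "\<bar>reduce 0 y\<bar> \<le> pi" using reduce_bounds[of 0 y] by auto
  ultimately have "\<not> \<bar>reduce 0 y\<bar> \<le> l"
    using assms cos_monotone_0_pi_le[of "\<bar>reduce 0 y\<bar>" l] l by (auto simp: cos_abs_real)
  then have "U (reduce 0 y) = 0" using U_out b by simp
  then show "U y = 0" using periodic_reduce[OF per] by simp
  then show "U1 y = 0" by (rule V1_zero)
qed

text \<open>A limit of wide profiles satisfies the differential equation across an interval longer than
  the droplet. Second differences eliminate the unknown multipliers.\<close>

lemma (in droplet_state) no_wide_limit:
  assumes st: "\<And>k. steady \<alpha> (V k) (V1 k) (r k)" and A: "uniform_limit UNIV V U sequentially" and B: "uniform_limit UNIV V1 U1 sequentially"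
    and wide: "\<And>k. steady.wide \<alpha> (V k) (c k)" and c: "\<And>k. \<bar>c k\<bar> \<le> pi" and lim: "c \<longlonglongrightarrow> c0" and \<alpha>1: "\<alpha> > 1"
  shows False
proof -
  define w where "w = pi / \<alpha>"
  have w: "l < w" "w \<le> pi" using drop \<alpha>1 \<alpha> by (auto simp: droplet_def w_def field_simps)
  \<comment> \<open>Midway between the droplet and the wide interval: a point chosen at this scale
    lies strictly outside the one and strictly inside the other.\<close>
  define l' where "l' = (l + w) / 2"
  have l': "l < l'" "l' < w" "0 < l'" "l' \<le> pi" using w l by (auto simp: l'_def)
  have c0: "\<bar>c0\<bar> \<le> pi"
    by (rule LIMSEQ_le_const2[OF tendsto_rabs[OF lim]]) (use c in auto)
  obtain x where x: "\<bar>x - c0\<bar> \<le> l'" "cos x \<le> cos l'" using far_point[OF c0 l'(3,4)] by blast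
  have "cos l' < cos l" using l l' by (intro cos_monotone_0_pi) auto
  then have "cos x < cos l" using x by linarith
  then have "eventually (\<lambda>y. cos y < cos l) (at x)"
    using isCont_cos[of x] by (intro order_tendstoD) (auto simp: isCont_def)
  then obtain \<eta> where \<eta>: "\<eta> > 0" "\<And>y. y \<noteq> x \<Longrightarrow> \<bar>y - x\<bar> < \<eta> \<Longrightarrow> cos y < cos l"
    by (auto simp: eventually_at dist_real_def)
  \<comment> \<open>One \<open>\<delta>\<close> covers the distance from \<open>x\<close>, the other
    the distance of \<open>c k\<close> from its limit; together they fit into the margin
    \<open>w - l'\<close>.\<close>
  define \<delta> where "\<delta> = min (min \<eta> (w - l')) 1 / 2"
  have \<delta>: "0 < \<delta>" "\<delta> < \<eta>" "2 * \<delta> \<le> w - l'" "\<delta> < 1" using \<eta> l' by (auto simp: \<delta>_def min_def)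
  have out: "U y = 0" "U1 y = 0" if "\<bar>y - x\<bar> \<le> \<delta>" for y
  proof -
    have "cos y < cos l" using \<eta>(2)[of y] that \<delta> \<open>cos x < cos l\<close> by (cases "y = x") auto
    then show "U y = 0" "U1 y = 0" using vanish_out by auto
  qed
  have sin0: "sin m = 0" if m: "\<bar>m - x\<bar> \<le> \<delta> / 2" for m
  proof -
    define h where "h = \<delta> / 2"
    have h: "0 < h" "h < pi" using \<delta> pi_gt3 by (auto simp: h_def)
    define s where "s = sin (m + h) - 2 * sin m + sin (m - h)"
    have "\<bar>s\<bar> \<le> (4 + 2 * \<alpha>\<^sup>2) * \<epsilon>" if \<epsilon>: "\<epsilon> > 0" for \<epsilon>
    proof -
      have "eventually (\<lambda>k. \<forall>y\<in>UNIV. dist (V k y) (U y) < \<epsilon>) sequentially" using A \<epsilon> by (rule uniform_limitD)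
      moreover have "eventually (\<lambda>k. \<forall>y\<in>UNIV. dist (V1 k y) (U1 y) < \<epsilon>) sequentially" using B \<epsilon> by (rule uniform_limitD)
      moreover have "eventually (\<lambda>k. dist (c k) c0 < \<delta>) sequentially" using lim \<delta>(1) by (rule tendstoD)
      ultimately have "eventually (\<lambda>k. (\<forall>y\<in>UNIV. dist (V k y) (U y) < \<epsilon>) \<and> (\<forall>y\<in>UNIV. dist (V1 k y) (U1 y) < \<epsilon>) \<and> dist (c k) c0 < \<delta>) sequentially"
        by eventually_elim blast
      then obtain k where k: "\<And>y. \<bar>V k y - U y\<bar> < \<epsilon>" "\<And>y. \<bar>V1 k y - U1 y\<bar> < \<epsilon>" "\<bar>c k - c0\<bar> < \<delta>"
        unfolding eventually_sequentially dist_real_def by blast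
      interpret V: steady \<alpha> "V k" "V1 k" "r k" by (rule st)
      have near: "\<bar>y - x\<bar> \<le> \<delta>" if "y \<in> {m - h..m + h}" for y
      proof -
        have "m - \<delta> / 2 \<le> y" "y \<le> m + \<delta> / 2" using that by (simp_all add: h_def)
        then show ?thesis using m by linarith
      qed
      have pos: "V k y > 0" if "\<bar>y - x\<bar> \<le> \<delta>" for y
      proof -
        have "\<bar>y - c k\<bar> \<le> pi / \<alpha>" using that x(1) k(3) \<delta>(3) unfolding w_def[symmetric] by linarith
        then show ?thesis using wide[of k] unfolding V.wide_def by blast
      qed
      have rc: "r k y = r k m" if "y \<in> {m - h..m + h}" for y
      proof -
        have "\<exists>q. \<forall>t\<in>{m - h..m + h}. r k t = q"
          by (rule has_field_derivative_zero_constant)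
             (use V.Dr[OF pos[OF near]] in \<open>auto intro: has_field_derivative_at_within\<close>)
        then obtain q where "\<forall>t\<in>{m - h..m + h}. r k t = q" by blast
        moreover have "m \<in> {m - h..m + h}" using h by simp
        ultimately show ?thesis using that by simp
      qed
      \<comment> \<open>Its derivative contains neither the multiplier nor the cosine and is small
        because \<open>V k\<close> is. The term linear in \<open>y\<close> disappears in a second
        difference, so only the second difference of the sine survives.\<close>
      define \<Theta> where "\<Theta> = (\<lambda>y. V1 k y + sin y - r k m * y)"
      have D\<Theta>: "(\<Theta> has_real_derivative - \<alpha>\<^sup>2 * V k y) (at y)" if "y \<in> {m - h..m + h}" for y
      proof -
        have "(V1 k has_real_derivative r k m - \<alpha>\<^sup>2 * V k y - cos y) (at y)"
          using V.D1[OF pos[OF near[OF that]]] rc[OF that] by simp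
        then show ?thesis unfolding \<Theta>_def by (auto intro!: derivative_eq_intros)
      qed
      have bd: "\<bar>\<Theta> y - \<Theta> z\<bar> \<le> \<alpha>\<^sup>2 * \<epsilon> * \<bar>y - z\<bar>" if yz: "y \<in> {m - h..m + h}" "z \<in> {m - h..m + h}" for y z
      proof -
        have "norm (\<Theta> y - \<Theta> z) \<le> \<alpha>\<^sup>2 * \<epsilon> * norm (y - z)"
        proof (rule field_differentiable_bound[of "{m - h..m + h}" \<Theta> "\<lambda>y. - \<alpha>\<^sup>2 * V k y", OF _ _ _ yz])
          fix t assume t: "t \<in> {m - h..m + h}"
          show "(\<Theta> has_real_derivative - \<alpha>\<^sup>2 * V k t) (at t within {m - h..m + h})"
            by (rule has_field_derivative_at_within[OF D\<Theta>[OF t]])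
          have "\<bar>V k t\<bar> \<le> \<epsilon>" using k(1)[of t] out(1)[OF near[OF t]] by simp
          then have "\<alpha>\<^sup>2 * \<bar>V k t\<bar> \<le> \<alpha>\<^sup>2 * \<epsilon>" by (rule mult_left_mono) simp
          then show "norm (- \<alpha>\<^sup>2 * V k t) \<le> \<alpha>\<^sup>2 * \<epsilon>" by (simp add: abs_mult)
        qed simp
        then show ?thesis by simp
      qed
      have e0: "0 \<le> \<alpha>\<^sup>2 * \<epsilon>" using \<epsilon> by simp
      have h1: "h \<le> 1" using \<delta> by (simp add: h_def)
      have "\<alpha>\<^sup>2 * \<epsilon> * h \<le> \<alpha>\<^sup>2 * \<epsilon> * 1" by (rule mult_left_mono[OF h1 e0])
      moreover have "\<bar>\<Theta> (m + h) - \<Theta> m\<bar> \<le> \<alpha>\<^sup>2 * \<epsilon> * h" "\<bar>\<Theta> m - \<Theta> (m - h)\<bar> \<le> \<alpha>\<^sup>2 * \<epsilon> * h"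
        using bd[of "m + h" m] bd[of m "m - h"] h by auto
      moreover have "s = (\<Theta> (m + h) - \<Theta> m) - (\<Theta> m - \<Theta> (m - h)) - V1 k (m + h) + 2 * V1 k m - V1 k (m - h)"
        unfolding s_def \<Theta>_def by (simp add: algebra_simps)
      moreover have "\<bar>V1 k y\<bar> < \<epsilon>" if "y \<in> {m - h..m + h}" for y
        using k(2)[of y] out(2)[OF near[OF that]] by simp
      then have "\<bar>V1 k (m + h)\<bar> < \<epsilon>" "\<bar>V1 k m\<bar> < \<epsilon>" "\<bar>V1 k (m - h)\<bar> < \<epsilon>" using h by auto
      \<comment> \<open>The weights 1, 2, 1 of the second difference of \<open>V1 k\<close> add up
        to 4; the remaining term comes from the two increments of \<open>\<Theta>\<close>.\<close>
      ultimately have "\<bar>s\<bar> \<le> 4 * \<epsilon> + 2 * (\<alpha>\<^sup>2 * \<epsilon>)" by linarith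
      then show ?thesis by (simp add: algebra_simps)
    qed
    note sb = this
    have "s = 0"
    proof (rule ccontr)
      assume "s \<noteq> 0"
      define q where "q = 4 + 2 * \<alpha>\<^sup>2"
      have q: "q > 0" unfolding q_def by (simp add: add_pos_nonneg)
      have "0 < \<bar>s\<bar> / (2 * q)" using \<open>s \<noteq> 0\<close> q by simp
      from sb[OF this] have "\<bar>s\<bar> \<le> \<bar>s\<bar> / 2" using q unfolding q_def[symmetric] by simp
      then show False using \<open>s \<noteq> 0\<close> by simp
    qed
    moreover have "s = - 2 * (1 - cos h) * sin m" unfolding s_def by (simp add: sin_add sin_diff algebra_simps)
    moreover have "cos h < 1" using cos_monotone_0_pi[of 0 h] h by simp
    ultimately show ?thesis by simp
  qed
  \<comment> \<open>The sine would vanish at two points less than \<open>pi\<close> apart.\<close>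
  have "sin x = 0" "sin (x + \<delta> / 2) = 0" using sin0[of x] sin0[of "x + \<delta> / 2"] \<delta> by auto
  then have "cos x * sin (\<delta> / 2) = 0" by (simp add: sin_add)
  moreover have "sin (\<delta> / 2) > 0" using \<delta> pi_gt3 by (intro sin_gt_zero) auto
  ultimately have "cos x = 0" by simp
  then show False using \<open>sin x = 0\<close> sin_cos_squared_add[of x] by simp
qed

text \<open>If every level above the minimum failed, the levels \<open>e + 1 / (real k + 1)\<close>
  would provide wide profiles with energies tending to the minimum. The energy bound makes them
  compact, and uniqueness identifies their limit with the droplet.\<close>

lemma energy_gap:
  assumes mi: "minimizer \<alpha> M U g" and ds: "droplet_state \<alpha> \<kappa> U U1 l" and \<alpha>1: "\<alpha> > 1"
  shows "\<exists>E. en \<alpha> U g < E \<and> (\<forall>V V1 r c. steady \<alpha> V V1 r \<longrightarrow> integral period V = M \<longrightarrow> steady.wide \<alpha> V c \<longrightarrow> E \<le> en \<alpha> V V1)"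
proof (rule ccontr)
  assume no: "\<not> ?thesis"
  interpret minimizer \<alpha> M U g by fact
  interpret ds: droplet_state \<alpha> \<kappa> U U1 l by fact
  define e where "e = en \<alpha> U g"
  have "\<exists>V V1 r c. steady \<alpha> V V1 r \<and> integral period V = M \<and> steady.wide \<alpha> V c \<and> en \<alpha> V V1 < e + 1 / (real k + 1)" for k
  proof (rule ccontr)
    assume neg: "\<not> ?thesis"
    have "e + 1 / (real k + 1) \<le> en \<alpha> V V1" if "steady \<alpha> V V1 r" "integral period V = M" "steady.wide \<alpha> V c" for V V1 r c
    proof (rule ccontr)
      assume "\<not> e + 1 / (real k + 1) \<le> en \<alpha> V V1"
      then have "en \<alpha> V V1 < e + 1 / (real k + 1)" by simp
      then show False using neg that by blast
    qed
    moreover have "e < e + 1 / (real k + 1)" by simp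
    ultimately show False using no unfolding e_def by blast
  qed
  note ex = this
  define Q where "Q = (\<lambda>k V V1 r c. steady \<alpha> V V1 r \<and> integral period V = M \<and> steady.wide \<alpha> V c \<and> en \<alpha> V V1 < e + 1 / (real (k::nat) + 1))"
  have "\<forall>k. \<exists>V V1 r c. Q k V V1 r c" unfolding Q_def using ex by (rule allI)
  then obtain V V1 r c where "\<forall>k. Q k (V k) (V1 k) (r k) (c k)" by metis
  then have st: "\<And>k. steady \<alpha> (V k) (V1 k) (r k)" and mV: "\<And>k. integral period (V k) = M" and wd: "\<And>k. steady.wide \<alpha> (V k) (c k)"
    and eV: "\<And>k. en \<alpha> (V k) (V1 k) < e + 1 / (real k + 1)" unfolding Q_def by blast+
  \<comment> \<open>The constant of \<open>sup_bound\<close> for the common energy bound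
    \<open>e + 1\<close>.\<close>
  define S where "S = 2 * (M / (2 * pi) + pi * \<alpha>\<^sup>2 * M + (e + 1 + M) / (\<alpha>\<^sup>2 * M))"
  have S: "V k x \<le> S" for k x
    unfolding S_def
  proof (rule steady.sup_bound[OF st M mV])
    have "1 / (real k + 1) \<le> 1" by simp
    then show "en \<alpha> (V k) (V1 k) \<le> e + 1" using eV[of k] by linarith
  qed
  \<comment> \<open>Centres are moved into one period, so that a subsequence of them
    converges.\<close>
  define c' where "c' = (\<lambda>k. reduce 0 (c k))"
  have c'b: "\<bar>c' k\<bar> \<le> pi" for k using reduce_bounds[of 0 "c k"] by (auto simp: c'_def)
  have wd': "steady.wide \<alpha> (V k) (c' k)" for k
  proof -
    interpret V: steady \<alpha> "V k" "V1 k" "r k" by (rule st)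
    obtain j :: int where j: "c k = c' k + 2 * pi * of_int j" using reduce_shift unfolding c'_def by blast
    show ?thesis unfolding V.wide_def
    proof (intro allI impI)
      fix x assume "\<bar>x - c' k\<bar> \<le> pi / \<alpha>"
      then have "\<bar>(x + 2 * pi * of_int j) - c k\<bar> \<le> pi / \<alpha>" by (simp add: j)
      then have "V k (x + 2 * pi * of_int j) > 0" using wd[of k] unfolding V.wide_def by blast
      then show "V k x > 0" using periodic_int[OF V.per] by simp
    qed
  qed
  obtain A B \<sigma> where \<sigma>: "strict_mono (\<sigma> :: nat \<Rightarrow> nat)" and uA: "uniform_limit UNIV (\<lambda>k. V (\<sigma> k)) A sequentially"
    and uB: "uniform_limit UNIV (\<lambda>k. V1 (\<sigma> k)) B sequentially" and pAB: "circle_periodic A" "circle_periodic B"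
    by (rule steady_compactness[OF st S])
  note lim = steady_limit[OF st uA uB pAB]
  have mA: "integral period A = M" using lim(4) mV by (simp add: LIMSEQ_const_iff)
  have BL: "B \<in> L2_circle" by (rule L2_circleI_continuous[OF pAB(2) lim(2)])
  have "en \<alpha> A B \<le> e"
  proof (rule LIMSEQ_le[OF lim(5)])
    have "(\<lambda>k. e + inverse (real (Suc k))) \<longlonglongrightarrow> e + 0" by (intro tendsto_intros LIMSEQ_inverse_real_of_nat)
    then show "(\<lambda>k. e + inverse (real (Suc k))) \<longlonglongrightarrow> e" by simp
    have "en \<alpha> (V (\<sigma> k)) (V1 (\<sigma> k)) \<le> e + inverse (real (Suc k))" for k
    proof -
      have "k \<le> \<sigma> k" by (rule strict_mono_imp_increasing[OF \<sigma>])
      then have "1 / (real (\<sigma> k) + 1) \<le> 1 / (real k + 1)" by (intro divide_left_mono) auto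
      then show ?thesis using eV[of "\<sigma> k"] by (simp add: inverse_eq_divide add.commute)
    qed
    then show "\<exists>N. \<forall>k\<ge>N. en \<alpha> (V (\<sigma> k)) (V1 (\<sigma> k)) \<le> e + inverse (real (Suc k))" by (intro exI allI impI)
  qed
  then have "en \<alpha> A B = en \<alpha> U g" using min[OF lim(1) BL lim(3) mA] by (simp add: e_def)
  then have AU: "A = U" by (rule uniq[OF lim(1) BL lim(3) mA])
  have "B x = U1 x" for x
  proof -
    have "(A has_real_derivative B x) (at x)"
      by (rule deriv_of_integral[of "x - 1" x "x + 1"]) (use acD(5)[OF lim(1)] continuous_on_subset[OF lim(2)] in auto)
    from DERIV_unique[OF this[unfolded AU] ds.D] show ?thesis .
  qed
  then have BU: "B = U1" by (rule ext)
  obtain c0 \<tau> where \<tau>: "strict_mono (\<tau> :: nat \<Rightarrow> nat)" "((\<lambda>k. c' (\<sigma> k)) \<circ> \<tau>) \<longlonglongrightarrow> c0"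
  proof -
    have "seq_compact period" by (simp add: compact_imp_seq_compact)
    moreover have "\<forall>k. c' (\<sigma> k) \<in> period"
    proof
      fix k show "c' (\<sigma> k) \<in> period" using c'b[of "\<sigma> k"] by auto
    qed
    ultimately obtain c0 \<tau> where "strict_mono (\<tau> :: nat \<Rightarrow> nat)" "((\<lambda>k. c' (\<sigma> k)) \<circ> \<tau>) \<longlonglongrightarrow> c0"
      by (rule seq_compactE)
    then show ?thesis by (rule that)
  qed
  have f\<tau>: "filterlim \<tau> sequentially sequentially" using \<tau>(1) by (rule filterlim_subseq)
  show False
  proof (rule ds.no_wide_limit[of "\<lambda>k. V (\<sigma> (\<tau> k))" "\<lambda>k. V1 (\<sigma> (\<tau> k))" "\<lambda>k. r (\<sigma> (\<tau> k))" "\<lambda>k. c' (\<sigma> (\<tau> k))" c0])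
    show "uniform_limit UNIV (\<lambda>k. V (\<sigma> (\<tau> k))) U sequentially"
      using filterlim_compose[OF uA f\<tau>] unfolding AU .
    show "uniform_limit UNIV (\<lambda>k. V1 (\<sigma> (\<tau> k))) U1 sequentially"
      using filterlim_compose[OF uB f\<tau>] unfolding BU .
    show "(\<lambda>k. c' (\<sigma> (\<tau> k))) \<longlonglongrightarrow> c0" using \<tau>(2) by (simp add: o_def)
  qed (rule st wd' c'b \<alpha>1)+
qed

theorem theorem3p5:
  fixes M \<alpha> n :: real and ustar :: "real \<Rightarrow> real"
  assumes "M > 0" and "\<alpha> > 0" and "n > 0"
    and "unique_minimizer \<alpha> M ustar"
  shows "(\<alpha> \<le> 1 \<longrightarrow>
            strong_steady_state \<alpha> n M ustar \<and> zero_dissipation \<alpha> n ustar \<and>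
            (\<forall>v. strong_steady_state \<alpha> n M v \<and> zero_dissipation \<alpha> n v \<longrightarrow>
                 (AE x in lebesgue. v x = ustar x)))
       \<and> (\<alpha> > 1 \<longrightarrow>
            (\<exists>E\<^sub>1::real. ereal E\<^sub>1 > energy \<alpha> ustar \<and>
               strong_steady_state \<alpha> n M ustar \<and> zero_dissipation \<alpha> n ustar \<and>
               (\<forall>v. strong_steady_state \<alpha> n M v \<and> zero_dissipation \<alpha> n v \<and>
                    energy \<alpha> v < ereal E\<^sub>1 \<longrightarrow>
                    (AE x in lebesgue. v x = ustar x))))"
proof -
  obtain U g where mi: "minimizer \<alpha> M U g" and ae: "AE x in lebesgue. U x = ustar x" and eu: "energy \<alpha> ustar = ereal (en \<alpha> U g)"
    using unique_minimizer_rep[OF assms(4,2,1)] by blast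
  interpret minimizer \<alpha> M U g by (rule mi)
  obtain \<kappa> where st: "steady \<alpha> U (deriv U) (\<lambda>x. \<kappa>)" using minimizer_steady by blast
  interpret U: steady \<alpha> U "deriv U" "\<lambda>x. \<kappa>" by (rule st)
  have mass_pos: "\<exists>x. V x > 0" if "steady \<alpha> V V1 r" "integral period V = M" for V V1 r
  proof (rule ccontr)
    assume "\<not> ?thesis"
    then have "V = (\<lambda>x. 0)" using steady.nonneg[OF that(1)] by (auto simp: not_less intro!: ext antisym)
    then show False using that(2) assms(1) by simp
  qed
  obtain x0 where "U x0 > 0" using mass_pos[OF st mass] by blast
  \<comment> \<open>The wide alternative comes with \<open>\<alpha> > 1\<close>, where
    \<open>not_wide\<close> rules it out for the minimizer; so the minimizer is a droplet in both
    regimes.\<close>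
  then obtain l where l: "U.droplet l" using U.droplet_or_wide not_wide unfolding U.wide_def by blast
  have ds: "droplet_state \<alpha> \<kappa> U (deriv U) l" by (rule droplet_state.intro[OF st droplet_state_axioms.intro[OF l]])
  have mc: "ustar \<in> mass_class M" using assms(4) by (simp add: unique_minimizer_def)
  have L2: "ustar \<in> L2_circle" using mc by (simp add: mass_class_def)
  have ss: "strong_steady_state \<alpha> n M ustar" by (rule droplet_state.strong_steady[OF ds ae mc assms(3)])
  have zd: "zero_dissipation \<alpha> n ustar" by (rule droplet_state.zero_diss[OF ds ae L2])
  have uniq_droplet: "AE x in lebesgue. v x = ustar x"
    if "steady \<alpha> V V1 r" "integral period V = M" "AE x in lebesgue. V x = v x" "steady.droplet \<alpha> V V1 m" for v V V1 r m
  proof -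
    have "V = U" by (rule droplet_unique[OF that(1) st that(4) l]) (use that(2) mass in simp)
    then show ?thesis using that(3) ae by (auto elim: eventually_elim2)
  qed
  show ?thesis
  proof (intro conjI impI)
    assume \<alpha>1: "\<alpha> \<le> 1"
    show "strong_steady_state \<alpha> n M ustar" by (rule ss)
    show "zero_dissipation \<alpha> n ustar" by (rule zd)
    show "\<forall>v. strong_steady_state \<alpha> n M v \<and> zero_dissipation \<alpha> n v \<longrightarrow> (AE x in lebesgue. v x = ustar x)"
    proof (intro allI impI)
      fix v assume v: "strong_steady_state \<alpha> n M v \<and> zero_dissipation \<alpha> n v"
      obtain V V1 r where V: "steady \<alpha> V V1 r" "AE x in lebesgue. V x = v x" "integral period V = M"
        using strong_steady_classical[OF assms(2)] v by metis
      obtain m where "steady.droplet \<alpha> V V1 m"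
        using steady.droplet_or_wide[OF V(1)] mass_pos[OF V(1,3)] \<alpha>1 by fastforce
      then show "AE x in lebesgue. v x = ustar x" by (rule uniq_droplet[OF V(1,3,2)])
    qed
  next
    assume \<alpha>1: "1 < \<alpha>"
    obtain E where E: "en \<alpha> U g < E"
      "\<And>V V1 r c. steady \<alpha> V V1 r \<Longrightarrow> integral period V = M \<Longrightarrow> steady.wide \<alpha> V c \<Longrightarrow> E \<le> en \<alpha> V V1"
      using energy_gap[OF mi ds \<alpha>1] by blast
    show "\<exists>E\<^sub>1::real. ereal E\<^sub>1 > energy \<alpha> ustar \<and>
               strong_steady_state \<alpha> n M ustar \<and> zero_dissipation \<alpha> n ustar \<and>
               (\<forall>v. strong_steady_state \<alpha> n M v \<and> zero_dissipation \<alpha> n v \<and>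
                    energy \<alpha> v < ereal E\<^sub>1 \<longrightarrow> (AE x in lebesgue. v x = ustar x))"
    proof (intro exI[of _ E] conjI ss zd allI impI)
      show "ereal E > energy \<alpha> ustar" using E(1) eu by simp
      fix v assume v: "strong_steady_state \<alpha> n M v \<and> zero_dissipation \<alpha> n v \<and> energy \<alpha> v < ereal E"
      obtain V V1 r where V: "steady \<alpha> V V1 r" "AE x in lebesgue. V x = v x" "integral period V = M" "energy \<alpha> v = ereal (en \<alpha> V V1)"
        using strong_steady_classical[OF assms(2)] v by metis
      \<comment> \<open>Below the level \<open>E\<close> the wide alternative is excluded by energy,
        which leaves the droplet.\<close>
      have "\<not> steady.wide \<alpha> V c" for c using E(2)[OF V(1,3)] v V(4) by force
      then obtain m where "steady.droplet \<alpha> V V1 m"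
        using steady.droplet_or_wide[OF V(1)] mass_pos[OF V(1,3)] by blast
      then show "AE x in lebesgue. v x = ustar x" by (rule uniq_droplet[OF V(1,3,2)])
    qed
  qed
qed

end
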